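(* Suppose that: (1) the undirected graph $\mathcal G$ is connected; (2) $\mathbb X^*\neq\emptyset$ and $f^*>-\infty$; (3) for every $i\in[n]$ and almost all $\xi_i$, $F_i(\cdot,\xi_i)$ is smooth with constant $L_f>0$, i.e., differentiable with $L_f$-Lipschitz gradient; (4) there exist constants $\sigma_0,\sigma_1$ such that $\mathbf E_{\xi_i}[\|\nabla_xF_i(x,\xi_i)-\nabla f_i(x)\|^2]\le\sigma_0^2\|\nabla f_i(x)\|^2+\sigma_1^2$ for all $i\in[n]$, $x\in\mathbb R^p$; (5) $f$ satisfies the Polyak–Łojasiewicz condition with constant $\nu>0$: $\frac12\|\nabla f(x)\|^2\ge\nu(f(x)-f^* )$ for all $x\in\mathbb R^p$, and $\nu$ is known in advance; (6) $f_i^*>-\infty$ for each $i\in[n]$, where $f_i^*=\min_{x\in\mathbb R^p}f_i(x)$. Let $\{x_{i,k}\}$ be the sequence generated by Algorithm 1 with $$\alpha_k=\kappa_1\beta_k,\quad\beta_k=\kappa_0(k+t_1),\quad\eta_k=\frac{\kappa_2}{\beta_k},\quad \delta_{i,k}\le\frac{\kappa_\delta\sqrt{p\eta_k}}{\sqrt{n+p}},\quad\forall k\in\mathbb N_0,$$ where $\kappa_1>c_1$, $\kappa_2\in(0,c_2(\kappa_1))$, $\kappa_0\in[\frac{3\hat c_0\nu\kappa_2}{16},\frac{3\nu\kappa_2}{16})$, $t_1\ge\check c_3(\kappa_0,\kappa_1,\kappa_2)$, $\kappa_\delta>0$ and $\hat c_0\in(0,1)$. Then, for any $T\in\mathbb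 N_+$, $$\mathbf E\Big[\frac1n\sum_{i=1}^n\|x_{i,T}-\bar x_T\|^2\Big]=\mathcal O\Big(\frac p{T^2}\Big),\qquad \mathbf E[f(\bar x_T)-f^*]=\mathcal O\Big(\frac p{nT}\Big)+\mathcal O\Big(\frac p{T^2}\Big),$$ where $\bar x_k=\frac1n\sum_{i=1}^nx_{i,k}$. Moreover, the omitted constants in the first term $\mathcal O(\frac p{nT})$ on the right-hand side of the second bound do not depend on any parameters related to the communication network.
   Context: Problem: $n$ agents, $[n]=\{1,\dots,n\}$. For each $i\in[n]$, $\xi_i$ is a random variable and $F_i(\cdot,\xi_i):\mathbb R^p\to\mathbb R$ a stochastic function (not necessarily convex); $f_i(x)=\mathbf E_{\xi_i}[F_i(x,\xi_i)]$, $f(x)=\frac1n\sum_{i=1}^nf_i(x)$, $f^*=\min_{x\in\mathbb R^p}f(x)$, $\mathbb X^*$ is the set of minimizers of $f$. Network: $\mathcal G=([n],\mathcal E)$ is an undirected graph with symmetric weights $a_{ij}>0$ if $(i,j)\in\mathcal E$, $a_{ij}=0$ otherwise, $a_{ii}=0$; $L=(L_{ij})$ is the weighted Laplacian, $L=\mathrm{diag}(\sum_ja_{1j},\dots,\sum_ja_{nj})-(a_{ij})$. $\rho(\cdot)$ is the spectral radius and $\rho_2(L)$ the minimum positive eigenvalue of $L$. $\|\cdot\|$ is the Euclidean norm. $\mathbb N_+$: positive integers; $\mathbb N_0$: nonnegative integers. Algorithm 1 (distributed zeroth-order primal–dual algorithm): given positive sequences $\{\alpha_k\},\{\beta_k\},\{\eta_k\},\{\delta_{i,k}\}$,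 initial points $x_{i,0}\in\mathbb R^p$ and $v_{i,0}=\mathbf 0_p$, at each iteration $k$ each agent $i$ draws $u_{i,k}$ uniformly from the unit sphere $\mathbb S^p$ of $\mathbb R^p$ and $\xi_{i,k}$ from the distribution of $\xi_i$ (all $u_{i,k},\xi_{j,l}$ mutually independent), sets $$g^e_{i,k}=\frac{p\,(F_i(x_{i,k}+\delta_{i,k}u_{i,k},\xi_{i,k})-F_i(x_{i,k},\xi_{i,k}))}{\delta_{i,k}}u_{i,k},$$ and updates $x_{i,k+1}=x_{i,k}-\eta_k(\alpha_k\sum_{j=1}^nL_{ij}x_{j,k}+\beta_kv_{i,k}+g^e_{i,k})$, $v_{i,k+1}=v_{i,k}+\eta_k\beta_k\sum_{j=1}^nL_{ij}x_{j,k}$. Constants: $c_1=\frac1{\rho_2(L)}+1$, $c_2(\kappa_1)=\min\{\frac{\varepsilon_2}{\varepsilon_3},\frac15\}$, $\kappa_3=\frac1{\rho_2(L)}+\kappa_1+1$, $\kappa_4=\frac1{\rho_2(L)}+\kappa_1$, $\varepsilon_2=(\kappa_1-1)\rho_2(L)-1$, $\varepsilon_3=\rho(L)+(2\kappa_1^2+1)\rho(L^2)+1$, $\varepsilon_4=\frac12(\varepsilon_2\kappa_2-\varepsilon_3\kappa_2^2)$, $\varepsilon_5=\frac12-\kappa_1\kappa_2\rho_2(L)+\kappa_2^2\rho(L)+\frac12(1+3\kappa_1\kappa_2+2\kappa_2)\kappa_1\kappa_2\rho(L^2)$, $\varepsilon_6=\frac14(\kappa_2-5\kappa_2^2)$,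 $\varepsilon_8=\kappa_4+\kappa_1\kappa_2+3\kappa_2^2+\kappa_2\kappa_4$, $\check\varepsilon_1=\max\{1+3L_f^2,\ (8+4p(1+\sigma_0^2)(6+L_f))^{1/2}L_f,\ p\kappa_3\}$, $$\check\varepsilon_7=4(6+5\kappa_2+2\kappa_4+8\kappa_2\kappa_4)\kappa_2L_f^4+\frac{(1+2L_f^2)\kappa_2}{2p(1+\sigma_0^2)}+\Big(\frac5{p(1+\sigma_0^2)}+16\Big)L_f^2\kappa_2^2,$$ $\check\varepsilon_{10}=10+L_f+\frac1{\kappa_2}(2\kappa_4+1)L_f^2+(8\kappa_4+5)L_f^2$, and $$\check c_3(\kappa_0,\kappa_1,\kappa_2)=\max\Big\{\frac2{3\varepsilon_4},\ \frac2{3\varepsilon_6},\ \frac{\check\varepsilon_1}{\kappa_0},\ \frac{2\varepsilon_5}{\kappa_0\varepsilon_4},\ \Big(\frac{2p(1+\sigma_0^2)\check\varepsilon_7}{\kappa_0^2\varepsilon_4}\Big)^{1/3},\ \Big(\frac{\varepsilon_8}{2\kappa_0\varepsilon_6}\Big)^{1/2},\ \frac{16L_f\kappa_3}{\nu\kappa_2},\ \Big(\frac{16L_f\kappa_4}{\nu\kappa_0\kappa_2}\Big)^{1/3},\ \frac{64p(1+\sigma_0^2)L_f\kappa_2\check\varepsilon_{10}}{\nu\kappa_0},\ \frac{p(1+\sigma_0^2)\kappa_2\check\varepsilon_{10}}{4\kappa_0}\Big\}.$$ *)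

theory Defs
  imports "HOL-Probability.Probability" "Jordan_Normal_Form.Spectral_Radius"
begin

text \<open>
  The dimension p is quantified inside the statement (the bounds are uniform in it), so vectors of
  $R^p$ are the functions in \<open>space (RV p)\<close>, i.e. the extensional functions on \<open>{..<p}\<close>.
  Agents are numbered \<open>0, \<dots>, n - 1\<close>.
\<close>

abbreviation RV :: "nat \<Rightarrow> (nat \<Rightarrow> real) measure" where
  "RV p \<equiv> Pi\<^sub>M {..<p} (\<lambda>_. borel)"

abbreviation Rp :: "nat \<Rightarrow> (nat \<Rightarrow> real) set" where
  "Rp p \<equiv> {..<p} \<rightarrow>\<^sub>E UNIV"

lemma space_RV: "space (RV p) = Rp p"
  by (simp add: space_PiM)

definition nrm :: "nat \<Rightarrow> (nat \<Rightarrow> real) \<Rightarrow> real" where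
  "nrm p x = L2_set x {..<p}"

definition has_grad :: "nat \<Rightarrow> ((nat \<Rightarrow> real) \<Rightarrow> real) \<Rightarrow> (nat \<Rightarrow> real) \<Rightarrow> (nat \<Rightarrow> real) \<Rightarrow> bool" where
  "has_grad p \<phi> g x \<longleftrightarrow> g \<in> Rp p \<and>
     (\<forall>e>0. \<exists>d>0. \<forall>y\<in>Rp p. nrm p (\<lambda>j. y j - x j) < d \<longrightarrow>
        \<bar>\<phi> y - \<phi> x - (\<Sum>j<p. g j * (y j - x j))\<bar> \<le> e * nrm p (\<lambda>j. y j - x j))"

definition grad :: "nat \<Rightarrow> ((nat \<Rightarrow> real) \<Rightarrow> real) \<Rightarrow> (nat \<Rightarrow> real) \<Rightarrow> nat \<Rightarrow> real" where
  "grad p \<phi> x = (THE g. has_grad p \<phi> g x)"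

definition smooth_fun :: "nat \<Rightarrow> real \<Rightarrow> ((nat \<Rightarrow> real) \<Rightarrow> real) \<Rightarrow> bool" where
  "smooth_fun p Lf \<phi> \<longleftrightarrow>
     (\<forall>x\<in>Rp p. \<exists>g. has_grad p \<phi> g x) \<and>
     (\<forall>x\<in>Rp p. \<forall>y\<in>Rp p.
        nrm p (\<lambda>j. grad p \<phi> x j - grad p \<phi> y j) \<le> Lf * nrm p (\<lambda>j. x j - y j))"

text \<open>The uniform distribution on the unit sphere: the radial projection of the uniform
  distribution on the unit ball.\<close>

definition unif_sphere :: "nat \<Rightarrow> (nat \<Rightarrow> real) measure" where
  "unif_sphere p =
     distr (uniform_measure (Pi\<^sub>M {..<p} (\<lambda>_. lborel)) {x \<in> Rp p. nrm p x \<le> 1}) (RV p)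
       (\<lambda>x. \<lambda>j\<in>{..<p}. x j / nrm p x)"


subsection \<open>Objective\<close>

text \<open>\<open>D i\<close> is the distribution of \<open>\<xi>\<^sub>i\<close>.\<close>

definition local_obj ::
    "(nat \<Rightarrow> (nat \<Rightarrow> real) \<Rightarrow> 'z \<Rightarrow> real) \<Rightarrow> (nat \<Rightarrow> 'z measure) \<Rightarrow> nat \<Rightarrow> (nat \<Rightarrow> real) \<Rightarrow> real" where
  "local_obj F D i x = (\<integral>z. F i x z \<partial>D i)"

definition global_obj ::
    "nat \<Rightarrow> (nat \<Rightarrow> (nat \<Rightarrow> real) \<Rightarrow> 'z \<Rightarrow> real) \<Rightarrow> (nat \<Rightarrow> 'z measure) \<Rightarrow> (nat \<Rightarrow> real) \<Rightarrow> real" where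
  "global_obj n F D x = (\<Sum>i<n. local_obj F D i x) / real n"

definition infval :: "nat \<Rightarrow> ((nat \<Rightarrow> real) \<Rightarrow> real) \<Rightarrow> real" where
  "infval p \<phi> = (INF x\<in>Rp p. \<phi> x)"

definition minimizers :: "nat \<Rightarrow> ((nat \<Rightarrow> real) \<Rightarrow> real) \<Rightarrow> (nat \<Rightarrow> real) set" where
  "minimizers p \<phi> = {x \<in> Rp p. \<forall>y\<in>Rp p. \<phi> x \<le> \<phi> y}"

definition stochastic_objectives ::
    "nat \<Rightarrow> nat \<Rightarrow> (nat \<Rightarrow> (nat \<Rightarrow> real) \<Rightarrow> 'z \<Rightarrow> real) \<Rightarrow> (nat \<Rightarrow> 'z measure) \<Rightarrow> bool" where
  "stochastic_objectives n p F D \<longleftrightarrow>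
     (\<forall>i<n. prob_space (D i) \<and>
        (\<lambda>(x, z). F i x z) \<in> borel_measurable (RV p \<Otimes>\<^sub>M D i) \<and>
        (\<forall>x\<in>Rp p. integrable (D i) (F i x)))"

text \<open>The variance is a nonnegative integral, so that the bound includes its finiteness.\<close>

definition bounded_variance ::
    "nat \<Rightarrow> nat \<Rightarrow> (nat \<Rightarrow> (nat \<Rightarrow> real) \<Rightarrow> 'z \<Rightarrow> real) \<Rightarrow> (nat \<Rightarrow> 'z measure) \<Rightarrow> real \<Rightarrow> real \<Rightarrow> bool" where
  "bounded_variance n p F D \<sigma>\<^sub>0 \<sigma>\<^sub>1 \<longleftrightarrow>
     (\<forall>i<n. \<forall>x\<in>Rp p.
        (\<integral>\<^sup>+ z. ennreal ((nrm p (\<lambda>j. grad p (\<lambda>y. F i y z) x j - grad p (local_obj F D i) x j))\<^sup>2) \<partial>D i)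
        \<le> ennreal (\<sigma>\<^sub>0\<^sup>2 * (nrm p (grad p (local_obj F D i) x))\<^sup>2 + \<sigma>\<^sub>1\<^sup>2))"

definition PL_condition :: "nat \<Rightarrow> ((nat \<Rightarrow> real) \<Rightarrow> real) \<Rightarrow> real \<Rightarrow> bool" where
  "PL_condition p \<phi> \<nu> \<longleftrightarrow>
     (\<forall>x\<in>Rp p. 1/2 * (nrm p (grad p \<phi> x))\<^sup>2 \<ge> \<nu> * (\<phi> x - infval p \<phi>))"


subsection \<open>Network\<close>

definition network :: "nat \<Rightarrow> (nat \<times> nat) set \<Rightarrow> (nat \<Rightarrow> nat \<Rightarrow> real) \<Rightarrow> bool" where
  "network n E a \<longleftrightarrow>
     E \<subseteq> {..<n} \<times> {..<n} \<and> sym E \<and>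
     (\<forall>i<n. \<forall>j<n. a i j = a j i \<and> (if (i, j) \<in> E then a i j > 0 else a i j = 0)) \<and>
     (\<forall>i<n. a i i = 0)"

definition connected_network :: "nat \<Rightarrow> (nat \<times> nat) set \<Rightarrow> bool" where
  "connected_network n E \<longleftrightarrow> (\<forall>i<n. \<forall>j<n. (i, j) \<in> E\<^sup>*)"

definition laplacian :: "nat \<Rightarrow> (nat \<Rightarrow> nat \<Rightarrow> real) \<Rightarrow> real mat" where
  "laplacian n a = mat n n (\<lambda>(i, j). (if i = j then \<Sum>l<n. a i l else 0) - a i j)"

definition rho :: "real mat \<Rightarrow> real" where
  "rho A = spectral_radius (map_mat complex_of_real A)"

text \<open>For a connected network the set below is nonempty exactly when \<open>n \<ge> 2\<close>; for \<open>n = 1\<close>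
  the Laplacian is zero and \<open>Min\<close> is unspecified.\<close>

definition rho2 :: "real mat \<Rightarrow> real" where
  "rho2 A = Min {l. eigenvalue A l \<and> 0 < l}"


subsection \<open>Algorithm\<close>

text \<open>All \<open>u i k\<close> and \<open>\<xi> i k\<close> together are mutually independent. They take values in different
  types, so independence is stated for the generated \<open>\<sigma>\<close>-algebras.\<close>

definition sampling ::
    "nat \<Rightarrow> nat \<Rightarrow> (nat \<Rightarrow> 'z measure) \<Rightarrow> 'w measure \<Rightarrow>
     (nat \<Rightarrow> nat \<Rightarrow> 'w \<Rightarrow> nat \<Rightarrow> real) \<Rightarrow> (nat \<Rightarrow> nat \<Rightarrow> 'w \<Rightarrow> 'z) \<Rightarrow> bool" where
  "sampling n p D M u \<xi> \<longleftrightarrow>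
     prob_space M \<and>
     (\<forall>i<n. \<forall>k. u i k \<in> M \<rightarrow>\<^sub>M RV p \<and> distr M (RV p) (u i k) = unif_sphere p) \<and>
     (\<forall>i<n. \<forall>k. \<xi> i k \<in> M \<rightarrow>\<^sub>M D i \<and> distr M (D i) (\<xi> i k) = D i) \<and>
     prob_space.indep_sets M
       (case_sum (\<lambda>(i, k). {u i k -` A \<inter> space M |A. A \<in> sets (RV p)})
                 (\<lambda>(i, k). {\<xi> i k -` A \<inter> space M |A. A \<in> sets (D i)}))
       (({..<n} \<times> UNIV) <+> ({..<n} \<times> UNIV))"

definition grad_est ::
    "nat \<Rightarrow> ((nat \<Rightarrow> real) \<Rightarrow> 'z \<Rightarrow> real) \<Rightarrow> real \<Rightarrow> (nat \<Rightarrow> real) \<Rightarrow> (nat \<Rightarrow> real) \<Rightarrow> 'z \<Rightarrow> nat \<Rightarrow> real" where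
  "grad_est p \<Phi> d x u z =
     (\<lambda>j\<in>{..<p}. real p * (\<Phi> (\<lambda>l\<in>{..<p}. x l + d * u l) z - \<Phi> x z) / d * u j)"

definition primal_dual_iterates ::
    "nat \<Rightarrow> nat \<Rightarrow> real mat \<Rightarrow> (nat \<Rightarrow> (nat \<Rightarrow> real) \<Rightarrow> 'z \<Rightarrow> real) \<Rightarrow>
     (nat \<Rightarrow> real) \<Rightarrow> (nat \<Rightarrow> real) \<Rightarrow> (nat \<Rightarrow> real) \<Rightarrow> (nat \<Rightarrow> nat \<Rightarrow> real) \<Rightarrow> (nat \<Rightarrow> nat \<Rightarrow> real) \<Rightarrow>
     'w measure \<Rightarrow> (nat \<Rightarrow> nat \<Rightarrow> 'w \<Rightarrow> nat \<Rightarrow> real) \<Rightarrow> (nat \<Rightarrow> nat \<Rightarrow> 'w \<Rightarrow> 'z) \<Rightarrow>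
     (nat \<Rightarrow> nat \<Rightarrow> 'w \<Rightarrow> nat \<Rightarrow> real) \<Rightarrow> (nat \<Rightarrow> nat \<Rightarrow> 'w \<Rightarrow> nat \<Rightarrow> real) \<Rightarrow> bool" where
  "primal_dual_iterates n p L F \<alpha> \<beta> \<eta> \<delta> x0 M u \<xi> x v \<longleftrightarrow>
     (\<forall>\<omega>\<in>space M. \<forall>i<n.
        x i 0 \<omega> = x0 i \<and>
        v i 0 \<omega> = (\<lambda>j\<in>{..<p}. 0) \<and>
        (\<forall>k.
          x i (Suc k) \<omega> =
            (\<lambda>j\<in>{..<p}. x i k \<omega> j -
               \<eta> k * (\<alpha> k * (\<Sum>l<n. L $$ (i, l) * x l k \<omega> j) + \<beta> k * v i k \<omega> j
                      + grad_est p (F i) (\<delta> i k) (x i k \<omega>) (u i k \<omega>) (\<xi> i k \<omega>) j)) \<and>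
          v i (Suc k) \<omega> =
            (\<lambda>j\<in>{..<p}. v i k \<omega> j + \<eta> k * \<beta> k * (\<Sum>l<n. L $$ (i, l) * x l k \<omega> j))))"

definition agent_mean :: "nat \<Rightarrow> nat \<Rightarrow> (nat \<Rightarrow> nat \<Rightarrow> real) \<Rightarrow> nat \<Rightarrow> real" where
  "agent_mean n p y = (\<lambda>j\<in>{..<p}. (\<Sum>i<n. y i j) / real n)"

definition consensus_error :: "nat \<Rightarrow> nat \<Rightarrow> (nat \<Rightarrow> nat \<Rightarrow> real) \<Rightarrow> real" where
  "consensus_error n p y = (\<Sum>i<n. (nrm p (\<lambda>j. y i j - agent_mean n p y j))\<^sup>2) / real n"

definition beta_seq :: "real \<Rightarrow> real \<Rightarrow> nat \<Rightarrow> real" where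
  "beta_seq \<kappa>\<^sub>0 t\<^sub>1 k = \<kappa>\<^sub>0 * (real k + t\<^sub>1)"

definition alpha_seq :: "real \<Rightarrow> real \<Rightarrow> real \<Rightarrow> nat \<Rightarrow> real" where
  "alpha_seq \<kappa>\<^sub>0 \<kappa>\<^sub>1 t\<^sub>1 k = \<kappa>\<^sub>1 * beta_seq \<kappa>\<^sub>0 t\<^sub>1 k"

definition eta_seq :: "real \<Rightarrow> real \<Rightarrow> real \<Rightarrow> nat \<Rightarrow> real" where
  "eta_seq \<kappa>\<^sub>0 \<kappa>\<^sub>2 t\<^sub>1 k = \<kappa>\<^sub>2 / beta_seq \<kappa>\<^sub>0 t\<^sub>1 k"


subsection \<open>Parameter bounds\<close>

definition c1 :: "real mat \<Rightarrow> real" where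
  "c1 L = 1 / rho2 L + 1"

definition kappa3 :: "real mat \<Rightarrow> real \<Rightarrow> real" where
  "kappa3 L \<kappa>\<^sub>1 = 1 / rho2 L + \<kappa>\<^sub>1 + 1"

definition kappa4 :: "real mat \<Rightarrow> real \<Rightarrow> real" where
  "kappa4 L \<kappa>\<^sub>1 = 1 / rho2 L + \<kappa>\<^sub>1"

definition eps2 :: "real mat \<Rightarrow> real \<Rightarrow> real" where
  "eps2 L \<kappa>\<^sub>1 = (\<kappa>\<^sub>1 - 1) * rho2 L - 1"

definition eps3 :: "real mat \<Rightarrow> real \<Rightarrow> real" where
  "eps3 L \<kappa>\<^sub>1 = rho L + (2 * \<kappa>\<^sub>1\<^sup>2 + 1) * rho (L * L) + 1"

definition c2 :: "real mat \<Rightarrow> real \<Rightarrow> real" where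
  "c2 L \<kappa>\<^sub>1 = min (eps2 L \<kappa>\<^sub>1 / eps3 L \<kappa>\<^sub>1) (1/5)"

definition eps4 :: "real mat \<Rightarrow> real \<Rightarrow> real \<Rightarrow> real" where
  "eps4 L \<kappa>\<^sub>1 \<kappa>\<^sub>2 = 1/2 * (eps2 L \<kappa>\<^sub>1 * \<kappa>\<^sub>2 - eps3 L \<kappa>\<^sub>1 * \<kappa>\<^sub>2\<^sup>2)"

definition eps5 :: "real mat \<Rightarrow> real \<Rightarrow> real \<Rightarrow> real" where
  "eps5 L \<kappa>\<^sub>1 \<kappa>\<^sub>2 = 1/2 - \<kappa>\<^sub>1 * \<kappa>\<^sub>2 * rho2 L + \<kappa>\<^sub>2\<^sup>2 * rho L
     + 1/2 * (1 + 3 * \<kappa>\<^sub>1 * \<kappa>\<^sub>2 + 2 * \<kappa>\<^sub>2) * \<kappa>\<^sub>1 * \<kappa>\<^sub>2 * rho (L * L)"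

definition eps6 :: "real \<Rightarrow> real" where
  "eps6 \<kappa>\<^sub>2 = 1/4 * (\<kappa>\<^sub>2 - 5 * \<kappa>\<^sub>2\<^sup>2)"

definition eps8 :: "real mat \<Rightarrow> real \<Rightarrow> real \<Rightarrow> real" where
  "eps8 L \<kappa>\<^sub>1 \<kappa>\<^sub>2 = kappa4 L \<kappa>\<^sub>1 + \<kappa>\<^sub>1 * \<kappa>\<^sub>2 + 3 * \<kappa>\<^sub>2\<^sup>2 + \<kappa>\<^sub>2 * kappa4 L \<kappa>\<^sub>1"

definition eps1_check :: "nat \<Rightarrow> real \<Rightarrow> real \<Rightarrow> real mat \<Rightarrow> real \<Rightarrow> real" where
  "eps1_check p Lf \<sigma>\<^sub>0 L \<kappa>\<^sub>1 =
     Max {1 + 3 * Lf\<^sup>2,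
          sqrt (8 + 4 * real p * (1 + \<sigma>\<^sub>0\<^sup>2) * (6 + Lf)) * Lf,
          real p * kappa3 L \<kappa>\<^sub>1}"

definition eps7_check :: "nat \<Rightarrow> real \<Rightarrow> real \<Rightarrow> real mat \<Rightarrow> real \<Rightarrow> real \<Rightarrow> real" where
  "eps7_check p Lf \<sigma>\<^sub>0 L \<kappa>\<^sub>1 \<kappa>\<^sub>2 =
     4 * (6 + 5 * \<kappa>\<^sub>2 + 2 * kappa4 L \<kappa>\<^sub>1 + 8 * \<kappa>\<^sub>2 * kappa4 L \<kappa>\<^sub>1) * \<kappa>\<^sub>2 * Lf ^ 4
     + (1 + 2 * Lf\<^sup>2) * \<kappa>\<^sub>2 / (2 * real p * (1 + \<sigma>\<^sub>0\<^sup>2))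
     + (5 / (real p * (1 + \<sigma>\<^sub>0\<^sup>2)) + 16) * Lf\<^sup>2 * \<kappa>\<^sub>2\<^sup>2"

definition eps10_check :: "real \<Rightarrow> real mat \<Rightarrow> real \<Rightarrow> real \<Rightarrow> real" where
  "eps10_check Lf L \<kappa>\<^sub>1 \<kappa>\<^sub>2 =
     10 + Lf + 1 / \<kappa>\<^sub>2 * (2 * kappa4 L \<kappa>\<^sub>1 + 1) * Lf\<^sup>2 + (8 * kappa4 L \<kappa>\<^sub>1 + 5) * Lf\<^sup>2"

definition c3_check ::
    "nat \<Rightarrow> real \<Rightarrow> real \<Rightarrow> real \<Rightarrow> real mat \<Rightarrow> real \<Rightarrow> real \<Rightarrow> real \<Rightarrow> real" where
  "c3_check p Lf \<sigma>\<^sub>0 \<nu> L \<kappa>\<^sub>0 \<kappa>\<^sub>1 \<kappa>\<^sub>2 =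
     Max {2 / (3 * eps4 L \<kappa>\<^sub>1 \<kappa>\<^sub>2),
          2 / (3 * eps6 \<kappa>\<^sub>2),
          eps1_check p Lf \<sigma>\<^sub>0 L \<kappa>\<^sub>1 / \<kappa>\<^sub>0,
          2 * eps5 L \<kappa>\<^sub>1 \<kappa>\<^sub>2 / (\<kappa>\<^sub>0 * eps4 L \<kappa>\<^sub>1 \<kappa>\<^sub>2),
          root 3 (2 * real p * (1 + \<sigma>\<^sub>0\<^sup>2) * eps7_check p Lf \<sigma>\<^sub>0 L \<kappa>\<^sub>1 \<kappa>\<^sub>2
                  / (\<kappa>\<^sub>0\<^sup>2 * eps4 L \<kappa>\<^sub>1 \<kappa>\<^sub>2)),
          sqrt (eps8 L \<kappa>\<^sub>1 \<kappa>\<^sub>2 / (2 * \<kappa>\<^sub>0 * eps6 \<kappa>\<^sub>2)),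
          16 * Lf * kappa3 L \<kappa>\<^sub>1 / (\<nu> * \<kappa>\<^sub>2),
          root 3 (16 * Lf * kappa4 L \<kappa>\<^sub>1 / (\<nu> * \<kappa>\<^sub>0 * \<kappa>\<^sub>2)),
          64 * real p * (1 + \<sigma>\<^sub>0\<^sup>2) * Lf * \<kappa>\<^sub>2 * eps10_check Lf L \<kappa>\<^sub>1 \<kappa>\<^sub>2 / (\<nu> * \<kappa>\<^sub>0),
          real p * (1 + \<sigma>\<^sub>0\<^sup>2) * \<kappa>\<^sub>2 * eps10_check Lf L \<kappa>\<^sub>1 \<kappa>\<^sub>2 / (4 * \<kappa>\<^sub>0)}"

end

theory Submission
  imports Defs
begin

text \<open>
  Write \<open>s = k + t\<^sub>1\<close>. Since \<open>\<eta>\<^sub>k \<alpha>\<^sub>k\<close> and \<open>\<eta>\<^sub>k \<beta>\<^sub>k\<close> are constant, the disagreement of the agents follows a fixed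
  linear recursion that is perturbed by \<open>\<eta>\<^sub>k = O(1/s)\<close> times the gradient estimates. The bounds on
  \<open>\<kappa>\<^sub>1\<close> and \<open>\<kappa>\<^sub>2\<close> make this recursion a strict contraction in a quadratic Lyapunov function, so the mean
  square disagreement is \<open>O(1/s\<^sup>2)\<close> as long as the second moments of the estimates stay bounded.

  The mean of the agents performs stochastic gradient descent on \<open>f\<close>. The bias of the two-point
  estimator is at most \<open>L\<^sub>f \<delta>\<close>, without a dimension factor: the sphere is invariant under the reflection
  at the hyperplane orthogonal to the direction in which the bias is measured, and antisymmetrizing
  the estimator under this reflection replaces its size by its increment. Different agents are
  conditionally independent, so the variance of the averaged estimate is \<open>O(p/n)\<close>, with a constant that
  depends on the network only through terms of order \<open>1/s\<^sup>3\<close>. With the Polyak-Lojasiewicz condition the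
  expected gap satisfies \<open>A' \<le> (1 - (16/3)/s + O(1/s\<^sup>2)) A + q/s\<^sup>2 + O(1/s\<^sup>3)\<close>, \<open>q = O(p/n)\<close>, and hence
  \<open>A \<le> q/s + O(1/s\<^sup>2)\<close>.

  All constants except \<open>q\<close> may depend on \<open>t\<^sub>1\<close>, and the lower bound on \<open>t\<^sub>1\<close> bounds \<open>p\<close> in terms of \<open>t\<^sub>1\<close>, so
  that for small \<open>k\<close> a crude growth bound suffices.
\<close>

text \<open>The order of quantifiers shapes the proof: the leading constant is fixed before the
  network, the other two before the dimension, the data and the samples. The recursion lemma must
  therefore give constants that are uniform in the sequences and in q. The second moment of the
  estimates grows with the gap and with the disagreement, so boundedness of the gap has to be proved
  together with both rates. Local gradients are bounded through f_i - f_i^*, which is how the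
  difference of f^* and the mean of the f_i^* enters the leading constant. The number 16/3 is the
  lower bound on \<nu> \<open>\<kappa>\<^sub>2\<close> / \<open>\<kappa>\<^sub>0\<close> given by
  the upper bound on \<open>\<kappa>\<^sub>0\<close>. The lower bound on
  \<open>\<kappa>\<^sub>0\<close> bounds \<open>\<kappa>\<^sub>2\<close> /
  \<open>\<kappa>\<^sub>0\<close> from above and so keeps the network out of the leading constant.
  Reflections take the place of the divergence theorem, by which the mean of the estimator is
  usually recognized as the gradient of a ball average.\<close>

definition ip :: "nat \<Rightarrow> (nat \<Rightarrow> real) \<Rightarrow> (nat \<Rightarrow> real) \<Rightarrow> real" where
  "ip n x y = (\<Sum>i<n. x i * y i)"

lemma ip_commute: "ip n x y = ip n y x"
  by (simp add: ip_def mult.commute)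

lemma ip_add_left: "ip n (\<lambda>i. x i + y i) z = ip n x z + ip n y z"
  and ip_add_right: "ip n z (\<lambda>i. x i + y i) = ip n z x + ip n z y"
  and ip_diff_left: "ip n (\<lambda>i. x i - y i) z = ip n x z - ip n y z"
  and ip_diff_right: "ip n z (\<lambda>i. x i - y i) = ip n z x - ip n z y"
  and ip_scale_left: "ip n (\<lambda>i. c * x i) z = c * ip n x z"
  and ip_scale_right: "ip n z (\<lambda>i. c * x i) = c * ip n z x"
  and ip_minus_left: "ip n (\<lambda>i. - x i) z = - ip n x z"
  and ip_minus_right: "ip n z (\<lambda>i. - x i) = - ip n z x"
  by (simp_all add: ip_def algebra_simps sum.distrib sum_subtractf sum_distrib_left sum_negf)

lemmas ip_simps = ip_add_left ip_add_right ip_diff_left ip_diff_right ip_scale_left ip_scale_right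
  ip_minus_left ip_minus_right

lemma ip_cong: "(\<And>i. i < n \<Longrightarrow> x i = x' i) \<Longrightarrow> (\<And>i. i < n \<Longrightarrow> y i = y' i) \<Longrightarrow> ip n x y = ip n x' y'"
  by (auto simp: ip_def intro!: sum.cong)

lemma ip_self_nonneg [simp]: "0 \<le> ip n x x"
  by (simp add: ip_def sum_nonneg)

lemma ip_self: "ip n x x = (\<Sum>i<n. (x i)\<^sup>2)"
  by (simp add: ip_def power2_eq_square)

lemma ip_self_eq_0: "ip n x x = 0 \<longleftrightarrow> (\<forall>i<n. x i = 0)"
  by (auto simp: ip_self sum_nonneg_eq_0_iff)

lemma ip_Cauchy_Schwarz: "(ip n x y)\<^sup>2 \<le> ip n x x * ip n y y"
  unfolding ip_self by (simp add: ip_def Cauchy_Schwarz_ineq_sum)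

lemma nrm_sq: "(nrm p x)\<^sup>2 = ip p x x"
  by (simp add: nrm_def L2_set_def ip_self sum_nonneg)

lemma nrm_nonneg [simp]: "0 \<le> nrm p x"
  by (simp add: nrm_def L2_set_nonneg)

lemma ip_le_nrm: "\<bar>ip p x y\<bar> \<le> nrm p x * nrm p y"
proof (rule power2_le_imp_le)
  show "\<bar>ip p x y\<bar>\<^sup>2 \<le> (nrm p x * nrm p y)\<^sup>2"
    by (simp add: power_mult_distrib nrm_sq ip_Cauchy_Schwarz)
qed simp

text \<open>Both \<theta> x - y and \<theta> x + y have nonnegative square, which covers both signs
  of the inner product.\<close>

lemma ip_Young:
  assumes "0 < \<theta>"
  shows "2 * \<bar>ip n x y\<bar> \<le> \<theta> * ip n x x + ip n y y / \<theta>"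
proof -
  have "0 \<le> ip n (\<lambda>i. \<theta> * x i - y i) (\<lambda>i. \<theta> * x i - y i)"
    "0 \<le> ip n (\<lambda>i. \<theta> * x i + y i) (\<lambda>i. \<theta> * x i + y i)" by simp_all
  then have "2 * \<theta> * \<bar>ip n x y\<bar> \<le> \<theta> * (\<theta> * ip n x x) + ip n y y"
    by (simp add: ip_simps ip_commute[of n y x] abs_if)
  moreover have "\<theta> * (\<theta> * ip n x x + ip n y y / \<theta>) = \<theta> * (\<theta> * ip n x x) + ip n y y"
    using assms by (simp add: distrib_left)
  ultimately have "\<theta> * (2 * \<bar>ip n x y\<bar>) \<le> \<theta> * (\<theta> * ip n x x + ip n y y / \<theta>)"
    by (simp add: ac_simps)
  then show ?thesis
    using assms by (simp add: mult_le_cancel_left_pos)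
qed

lemma ip_sum_le: "ip n (\<lambda>i. x i + y i) (\<lambda>i. x i + y i) \<le> 2 * ip n x x + 2 * ip n y y"
  using ip_Young[of 1 n x y] by (simp add: ip_simps ip_commute[of n y x])

lemma ip_diff_le: "ip n (\<lambda>i. x i - y i) (\<lambda>i. x i - y i) \<le> 2 * ip n x x + 2 * ip n y y"
  using ip_Young[of 1 n x y] by (simp add: ip_simps ip_commute[of n y x])


subsection \<open>The Laplacian\<close>

text \<open>Written with differences, so that constants are annihilated by inspection;
  \<open>laplacian_row\<close> ties it to the matrix.\<close>

definition lap :: "nat \<Rightarrow> (nat \<Rightarrow> nat \<Rightarrow> real) \<Rightarrow> (nat \<Rightarrow> real) \<Rightarrow> nat \<Rightarrow> real" where
  "lap n a y i = (\<Sum>l<n. a i l * (y i - y l))"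

lemma lap_add: "lap n a (\<lambda>i. x i + y i) = (\<lambda>i. lap n a x i + lap n a y i)"
  and lap_diff: "lap n a (\<lambda>i. x i - y i) = (\<lambda>i. lap n a x i - lap n a y i)"
  and lap_scale: "lap n a (\<lambda>i. c * x i) = (\<lambda>i. c * lap n a x i)"
  by (simp_all add: lap_def fun_eq_iff algebra_simps sum.distrib sum_subtractf sum_distrib_left)

lemma lap_cong: "(\<And>i. i < n \<Longrightarrow> x i = y i) \<Longrightarrow> i < n \<Longrightarrow> lap n a x i = lap n a y i"
  by (simp add: lap_def)

lemma laplacian_row:
  assumes "network n E a" "i < n"
  shows "(\<Sum>l<n. laplacian n a $$ (i, l) * y l) = lap n a y i"
proof -
  have "(\<Sum>l<n. laplacian n a $$ (i, l) * y l)
      = (\<Sum>l<n. (if i = l then \<Sum>m<n. a i m else 0) * y l - a i l * y l)"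
    using assms by (intro sum.cong) (auto simp: laplacian_def left_diff_distrib)
  also have "\<dots> = (\<Sum>l<n. (if i = l then (\<Sum>m<n. a i m) * y l else 0)) - (\<Sum>l<n. a i l * y l)"
    by (simp add: sum_subtractf if_distrib[of "\<lambda>c. c * _"] cong: if_cong)
  also have "(\<Sum>l<n. (if i = l then (\<Sum>m<n. a i m) * y l else 0)) = (\<Sum>m<n. a i m) * y i"
    using assms by (simp add: sum.delta)
  finally show ?thesis
    by (simp add: lap_def algebra_simps sum_subtractf sum_distrib_left)
qed

text \<open>Exchanging the two summation indices and using symmetric weights gives a second form of
  the same sum; the average of both is the Dirichlet form. Symmetry, positivity and the zero sum of
  \<open>lap\<close> are read off from it.\<close>

lemma lap_bilinear:
  assumes "network n E a"
  shows "ip n x (lap n a y) = (\<Sum>i<n. \<Sum>l<n. a i l * (x i - x l) * (y i - y l)) / 2"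
proof -
  have s: "a i l = a l i" if "i < n" "l < n" for i l
    using assms that by (auto simp: network_def)
  have "ip n x (lap n a y) = (\<Sum>i<n. \<Sum>l<n. a i l * x i * (y i - y l))"
    by (simp add: ip_def lap_def sum_distrib_left algebra_simps)
  moreover have "(\<Sum>i<n. \<Sum>l<n. a i l * x i * (y i - y l)) = (\<Sum>l<n. \<Sum>i<n. a i l * x i * (y i - y l))"
    by (rule sum.swap)
  moreover have "\<dots> = (\<Sum>i<n. \<Sum>l<n. a i l * x l * (y l - y i))"
    using s by (intro sum.cong) auto
  ultimately have "2 * ip n x (lap n a y)
      = (\<Sum>i<n. \<Sum>l<n. a i l * x i * (y i - y l)) + (\<Sum>i<n. \<Sum>l<n. a i l * x l * (y l - y i))"
    by simp
  also have "\<dots> = (\<Sum>i<n. \<Sum>l<n. a i l * (x i - x l) * (y i - y l))"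
    unfolding sum.distrib[symmetric] by (intro sum.cong) (auto simp: algebra_simps)
  finally show ?thesis by simp
qed

lemma lap_symmetric: "network n E a \<Longrightarrow> ip n x (lap n a y) = ip n y (lap n a x)"
  by (simp add: lap_bilinear ac_simps)

lemma network_weight_nonneg: "network n E a \<Longrightarrow> i < n \<Longrightarrow> l < n \<Longrightarrow> 0 \<le> a i l"
  unfolding network_def by (metis order.refl less_imp_le)

lemma lap_psd:
  assumes "network n E a"
  shows "0 \<le> ip n y (lap n a y)"
  unfolding lap_bilinear[OF assms]
  using network_weight_nonneg[OF assms] by (auto intro!: sum_nonneg simp: mult.assoc)

lemma sum_lap: "network n E a \<Longrightarrow> (\<Sum>i<n. lap n a y i) = 0"
  using lap_bilinear[of n E a "\<lambda>_. 1" y] by (simp add: ip_def)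

text \<open>A sum of nonnegative edge terms vanishes only termwise, so values agree along every
  edge; connectivity carries the equality along paths.\<close>

lemma lap_kernel:
  assumes net: "network n E a" and con: "connected_network n E"
    and "ip n y (lap n a y) = 0" and ij: "i < n" "j < n"
  shows "y i = y j"
proof -
  have nonneg: "0 \<le> a i l * (y i - y l) * (y i - y l)" if "i < n" "l < n" for i l
    using network_weight_nonneg[OF net that] by (simp add: mult.assoc)
  have 0: "(\<Sum>i<n. \<Sum>l<n. a i l * (y i - y l) * (y i - y l)) = 0"
    using assms(3) unfolding lap_bilinear[OF net] by simp
  have *: "a i l * (y i - y l) * (y i - y l) = 0" if "i < n" "l < n" for i l
  proof -
    have "\<forall>i\<in>{..<n}. (\<Sum>l<n. a i l * (y i - y l) * (y i - y l)) = 0"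
      using 0 nonneg by (subst sum_nonneg_eq_0_iff[symmetric]) (auto intro!: sum_nonneg)
    then have "\<forall>l\<in>{..<n}. a i l * (y i - y l) * (y i - y l) = 0"
      using nonneg that by (subst sum_nonneg_eq_0_iff[symmetric]) auto
    then show ?thesis using that by auto
  qed
  have edge: "y k = y l" if "(k, l) \<in> E" for k l
  proof -
    have kl: "k < n" "l < n" using net that by (auto simp: network_def)
    have "\<forall>i<n. \<forall>j<n. (i, j) \<in> E \<longrightarrow> 0 < a i j" using net by (simp add: network_def)
    then have "0 < a k l" using kl that by blast
    then show ?thesis using *[OF kl] by auto
  qed
  have "(i, j) \<in> E\<^sup>*" using con ij by (auto simp: connected_network_def)
  then show ?thesis
    by (induction rule: rtrancl_induct) (auto dest: edge)
qed

text \<open>Vectors are functions on all of \<open>nat\<close>; the coordinates from n on are pinned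
  to zero, since otherwise the set would not be compact. It is a closed subset of a product of
  compact intervals.\<close>

lemma compact_unit_vectors: "compact {y. (\<forall>i\<ge>n. y i = 0) \<and> ip n y y = 1}"
proof -
  let ?B = "PiE UNIV (\<lambda>i. if i < n then {-1..1} else {0::real})"
  let ?S = "{y. (\<forall>i\<ge>n. y i = 0) \<and> ip n y y = 1}"
  have "compactin (product_topology (\<lambda>_. euclidean) UNIV) ?B"
    by (simp add: compactin_PiE)
  then have "compact ?B"
    by (metis compactin_euclidean_iff euclidean_product_topology)
  moreover have "closed {y::nat \<Rightarrow> real. (\<forall>i\<ge>n. y i = 0) \<and> ip n y y = 1}"
    unfolding ip_def
    by (intro closed_Collect_conj closed_Collect_all closed_Collect_imp closed_Collect_eq
        continuous_intros continuous_on_product_coordinates) auto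
  moreover have "{y. (\<forall>i\<ge>n. y i = 0) \<and> ip n y y = 1} \<subseteq> ?B"
  proof
    fix y assume y: "y \<in> {y. (\<forall>i\<ge>n. y i = 0) \<and> ip n y y = 1}"
    have "\<bar>y i\<bar> \<le> 1" if "i < n" for i
    proof -
      have "(y i)\<^sup>2 \<le> (\<Sum>i<n. (y i)\<^sup>2)"
        using that by (intro member_le_sum) auto
      then show ?thesis using y by (simp add: ip_self abs_square_le_1)
    qed
    then show "y \<in> ?B" using y by (auto simp: abs_le_iff PiE_iff minus_le_iff)
  qed
  moreover have "?S = ?B \<inter> ?S" using calculation(3) by (rule inf.absorb_iff2[THEN iffD1, symmetric])
  ultimately show ?thesis
    using compact_Int_closed[of ?B ?S] by (simp only:)
qed

lemma lap_form_continuous: "continuous_on A (\<lambda>y. ip n y (lap n a y))"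
  unfolding ip_def lap_def
  by (intro continuous_intros continuous_on_product_coordinates)
     (auto intro: continuous_on_subset[OF continuous_on_product_coordinates])

lemma normalize_vector:
  assumes "ip n y y \<noteq> 0"
  obtains c z where "0 < c" "\<forall>i<n. y i = c * z i" "\<forall>i\<ge>n. z i = 0" "ip n z z = 1"
proof
  let ?c = "sqrt (ip n y y)" and ?z = "\<lambda>i. if i < n then y i / sqrt (ip n y y) else 0"
  have pos: "0 < ip n y y" using assms ip_self_nonneg[of n y] by linarith
  then show "0 < ?c" by simp
  then show "\<forall>i<n. y i = ?c * ?z i" by simp
  have "ip n ?z ?z = ip n y y / (?c * ?c)"
    by (simp add: ip_def sum_divide_distrib)
  then show "ip n ?z ?z = 1" using pos by simp
qed simp

lemma ip_lap_cong: "(\<And>i. i < n \<Longrightarrow> x i = x' i) \<Longrightarrow> (\<And>i. i < n \<Longrightarrow> y i = y' i) \<Longrightarrow>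
    ip n x (lap n a y) = ip n x' (lap n a y')"
  by (intro ip_cong) (auto intro: lap_cong)

text \<open>The largest Rayleigh quotient: it is attained on the compact unit sphere, and
  homogeneity extends the bound to all vectors.\<close>

lemma lap_form_max:
  assumes net: "network n E a" and n: "1 \<le> n"
  obtains \<Lambda> w where "\<And>y. ip n y (lap n a y) \<le> \<Lambda> * ip n y y"
    "ip n w w = 1" "ip n w (lap n a w) = \<Lambda>"
proof -
  let ?S = "{y. (\<forall>i\<ge>n. y i = 0) \<and> ip n y y = 1}"
  define e :: "nat \<Rightarrow> real" where "e i = (if i = 0 then 1 else 0)" for i
  have "e \<in> ?S"
    using n by (auto simp: e_def ip_def if_distrib sum.delta cong: if_cong)
  then have "?S \<noteq> {}" by blast
  from continuous_attains_sup[OF compact_unit_vectors this lap_form_continuous[of _ n a]]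
  obtain w where w: "w \<in> ?S" "\<forall>y\<in>?S. ip n y (lap n a y) \<le> ip n w (lap n a w)" ..
  have "ip n y (lap n a y) \<le> ip n w (lap n a w) * ip n y y" for y
  proof (cases "ip n y y = 0")
    case True
    then have "\<forall>i<n. y i = 0" by (simp only: ip_self_eq_0)
    then have "ip n y (lap n a y) = 0" by (simp add: ip_def)
    then show ?thesis using True by simp
  next
    case False
    then obtain c z where z: "0 < c" "\<forall>i<n. y i = c * z i" "\<forall>i\<ge>n. z i = 0" "ip n z z = 1"
      by (rule normalize_vector)
    have "ip n y (lap n a y) = ip n (\<lambda>i. c * z i) (lap n a (\<lambda>i. c * z i))"
      using z by (intro ip_lap_cong) auto
    also have "\<dots> = c * c * ip n z (lap n a z)" by (simp add: lap_scale ip_simps)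
    also have "\<dots> \<le> c * c * ip n w (lap n a w)" using z w by (intro mult_left_mono) auto
    also have "c * c = ip n (\<lambda>i. c * z i) (\<lambda>i. c * z i)" using z by (simp add: ip_simps)
    also have "\<dots> = ip n y y" using z by (intro ip_cong) auto
    finally show ?thesis by (simp add: mult.commute)
  qed
  then show ?thesis using w that by blast
qed

text \<open>The operator inequality L^2 <= \<Lambda> L without diagonalization: positivity of the
  form is applied to y - L y / \<Lambda>, and the resulting term with three factors L is bounded by
  the form inequality at L y.\<close>

lemma lap_norm_le:
  assumes net: "network n E a" and \<Lambda>: "0 < \<Lambda>" "\<And>y. ip n y (lap n a y) \<le> \<Lambda> * ip n y y"
  shows "ip n (lap n a y) (lap n a y) \<le> \<Lambda> * ip n y (lap n a y)"
proof -
  let ?L = "lap n a" and ?z = "\<lambda>i. y i - (1/\<Lambda>) * lap n a y i"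
  have "0 \<le> ip n ?z (?L ?z)" by (rule lap_psd[OF net])
  also have "\<dots> = ip n y (?L y) - 2 / \<Lambda> * ip n (?L y) (?L y)
      + (1/\<Lambda>) * ((1/\<Lambda>) * ip n (?L y) (?L (?L y)))"
    using lap_symmetric[OF net, of y "?L y"]
    by (simp add: lap_diff lap_scale ip_simps del: times_divide_eq_left)
  also have "\<dots> \<le> ip n y (?L y) - 2 / \<Lambda> * ip n (?L y) (?L y)
      + (1/\<Lambda>) * ((1/\<Lambda>) * (\<Lambda> * ip n (?L y) (?L y)))"
    using \<Lambda> by (intro add_left_mono mult_left_mono) auto
  finally have "0 \<le> ip n y (?L y) - ip n (?L y) (?L y) / \<Lambda>" using \<Lambda> by simp
  then show ?thesis using \<Lambda> by (simp add: field_simps)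
qed

text \<open>First variation: if the residual d = L w - \<Lambda> w were nonzero, moving w slightly
  along d would raise the Rayleigh quotient above its maximum.\<close>

lemma lap_maximizer_eigen:
  assumes net: "network n E a" and \<Lambda>: "\<And>y. ip n y (lap n a y) \<le> \<Lambda> * ip n y y"
    and w: "ip n w w = 1" "ip n w (lap n a w) = \<Lambda>"
  shows "\<forall>i<n. lap n a w i = \<Lambda> * w i"
proof (rule ccontr)
  let ?d = "\<lambda>i. lap n a w i - \<Lambda> * w i"
  define s where "s = ip n ?d ?d"
  define c where "c = \<Lambda> * ip n ?d ?d - ip n ?d (lap n a ?d)"
  assume "\<not> ?thesis"
  then have "s \<noteq> 0" unfolding s_def ip_self_eq_0 by auto
  then have s: "0 < s" by (simp add: s_def order_less_le)
  have c: "0 \<le> c" unfolding c_def using \<Lambda>[of ?d] by simp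
  have *: "2 * t * s \<le> t\<^sup>2 * c" for t
  proof -
    let ?z = "\<lambda>i. w i + t * ?d i"
    have "ip n ?z (lap n a ?z) \<le> \<Lambda> * ip n ?z ?z" by (rule \<Lambda>)
    moreover have "ip n ?z (lap n a ?z) = \<Lambda> + 2 * t * ip n ?d (lap n a w) + t\<^sup>2 * ip n ?d (lap n a ?d)"
      using lap_symmetric[OF net, of w ?d] w(2)
      by (simp only: lap_add lap_scale ip_add_left ip_add_right ip_scale_left ip_scale_right)
         (simp add: power2_eq_square algebra_simps)
    moreover have "ip n ?z ?z = 1 + 2 * t * ip n ?d w + t\<^sup>2 * ip n ?d ?d"
      using w(1) ip_commute[of n w ?d]
      by (simp only: ip_add_left ip_add_right ip_scale_left ip_scale_right)
         (simp add: power2_eq_square algebra_simps)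
    moreover have "ip n ?d (lap n a w) - \<Lambda> * ip n ?d w = s"
      unfolding s_def by (simp only: ip_diff_right[of n ?d "lap n a w"] ip_scale_right)
    ultimately show ?thesis
      unfolding c_def s_def by (simp add: algebra_simps)
  qed
  \<comment> \<open>Small enough for the linear term 2 t s to beat t^2 c; the divisor is c + 1
    because c may be zero.\<close>
  define t where "t = s / (c + 1)"
  have t: "0 < t" "t * (c + 1) = s" using s c by (simp_all add: t_def)
  have "t\<^sup>2 * c \<le> t\<^sup>2 * (c + 1)" by (intro mult_left_mono) auto
  also have "\<dots> = t * s" using t(2) by (simp add: power2_eq_square mult.assoc)
  finally have "2 * t * s \<le> t * s" using *[of t] by linarith
  moreover have "0 < t * s" using t(1) s by (rule mult_pos_pos)
  ultimately show False by linarith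
qed

section \<open>Eigenvalues of the Laplacian matrix and the network constants\<close>

lemma laplacian_carrier [simp]: "laplacian n a \<in> carrier_mat n n"
  by (simp add: laplacian_def)

lemma laplacian_mult_vec:
  assumes "network n E a"
  shows "laplacian n a *\<^sub>v vec n y = vec n (lap n a y)"
proof (rule eq_vecI)
  fix i assume i: "i < dim_vec (vec n (lap n a y))"
  have "(laplacian n a *\<^sub>v vec n y) $ i = (\<Sum>l<n. laplacian n a $$ (i, l) * y l)"
    using i by (simp add: laplacian_def scalar_prod_def lessThan_atLeast0)
  then show "(laplacian n a *\<^sub>v vec n y) $ i = vec n (lap n a y) $ i"
    using i laplacian_row[OF assms] by simp
qed (auto simp: laplacian_def)

lemma laplacian_eigenvector:
  assumes net: "network n E a" and y: "ip n y y \<noteq> 0" "\<forall>i<n. lap n a y i = l * y i"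
  shows "eigenvector (laplacian n a) (vec n y) l"
proof -
  have "laplacian n a *\<^sub>v vec n y = l \<cdot>\<^sub>v vec n y"
    using y unfolding laplacian_mult_vec[OF net] by auto
  moreover have "vec n y \<noteq> 0\<^sub>v n"
  proof
    assume "vec n y = 0\<^sub>v n"
    then have "y i = 0" if "i < n" for i using that by (metis index_vec index_zero_vec(1))
    then show False using y by (simp add: ip_self_eq_0)
  qed
  ultimately show ?thesis by (simp add: eigenvector_def laplacian_def)
qed

lemma eigenvector_square:
  assumes A: "(A :: 'a :: field mat) \<in> carrier_mat n n" and "eigenvector A v l"
  shows "eigenvector (A * A) v (l * l)"
proof -
  have v: "v \<in> carrier_vec n" "v \<noteq> 0\<^sub>v n" "A *\<^sub>v v = l \<cdot>\<^sub>v v"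
    using assms by (auto simp: eigenvector_def)
  have "(A * A) *\<^sub>v v = A *\<^sub>v (l \<cdot>\<^sub>v v)" using A v by simp
  also have "\<dots> = (l * l) \<cdot>\<^sub>v v" using A v by (simp add: mult_mat_vec[OF A] smult_smult_assoc)
  finally show ?thesis using A v by (simp add: eigenvector_def)
qed

lemma eigenvalue_le_rho:
  assumes A: "A \<in> carrier_mat n n" and n: "0 < n" and "eigenvalue A l"
  shows "\<bar>l\<bar> \<le> rho A"
proof -
  have "eigenvalue (map_mat complex_of_real A) (complex_of_real l)"
    by (rule of_real_hom.eigenvalue_hom[OF A assms(3)])
  then have "norm (complex_of_real l) \<in> norm ` spectrum (map_mat complex_of_real A)"
    unfolding spectrum_def by (intro imageI) simp
  then show ?thesis
    using spectral_radius_mem_max(2)[of "map_mat complex_of_real A" n] A n by (auto simp: rho_def)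
qed

text \<open>\<open>Min\<close> is meaningful only on a finite nonempty set: the spectrum is finite,
  and one positive eigenvalue makes the set nonempty.\<close>

lemma rho2_eigenvalue:
  assumes A: "A \<in> carrier_mat n n" and "eigenvalue A l" "0 < l"
  shows "eigenvalue A (rho2 A)" "0 < rho2 A"
proof -
  have "finite {l. eigenvalue A l \<and> 0 < l}"
    using card_finite_spectrum(1)[OF A] by (rule finite_subset[rotated]) (auto simp: spectrum_def)
  then have "rho2 A \<in> {l. eigenvalue A l \<and> 0 < l}"
    unfolding rho2_def using assms by (intro Min_in) auto
  then show "eigenvalue A (rho2 A)" "0 < rho2 A" by auto
qed

text \<open>Compactness gives a minimum of the form on unit vectors with zero sum. It is positive
  because a vector with vanishing form is constant, and a constant vector with zero sum is
  zero.\<close>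

lemma lap_coercive:
  assumes net: "network n E a" and con: "connected_network n E"
  obtains \<mu> where "0 < \<mu>" "\<And>y. (\<Sum>i<n. y i) = 0 \<Longrightarrow> \<mu> * ip n y y \<le> ip n y (lap n a y)"
proof -
  let ?S = "{y. (\<forall>i\<ge>n. y i = 0) \<and> ip n y y = 1} \<inter> {y. (\<Sum>i<n. y i) = 0}"
  have "closed {y::nat \<Rightarrow> real. (\<Sum>i<n. y i) = 0}"
    by (intro closed_Collect_eq continuous_intros continuous_on_product_coordinates)
  then have cpt: "compact ?S" by (intro compact_Int_closed compact_unit_vectors)
  have "\<exists>\<mu>>0. \<forall>y\<in>?S. \<mu> \<le> ip n y (lap n a y)"
  \<comment> \<open>For n <= 1 no unit vector has zero sum; then every positive constant serves and
    1 is taken.\<close>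
  proof (cases "?S = {}")
    case False
    from continuous_attains_inf[OF cpt this lap_form_continuous[of _ n a]]
    obtain w where w: "w \<in> ?S" "\<forall>y\<in>?S. ip n w (lap n a w) \<le> ip n y (lap n a y)" ..
    have "ip n w (lap n a w) \<noteq> 0"
    proof
      assume 0: "ip n w (lap n a w) = 0"
      have "w i = 0" if "i < n" for i
      proof -
        have "(\<Sum>j<n. w j) = (\<Sum>j<n. w i)"
          using that by (intro sum.cong refl lap_kernel[OF net con 0]) auto
        then show ?thesis using w that by simp
      qed
      then have "ip n w w = 0" by (simp add: ip_self_eq_0)
      then show False using w by simp
    qed
    then have "0 < ip n w (lap n a w)" using lap_psd[OF net, of w] by simp
    then show ?thesis using w(2) by blast
  qed (auto intro: exI[of _ 1])
  then obtain \<mu> where \<mu>: "0 < \<mu>" "\<And>y. y \<in> ?S \<Longrightarrow> \<mu> \<le> ip n y (lap n a y)" by blast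
  have "\<mu> * ip n y y \<le> ip n y (lap n a y)" if y: "(\<Sum>i<n. y i) = 0" for y
  proof (cases "ip n y y = 0")
    case True
    then have "\<forall>i<n. y i = 0" by (simp only: ip_self_eq_0)
    then have "ip n y (lap n a y) = 0" by (simp add: ip_def)
    then show ?thesis using True by simp
  next
    case False
    then obtain c z where z: "0 < c" "\<forall>i<n. y i = c * z i" "\<forall>i\<ge>n. z i = 0" "ip n z z = 1"
      by (rule normalize_vector)
    have "(\<Sum>i<n. y i) = c * (\<Sum>i<n. z i)" using z by (simp add: sum_distrib_left)
    then have "z \<in> ?S" using z y by simp
    have "ip n y y = ip n (\<lambda>i. c * z i) (\<lambda>i. c * z i)" using z by (intro ip_cong) auto
    then have "\<mu> * ip n y y = c * c * \<mu>" using z by (simp add: ip_simps)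
    also have "\<dots> \<le> c * c * ip n z (lap n a z)"
      using \<mu>(2)[OF \<open>z \<in> ?S\<close>] z by (intro mult_left_mono) auto
    also have "\<dots> = ip n (\<lambda>i. c * z i) (lap n a (\<lambda>i. c * z i))" by (simp add: lap_scale ip_simps)
    also have "\<dots> = ip n y (lap n a y)" using z by (intro ip_lap_cong) auto
    finally show ?thesis .
  qed
  then show ?thesis using \<mu> that by blast
qed

text \<open>Condenses the bounds on \<open>\<kappa>\<^sub>1\<close> and
  \<open>\<kappa>\<^sub>2\<close> into the inequality that the Lyapunov analysis uses. With r =
  \<open>rho2\<close>, one has eps2 <= \<open>\<kappa>\<^sub>1\<close> r, while eps3 is at least 2
  \<open>\<kappa>\<^sub>1\<close>^2 rho(L^2) and hence at least 2 \<open>\<kappa>\<^sub>1\<close>^2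
  \<Lambda> r. Dividing \<open>\<kappa>\<^sub>2\<close> eps3 < eps2 by
  \<open>\<kappa>\<^sub>1\<close> r gives the claim on \<Lambda>.\<close>

lemma network_constants:
  assumes n: "2 \<le> n" and net: "network n E a" and con: "connected_network n E"
    and \<kappa>1: "c1 (laplacian n a) < \<kappa>\<^sub>1" and \<kappa>2: "0 < \<kappa>\<^sub>2" "\<kappa>\<^sub>2 < c2 (laplacian n a) \<kappa>\<^sub>1"
  obtains \<Lambda> \<mu> where "0 < \<Lambda>" "0 < \<mu>" "\<kappa>\<^sub>1 * \<kappa>\<^sub>2 * \<Lambda> \<le> 1/2" "1 < \<kappa>\<^sub>1" "0 < rho2 (laplacian n a)"
    "\<And>y. ip n (lap n a y) (lap n a y) \<le> \<Lambda> * ip n y (lap n a y)"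
    "\<And>y. (\<Sum>i<n. y i) = 0 \<Longrightarrow> \<mu> * ip n y y \<le> ip n y (lap n a y)"
proof -
  let ?L = "laplacian n a"
  obtain \<mu> where \<mu>: "0 < \<mu>" "\<And>y. (\<Sum>i<n. y i) = 0 \<Longrightarrow> \<mu> * ip n y y \<le> ip n y (lap n a y)"
    using lap_coercive[OF net con] by blast
  obtain \<Lambda> w where \<Lambda>: "\<And>y. ip n y (lap n a y) \<le> \<Lambda> * ip n y y"
    and w: "ip n w w = 1" "ip n w (lap n a w) = \<Lambda>"
    using lap_form_max[OF net] n by auto
  have "0 < \<Lambda>"
  proof -
    \<comment> \<open>A test vector with zero sum, on which the coercivity constant can be compared
      with \<Lambda>; it needs two agents.\<close>
    let ?e = "\<lambda>i. (if i = 0 then 1 else 0) - (if i = 1 then 1 else 0) :: real"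
    have "(\<Sum>i<n. ?e i) = 0" using n by (simp add: sum_subtractf sum.delta)
    then have le: "\<mu> * ip n ?e ?e \<le> \<Lambda> * ip n ?e ?e" using \<mu>(2)[of ?e] \<Lambda>[of ?e] by linarith
    have "ip n ?e ?e \<noteq> 0" using n by (auto simp: ip_self_eq_0)
    then have "0 < ip n ?e ?e" using ip_self_nonneg[of n ?e] by linarith
    with le have "\<mu> \<le> \<Lambda>" by (rule mult_right_le_imp_le)
    then show ?thesis using \<mu>(1) by linarith
  qed
  have ev: "eigenvector ?L (vec n w) \<Lambda>"
    using laplacian_eigenvector[OF net] lap_maximizer_eigen[OF net \<Lambda> w] w by simp
  then have ev': "eigenvalue ?L \<Lambda>" by (auto simp: eigenvalue_def)
  note r2 = rho2_eigenvalue[OF laplacian_carrier ev' \<open>0 < \<Lambda>\<close>]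
  have LL: "?L * ?L \<in> carrier_mat n n" by (rule mult_carrier_mat[OF laplacian_carrier laplacian_carrier])
  have sq: "l * l \<le> rho (?L * ?L)" if ev: "eigenvalue ?L l" for l
  proof -
    obtain v where "eigenvector ?L v l" using ev by (auto simp: eigenvalue_def)
    then have "eigenvalue (?L * ?L) (l * l)"
      unfolding eigenvalue_def using eigenvector_square[OF laplacian_carrier] by blast
    then show ?thesis using eigenvalue_le_rho[OF LL] n by fastforce
  qed
  define R where "R = rho (?L * ?L)"
  define r where "r = rho2 ?L"
  have r: "0 < r" using r2 by (simp add: r_def)
  have rL: "0 < rho ?L" using eigenvalue_le_rho[OF laplacian_carrier _ ev'] n \<open>0 < \<Lambda>\<close> by simp
  \<comment> \<open>Both squares are eigenvalues of L^2; the mixed product lies below their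
    mean.\<close>
  have "\<Lambda> * \<Lambda> \<le> R" "r * r \<le> R" using sq ev' r2(1) by (auto simp: R_def r_def)
  then have \<Lambda>r: "\<Lambda> * r \<le> R" using sum_squares_bound[of \<Lambda> r] by (simp add: power2_eq_square)
  have "0 \<le> r * \<Lambda>" using r \<open>0 < \<Lambda>\<close> by simp
  then have R: "0 \<le> R" using \<Lambda>r by (simp add: mult.commute)
  have k1: "1 < \<kappa>\<^sub>1" using \<kappa>1 r by (simp add: c1_def r_def[symmetric]) (smt (verit) divide_pos_pos)
  have eps3: "2 * \<kappa>\<^sub>1\<^sup>2 * R \<le> eps3 ?L \<kappa>\<^sub>1" "0 < eps3 ?L \<kappa>\<^sub>1"
    using R rL by (auto simp: eps3_def R_def[symmetric] distrib_right intro!: add_nonneg_pos)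
  have "\<kappa>\<^sub>2 < eps2 ?L \<kappa>\<^sub>1 / eps3 ?L \<kappa>\<^sub>1" using \<kappa>2 by (simp add: c2_def)
  then have "\<kappa>\<^sub>2 * eps3 ?L \<kappa>\<^sub>1 < eps2 ?L \<kappa>\<^sub>1" using eps3 by (simp add: field_simps)
  moreover have "eps2 ?L \<kappa>\<^sub>1 \<le> \<kappa>\<^sub>1 * r" using r by (simp add: eps2_def r_def[symmetric] algebra_simps)
  moreover have "\<kappa>\<^sub>2 * (2 * \<kappa>\<^sub>1\<^sup>2 * (\<Lambda> * r)) \<le> \<kappa>\<^sub>2 * eps3 ?L \<kappa>\<^sub>1"
    using eps3(1) \<Lambda>r \<kappa>2 k1 by (intro mult_left_mono) (auto intro: order_trans[OF mult_left_mono])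
  ultimately have "(2 * \<kappa>\<^sub>1 * \<kappa>\<^sub>2 * \<Lambda>) * (\<kappa>\<^sub>1 * r) < 1 * (\<kappa>\<^sub>1 * r)"
    by (simp add: power2_eq_square algebra_simps)
  then have "2 * \<kappa>\<^sub>1 * \<kappa>\<^sub>2 * \<Lambda> < 1" using k1 r by (simp only: mult_less_cancel_right) auto
  moreover have "ip n (lap n a y) (lap n a y) \<le> \<Lambda> * ip n y (lap n a y)" for y
    by (rule lap_norm_le[OF net \<open>0 < \<Lambda>\<close> \<Lambda>])
  ultimately show ?thesis using that[of \<Lambda> \<mu>] \<open>0 < \<Lambda>\<close> \<mu> k1 r by (simp add: r_def)
qed

subsection \<open>Lyapunov function of the primal-dual dynamics\<close>

text \<open>The dual variable is \<open>v = lap w\<close>, with \<open>w\<close> the accumulated disagreement. The primal-dual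
  step is a damped symplectic Euler step in \<open>(x, w)\<close>; the weight of the cross term is the one for
  which the change of the function along the noiseless dynamics is minus a sum of squares.\<close>

definition lyap :: "nat \<Rightarrow> (nat \<Rightarrow> nat \<Rightarrow> real) \<Rightarrow> real \<Rightarrow> (nat \<Rightarrow> real) \<Rightarrow> (nat \<Rightarrow> real) \<Rightarrow> real" where
  "lyap n a b x w = ip n x x + ip n w (lap n a w) + 2 * b * ip n x (lap n a w)"

text \<open>The cross term is split by Young with weight 1/2; its dual part is at most 2 b^2 |L
  w|^2, which b^2 \<Lambda> <= 1/10 turns into a small multiple of the form of w.\<close>

lemma lyap_bounds:
  assumes net: "network n E a"
    and P: "\<And>y. ip n (lap n a y) (lap n a y) \<le> \<Lambda> * ip n y (lap n a y)" and b: "b\<^sup>2 * \<Lambda> \<le> 1/10"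
  shows "ip n x x + ip n w (lap n a w) \<le> 2 * lyap n a b x w"
    and "lyap n a b x w \<le> 2 * (ip n x x + ip n w (lap n a w))"
proof -
  have S: "0 \<le> ip n w (lap n a w)" by (rule lap_psd[OF net])
  have "2 * \<bar>ip n x (\<lambda>i. b * lap n a w i)\<bar>
      \<le> (1/2) * ip n x x + ip n (\<lambda>i. b * lap n a w i) (\<lambda>i. b * lap n a w i) / (1/2)"
    by (rule ip_Young) simp
  also have "ip n (\<lambda>i. b * lap n a w i) (\<lambda>i. b * lap n a w i) = b\<^sup>2 * ip n (lap n a w) (lap n a w)"
    by (simp add: ip_simps power2_eq_square)
  also have "\<dots> \<le> b\<^sup>2 * (\<Lambda> * ip n w (lap n a w))"
    by (intro mult_left_mono P) auto
  also have "\<dots> = (b\<^sup>2 * \<Lambda>) * ip n w (lap n a w)" by simp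
  also have "\<dots> \<le> (1/10) * ip n w (lap n a w)" by (intro mult_right_mono b S)
  finally have "\<bar>2 * b * ip n x (lap n a w)\<bar> \<le> (1/2) * ip n x x + (1/2) * ip n w (lap n a w)"
    using S by (simp add: ip_simps abs_mult)
  then show "ip n x x + ip n w (lap n a w) \<le> 2 * lyap n a b x w"
    "lyap n a b x w \<le> 2 * (ip n x x + ip n w (lap n a w))"
    unfolding lyap_def using S ip_self_nonneg[of n x] by (auto simp: abs_le_iff)
qed

text \<open>After expansion every term mixing x and w cancels except -2 b^3 <L x, L w>. Damping
  gives dissipation -(2 a' - 3 b^2) Q in x, and the cross term of \<open>lyap\<close> gives -b^2 |L
  w|^2 in w. Of 2 a' Q, at most 0.6 a' Q is lost to 3 b^2 Q and 0.6 a' Q to the terms in |L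
  x|^2.\<close>

lemma lyap_noiseless_step:
  assumes net: "network n E a" and \<Lambda>: "0 < \<Lambda>" and \<mu>: "0 < \<mu>"
    and P: "\<And>y. ip n (lap n a y) (lap n a y) \<le> \<Lambda> * ip n y (lap n a y)"
    and coer: "\<And>y. (\<Sum>i<n. y i) = 0 \<Longrightarrow> \<mu> * ip n y y \<le> ip n y (lap n a y)"
    and ab: "0 < a'" "0 < b" "b\<^sup>2 \<le> a' / 5" "b < 1/5" "a' * \<Lambda> \<le> 1/2"
    and x: "(\<Sum>i<n. x i) = 0" and w: "(\<Sum>i<n. w i) = 0"
  shows "lyap n a b (\<lambda>i. x i - a' * lap n a x i - b * lap n a w i) (\<lambda>i. w i + b * x i)
      \<le> lyap n a b x w - 1/2 * a' * \<mu> * ip n x x - 1/2 * b\<^sup>2 * \<mu> * ip n w (lap n a w)"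
proof -
  let ?L = "lap n a"
  define Q S PP V T where defs: "Q = ip n x (?L x)" "S = ip n w (?L w)" "PP = ip n (?L x) (?L x)"
    "V = ip n (?L w) (?L w)" "T = ip n (?L x) (?L w)"
  have s: "ip n w (?L x) = ip n x (?L w)" "ip n (?L w) (?L x) = T" "ip n x (?L (?L x)) = PP"
    "ip n x (?L (?L w)) = T" "ip n w (?L (?L x)) = T" "ip n w (?L (?L w)) = V"
    "ip n (?L x) x = Q" "ip n (?L w) x = ip n x (?L w)" "ip n (?L w) w = S" "ip n (?L x) w = ip n x (?L w)"
    unfolding defs by (metis lap_symmetric[OF net] ip_commute)+
  have "lyap n a b (\<lambda>i. x i - a' * lap n a x i - b * lap n a w i) (\<lambda>i. w i + b * x i)
      = lyap n a b x w - (2 * a' - 3 * b\<^sup>2) * Q + (a'\<^sup>2 - 2 * a' * b\<^sup>2) * PP - b\<^sup>2 * V - 2 * b^3 * T"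
    unfolding lyap_def lap_add lap_diff lap_scale
      ip_add_left ip_add_right ip_diff_left ip_diff_right ip_scale_left ip_scale_right s
    by (simp only: defs[symmetric]) (simp add: power2_eq_square power3_eq_cube algebra_simps)
  \<comment> \<open>The square of L w + 2 b L x absorbs the mixed term while spending only half of
    the dissipation b^2 V.\<close>
  moreover have "- (2 * b^3 * T) \<le> 1/2 * b\<^sup>2 * V + 2 * b^4 * PP"
  proof -
    have "0 \<le> b\<^sup>2 / 2 * ip n (\<lambda>i. ?L w i + 2 * b * ?L x i) (\<lambda>i. ?L w i + 2 * b * ?L x i)" by simp
    also have "ip n (\<lambda>i. ?L w i + 2 * b * ?L x i) (\<lambda>i. ?L w i + 2 * b * ?L x i)
        = V + 4 * b * T + 4 * b\<^sup>2 * PP"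
      unfolding ip_add_left ip_add_right ip_scale_left ip_scale_right s
      by (simp only: defs[symmetric]) (simp add: power2_eq_square algebra_simps)
    finally show ?thesis by (simp add: power2_eq_square power3_eq_cube power4_eq_xxxx algebra_simps)
  qed
  moreover have "(a'\<^sup>2 - 2 * a' * b\<^sup>2 + 2 * b^4) * PP \<le> (6/10 * a') * Q"
  proof -
    have Q: "0 \<le> Q" unfolding defs by (rule lap_psd[OF net])
    have b4: "b^4 \<le> a' * b\<^sup>2"
      using mult_right_mono[OF ab(3), of "b\<^sup>2"] ab by (simp add: power2_eq_square power4_eq_xxxx)
    have "(a'\<^sup>2 - 2 * a' * b\<^sup>2 + 2 * b^4) * PP \<le> a'\<^sup>2 * PP"
      using b4 by (intro mult_right_mono) (auto simp: defs)
    also have "\<dots> \<le> a'\<^sup>2 * (\<Lambda> * Q)" using P[of x] by (intro mult_left_mono) (auto simp: defs)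
    also have "\<dots> = a' * (a' * \<Lambda>) * Q" by (simp add: power2_eq_square)
    also have "\<dots> \<le> (a' * (1/2)) * Q" using ab Q by (intro mult_right_mono mult_left_mono) auto
    also have "\<dots> \<le> (6/10 * a') * Q" using ab Q by (intro mult_right_mono) auto
    finally show ?thesis .
  qed
  moreover have "3 * b\<^sup>2 * Q \<le> 6/10 * a' * Q"
    using ab lap_psd[OF net, of x] by (intro mult_right_mono) (auto simp: defs)
  moreover have "1/2 * a' * \<mu> * ip n x x \<le> 1/2 * a' * Q"
    using coer[OF x] ab by (simp add: defs)
  moreover have "1/2 * a' * Q \<le> 8/10 * a' * Q"
    using ab lap_psd[OF net, of x] by (intro mult_right_mono) (auto simp: defs)
  \<comment> \<open>Dissipation in |L w|^2 becomes dissipation in the form of w: \<mu> S <= V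
    follows by expanding |L w - \<mu> w|^2 and using coercivity once.\<close>
  moreover have "1/2 * b\<^sup>2 * \<mu> * S \<le> 1/2 * b\<^sup>2 * V"
  proof -
    have "0 \<le> ip n (\<lambda>i. ?L w i - \<mu> * w i) (\<lambda>i. ?L w i - \<mu> * w i)" by simp
    also have "\<dots> = V - 2 * \<mu> * S + \<mu> * (\<mu> * ip n w w)"
      unfolding ip_diff_left ip_diff_right ip_scale_left ip_scale_right s
      by (simp add: defs algebra_simps)
    also have "\<dots> \<le> V - 2 * \<mu> * S + \<mu> * S"
      using coer[OF w] \<mu> by (simp add: defs)
    finally have "\<mu> * S \<le> V" by (simp add: mult.commute)
    from mult_left_mono[OF this, of "1/2 * b\<^sup>2"] show ?thesis by (simp add: mult.assoc)
  qed
  ultimately show ?thesis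
    unfolding defs(2)[symmetric] by (simp add: algebra_simps)
qed

text \<open>\<open>lyap\<close> is quadratic in x with gradient 2 (x + b L w), whose halved square
  is at most 4 \<open>lyap\<close>; Young separates it from d.\<close>

lemma lyap_perturb:
  assumes net: "network n E a"
    and P: "\<And>y. ip n (lap n a y) (lap n a y) \<le> \<Lambda> * ip n y (lap n a y)" and b: "b\<^sup>2 * \<Lambda> \<le> 1/10"
    and \<theta>: "0 < \<theta>"
  shows "lyap n a b (\<lambda>i. x i + d i) w \<le> (1 + 4 * \<theta>) * lyap n a b x w + (1 + 1 / \<theta>) * ip n d d"
proof -
  let ?z = "\<lambda>i. x i + b * lap n a w i"
  have S: "0 \<le> ip n w (lap n a w)" by (rule lap_psd[OF net])
  have "lyap n a b (\<lambda>i. x i + d i) w = lyap n a b x w + 2 * ip n ?z d + ip n d d"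
    unfolding lyap_def ip_add_left ip_add_right ip_scale_left
    by (simp add: ip_commute algebra_simps)
  moreover have "2 * ip n ?z d \<le> \<theta> * ip n ?z ?z + ip n d d / \<theta>"
    using ip_Young[OF \<theta>, of n ?z d] by simp
  moreover have "\<theta> * ip n ?z ?z \<le> \<theta> * (4 * lyap n a b x w)"
  proof (intro mult_left_mono)
    have "ip n ?z ?z \<le> 2 * ip n x x + 2 * ip n (\<lambda>i. b * lap n a w i) (\<lambda>i. b * lap n a w i)"
      by (rule ip_sum_le)
    also have "ip n (\<lambda>i. b * lap n a w i) (\<lambda>i. b * lap n a w i) = b\<^sup>2 * ip n (lap n a w) (lap n a w)"
      by (simp add: ip_simps power2_eq_square)
    also have "\<dots> \<le> b\<^sup>2 * (\<Lambda> * ip n w (lap n a w))" by (intro mult_left_mono P) auto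
    also have "\<dots> = (b\<^sup>2 * \<Lambda>) * ip n w (lap n a w)" by simp
    also have "\<dots> \<le> (1/10) * ip n w (lap n a w)" by (intro mult_right_mono b S)
    finally show "ip n ?z ?z \<le> 4 * lyap n a b x w"
      using lyap_bounds(1)[OF net P b, of x w] S by simp
  qed (use \<theta> in auto)
  ultimately show ?thesis by (simp add: algebra_simps)
qed

text \<open>The one place where the two parts of the Lyapunov analysis meet: dissipation in both
  variables, compared with \<open>lyap\<close> by the upper bound in \<open>lyap_bounds\<close>,
  gives a factor below one, and part of it pays for the perturbation.\<close>

lemma lyap_contraction:
  assumes net: "network n E a" and \<Lambda>: "0 < \<Lambda>" and \<mu>: "0 < \<mu>"
    and P: "\<And>y. ip n (lap n a y) (lap n a y) \<le> \<Lambda> * ip n y (lap n a y)"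
    and coer: "\<And>y. (\<Sum>i<n. y i) = 0 \<Longrightarrow> \<mu> * ip n y y \<le> ip n y (lap n a y)"
    and ab: "0 < a'" "0 < b" "b\<^sup>2 \<le> a' / 5" "b < 1/5" "a' * \<Lambda> \<le> 1/2"
  obtains c K where "0 < c" "c < 1" "0 \<le> K"
    "\<And>x w d. (\<Sum>i<n. x i) = 0 \<Longrightarrow> (\<Sum>i<n. w i) = 0 \<Longrightarrow>
      lyap n a b (\<lambda>i. x i - a' * lap n a x i - b * lap n a w i + d i) (\<lambda>i. w i + b * x i)
        \<le> (1 - c) * lyap n a b x w + K * ip n d d"
    "\<And>x w. ip n x x \<le> 2 * lyap n a b x w"
proof -
  have b2: "b\<^sup>2 * \<Lambda> \<le> 1/10"
  proof -
    have "b\<^sup>2 * \<Lambda> \<le> a' / 5 * \<Lambda>" using ab(3) \<Lambda> by (intro mult_right_mono) auto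
    also have "\<dots> = a' * \<Lambda> / 5" by simp
    finally show ?thesis using ab(5) by linarith
  qed
  note bd = lyap_bounds[OF net P b2]
  have lyap_nonneg: "0 \<le> lyap n a b x w" for x w
    using bd(1)[of x w] ip_self_nonneg[of n x] lap_psd[OF net, of w] by linarith
  \<comment> \<open>The smaller of the two dissipation rates, capped at 1/2 so that the factors
    below stay positive.\<close>
  define c where "c = min (1/2) (1/2 * \<mu> * min a' (b\<^sup>2))"
  have c: "0 < c" "c \<le> 1/2" using \<mu> ab by (auto simp: c_def)
  have c': "c \<le> 1/2 * a' * \<mu>" "c \<le> 1/2 * b\<^sup>2 * \<mu>"
    using \<mu> by (auto simp: c_def min_le_iff_disj min_mult_distrib_left mult.commute mult.left_commute)
  have step: "lyap n a b (\<lambda>i. x i - a' * lap n a x i - b * lap n a w i + d i) (\<lambda>i. w i + b * x i)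
        \<le> (1 - c/4) * lyap n a b x w + (1 + 16 / c) * ip n d d"
    if xw: "(\<Sum>i<n. x i) = 0" "(\<Sum>i<n. w i) = 0" for x w d
  proof -
    let ?x = "\<lambda>i. x i - a' * lap n a x i - b * lap n a w i" and ?w = "\<lambda>i. w i + b * x i"
    have "lyap n a b ?x ?w
        \<le> lyap n a b x w - 1/2 * a' * \<mu> * ip n x x - 1/2 * b\<^sup>2 * \<mu> * ip n w (lap n a w)"
      by (rule lyap_noiseless_step[OF net \<Lambda> \<mu> P coer ab xw])
    also have "\<dots> \<le> lyap n a b x w - c * ip n x x - c * ip n w (lap n a w)"
      using c' lap_psd[OF net, of w] by (intro diff_mono mult_right_mono) auto
    also have "\<dots> = lyap n a b x w - (c/2) * (2 * (ip n x x + ip n w (lap n a w)))"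
      by (simp add: algebra_simps)
    also have "\<dots> \<le> lyap n a b x w - (c/2) * lyap n a b x w"
      using c bd(2) by (intro diff_left_mono mult_left_mono) auto
    finally have 1: "lyap n a b ?x ?w \<le> (1 - c/2) * lyap n a b x w" by (simp add: algebra_simps)
    \<comment> \<open>The weight c/16 is chosen because (1 + c/4) (1 - c/2) <= 1 - c/4.\<close>
    have "lyap n a b (\<lambda>i. ?x i + d i) ?w
        \<le> (1 + 4 * (c/16)) * lyap n a b ?x ?w + (1 + 1 / (c/16)) * ip n d d"
      using c by (intro lyap_perturb[OF net P b2]) auto
    also have "\<dots> \<le> (1 + 4 * (c/16)) * ((1 - c/2) * lyap n a b x w) + (1 + 1 / (c/16)) * ip n d d"
      using c 1 by (intro add_right_mono mult_left_mono) auto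
    also have "(1 + 4 * (c/16)) * ((1 - c/2) * lyap n a b x w) \<le> (1 - c/4) * lyap n a b x w"
    proof -
      have "(1 + 4 * (c/16)) * (1 - c/2) \<le> 1 - c/4"
        using c by (simp add: algebra_simps)
      then show ?thesis
        unfolding mult.assoc[symmetric] by (intro mult_right_mono lyap_nonneg)
    qed
    finally show ?thesis by simp
  qed
  have "ip n x x \<le> 2 * lyap n a b x w" for x w
    using bd(1)[of x w] lap_psd[OF net, of w] by simp
  then show ?thesis
    using that[of "c/4" "1 + 16 / c"] step c by auto
qed

subsection \<open>The uniform distribution on the sphere\<close>

interpretation lborel_prod: product_sigma_finite "\<lambda>_::nat. lborel :: real measure"
  by unfold_locales

text \<open>Boxes determine the product measure, and a translation acts on each side of a box
  separately.\<close>

lemma PiM_lborel_translate: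
  fixes c :: "nat \<Rightarrow> real"
  assumes I: "finite I"
  shows "distr (Pi\<^sub>M I (\<lambda>_. lborel)) (Pi\<^sub>M I (\<lambda>_. lborel)) (\<lambda>x. \<lambda>i\<in>I. x i + c i) = Pi\<^sub>M I (\<lambda>_. lborel)"
proof (rule lborel_prod.PiM_eqI[OF I])
  have meas: "(\<lambda>x. \<lambda>i\<in>I. x i + c i) \<in> Pi\<^sub>M I (\<lambda>_. lborel) \<rightarrow>\<^sub>M Pi\<^sub>M I (\<lambda>_. lborel :: real measure)"
    by measurable
  fix A :: "nat \<Rightarrow> real set" assume A: "\<And>i. i \<in> I \<Longrightarrow> A i \<in> sets lborel"
  have tr: "emeasure lborel ((\<lambda>x. x + c i) -` A i) = emeasure lborel (A i)" if "i \<in> I" for i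
  proof -
    have "emeasure lborel (A i) = emeasure (distr lborel borel ((+) (c i))) (A i)"
      by (simp add: lborel_distr_plus)
    also have "\<dots> = emeasure lborel ((+) (c i) -` A i)"
      using A[OF that] by (subst emeasure_distr) auto
    also have "(+) (c i) -` A i = (\<lambda>x. x + c i) -` A i" by (auto simp: add.commute)
    finally show ?thesis by simp
  qed
  have "(\<lambda>x. \<lambda>i\<in>I. x i + c i) -` (Pi\<^sub>E I A) \<inter> space (Pi\<^sub>M I (\<lambda>_. lborel))
      = Pi\<^sub>E I (\<lambda>i. (\<lambda>x. x + c i) -` A i)"
    by (auto simp: space_PiM PiE_iff)
  moreover have "(\<lambda>x. x + c i) -` A i \<in> sets lborel" if "i \<in> I" for i
    using measurable_sets[of "\<lambda>x. x + c i" lborel lborel "A i"] A[OF that] by simp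
  moreover have "Pi\<^sub>E I A \<in> sets (Pi\<^sub>M I (\<lambda>_. lborel))"
    using A I by (intro sets_PiM_I_finite) auto
  ultimately show "emeasure (distr (Pi\<^sub>M I (\<lambda>_. lborel)) (Pi\<^sub>M I (\<lambda>_. lborel)) (\<lambda>x. \<lambda>i\<in>I. x i + c i)) (Pi\<^sub>E I A)
      = (\<Prod>i\<in>I. emeasure lborel (A i))"
    using A I tr by (subst emeasure_distr[OF meas]) (auto simp: lborel_prod.emeasure_PiM)
qed simp

lemma nn_integral_PiM_lborel_translate:
  fixes c :: "nat \<Rightarrow> real"
  assumes I: "finite I" and f: "f \<in> borel_measurable (Pi\<^sub>M I (\<lambda>_. lborel))"
  shows "(\<integral>\<^sup>+x. f (\<lambda>i\<in>I. x i + c i) \<partial>Pi\<^sub>M I (\<lambda>_. lborel)) = (\<integral>\<^sup>+x. f x \<partial>Pi\<^sub>M I (\<lambda>_. lborel))"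
proof -
  have "(\<integral>\<^sup>+x. f x \<partial>Pi\<^sub>M I (\<lambda>_. lborel))
      = (\<integral>\<^sup>+x. f x \<partial>distr (Pi\<^sub>M I (\<lambda>_. lborel)) (Pi\<^sub>M I (\<lambda>_. lborel)) (\<lambda>x. \<lambda>i\<in>I. x i + c i))"
    by (simp add: PiM_lborel_translate[OF I])
  also have "\<dots> = (\<integral>\<^sup>+x. f (\<lambda>i\<in>I. x i + c i) \<partial>Pi\<^sub>M I (\<lambda>_. lborel))"
    by (rule nn_integral_distr) (use f in measurable)
  finally show ?thesis ..
qed

text \<open>The Householder reflection at the hyperplane orthogonal to e, provided e has norm one;
  restricted so that its values are points of \<open>Rp p\<close>.\<close>

definition refl_at :: "nat \<Rightarrow> (nat \<Rightarrow> real) \<Rightarrow> (nat \<Rightarrow> real) \<Rightarrow> nat \<Rightarrow> real" where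
  "refl_at p e x = (\<lambda>i\<in>{..<p}. x i - 2 * ip p x e * e i)"

lemma refl_at_measurable [measurable]:
  "refl_at p e \<in> Pi\<^sub>M {..<p} (\<lambda>_. lborel) \<rightarrow>\<^sub>M Pi\<^sub>M {..<p} (\<lambda>_. lborel)"
  "refl_at p e \<in> RV p \<rightarrow>\<^sub>M RV p"
  unfolding refl_at_def ip_def by measurable

lemma refl_at_Rp [simp]: "refl_at p e x \<in> Rp p"
  by (simp add: refl_at_def)

lemma ip_refl_at:
  assumes "ip p e e = 1"
  shows "ip p (refl_at p e x) e = - ip p x e"
    and "ip p (refl_at p e x) (refl_at p e x) = ip p x x"
proof -
  have *: "ip p (refl_at p e x) y = ip p (\<lambda>i. x i - 2 * ip p x e * e i) y" for y
    by (intro ip_cong) (auto simp: refl_at_def)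
  show "ip p (refl_at p e x) e = - ip p x e"
    unfolding * using assms by (simp add: ip_diff_left ip_scale_left)
  show "ip p (refl_at p e x) (refl_at p e x) = ip p x x"
    unfolding * ip_commute[of p "\<lambda>i. x i - 2 * ip p x e * e i" "refl_at p e x"]
    unfolding * ip_diff_left ip_diff_right ip_scale_left ip_scale_right assms
    by (simp add: ip_commute[of p e x])
qed

text \<open>In the coordinates where \<open>x j\<close> is replaced by \<open>s = ip p x e\<close>, the reflection
  flips \<open>s\<close> and translates the other coordinates by multiples of \<open>s\<close>.\<close>

lemma nn_integral_refl_at:
  assumes e: "ip p e e = 1" and f: "f \<in> borel_measurable (Pi\<^sub>M {..<p} (\<lambda>_. lborel))"
  shows "(\<integral>\<^sup>+x. f (refl_at p e x) \<partial>Pi\<^sub>M {..<p} (\<lambda>_. lborel)) = (\<integral>\<^sup>+x. f x \<partial>Pi\<^sub>M {..<p} (\<lambda>_. lborel))"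
proof -
  \<comment> \<open>A pivot coordinate: s = <x, e> can replace x j because e j is nonzero.\<close>
  obtain j where j: "j < p" "e j \<noteq> 0"
  proof -
    have "\<not> (\<forall>i<p. e i = 0)" using e ip_self_eq_0[of p e] by simp
    then show ?thesis using that by blast
  qed
  define I where "I = {..<p} - {j}"
  have I: "finite I" "j \<notin> I" "{..<p} = insert j I" using j by (auto simp: I_def)
  let ?PI = "Pi\<^sub>M I (\<lambda>_. lborel :: real measure)"
  define \<sigma> where "\<sigma> x = (\<Sum>i\<in>I. x i * e i)" for x
  define g where "g s x = f (x(j := (s - \<sigma> x) / e j))" for s x
  have f': "f \<in> borel_measurable (Pi\<^sub>M (insert j I) (\<lambda>_. lborel))" using f I by simp
  have \<sigma>[measurable]: "\<sigma> \<in> borel_measurable ?PI" unfolding \<sigma>_def by measurable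
  have upd: "(\<lambda>(s, x). x(j := (s - \<sigma> x) / e j)) \<in> lborel \<Otimes>\<^sub>M ?PI \<rightarrow>\<^sub>M Pi\<^sub>M (insert j I) (\<lambda>_. lborel)"
  proof -
    have "(\<lambda>z. (snd z)(j := (fst z - \<sigma> (snd z)) / e j)) \<in> lborel \<Otimes>\<^sub>M ?PI \<rightarrow>\<^sub>M Pi\<^sub>M (insert j I) (\<lambda>_. lborel)"
      by (rule measurable_fun_upd[where J = I]) auto
    then show ?thesis by (simp add: case_prod_beta')
  qed
  have g[measurable]: "(\<lambda>(s, x). g s x) \<in> borel_measurable (lborel \<Otimes>\<^sub>M ?PI)"
    using measurable_compose[OF upd f'] by (simp add: g_def case_prod_beta')
  have g_x[measurable]: "(\<lambda>x. g s x) \<in> borel_measurable ?PI" for s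
    using measurable_compose[OF measurable_Pair1' g, of s] by simp
  \<comment> \<open>For fixed remaining coordinates, passing from x j to s is affine with Jacobian 1
    / |e j|.\<close>
  have subst: "(\<integral>\<^sup>+x. F x \<partial>Pi\<^sub>M {..<p} (\<lambda>_. lborel))
      = (\<integral>\<^sup>+x. \<bar>1 / e j\<bar> * (\<integral>\<^sup>+s. F (x(j := (s - \<sigma> x) / e j)) \<partial>lborel) \<partial>?PI)"
    if F: "F \<in> borel_measurable (Pi\<^sub>M {..<p} (\<lambda>_. lborel))" for F
  proof -
    have F': "F \<in> borel_measurable (Pi\<^sub>M (insert j I) (\<lambda>_. lborel))" using F I by simp
    have "(\<integral>\<^sup>+x. F x \<partial>Pi\<^sub>M {..<p} (\<lambda>_. lborel)) = (\<integral>\<^sup>+x. (\<integral>\<^sup>+y. F (x(j := y)) \<partial>lborel) \<partial>?PI)"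
      unfolding I(3) by (rule lborel_prod.product_nn_integral_insert[OF I(1,2) F'])
    also have "\<dots> = (\<integral>\<^sup>+x. \<bar>1 / e j\<bar> * (\<integral>\<^sup>+s. F (x(j := (s - \<sigma> x) / e j)) \<partial>lborel) \<partial>?PI)"
    proof (intro nn_integral_cong)
      fix x assume x: "x \<in> space ?PI"
      have "(\<lambda>y. x(j := y)) \<in> lborel \<rightarrow>\<^sub>M Pi\<^sub>M (insert j I) (\<lambda>_. lborel)"
        using x I(2) by (rule measurable_component_update)
      then have "(\<lambda>y. F (x(j := y))) \<in> borel_measurable borel"
        using measurable_compose[OF _ F'] by (simp add: measurable_lborel1)
      then have "(\<integral>\<^sup>+y. F (x(j := y)) \<partial>lborel)
          = \<bar>1 / e j\<bar> * (\<integral>\<^sup>+s. F (x(j := - \<sigma> x / e j + 1 / e j * s)) \<partial>lborel)"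
        using j by (intro nn_integral_real_affine) auto
      also have "(\<lambda>s. - \<sigma> x / e j + 1 / e j * s) = (\<lambda>s. (s - \<sigma> x) / e j)"
        by (auto simp: diff_divide_distrib)
      then have "(\<integral>\<^sup>+s. F (x(j := - \<sigma> x / e j + 1 / e j * s)) \<partial>lborel)
          = (\<integral>\<^sup>+s. F (x(j := (s - \<sigma> x) / e j)) \<partial>lborel)" by metis
      finally show "(\<integral>\<^sup>+y. F (x(j := y)) \<partial>lborel)
          = \<bar>1 / e j\<bar> * (\<integral>\<^sup>+s. F (x(j := (s - \<sigma> x) / e j)) \<partial>lborel)" .
    qed
    finally show ?thesis .
  qed
  \<comment> \<open>In the new coordinates the reflection sends s to -s and x i to x i - 2 s e i.
    That coordinate j comes out right is where |e| = 1 enters, as the squares of e over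
    \<open>I\<close> then sum to 1 - (e j)^2. Once s is integrated last, the shift of the other
    coordinates is a constant vector.\<close>
  have inner: "f (refl_at p e (x(j := (s - \<sigma> x) / e j))) = g (- s) (\<lambda>i\<in>I. x i + (- 2 * s * e i))"
    if x: "x \<in> space ?PI" for s x
  proof -
    let ?y = "x(j := (s - \<sigma> x) / e j)"
    have ipy: "ip p ?y e = s"
    proof -
      have "ip p ?y e = ?y j * e j + (\<Sum>i\<in>I. ?y i * e i)"
        unfolding ip_def I(3) using I by (subst sum.insert) auto
      also have "(\<Sum>i\<in>I. ?y i * e i) = \<sigma> x" unfolding \<sigma>_def using I by (intro sum.cong) auto
      finally show ?thesis using j by (simp add: fun_upd_def)
    qed
    have ee: "(\<Sum>i\<in>I. e i * e i) = 1 - e j * e j"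
      using e unfolding ip_def I(3) using I by (subst (asm) sum.insert) auto
    let ?x' = "\<lambda>i\<in>I. x i + (- 2 * s * e i)"
    have "\<sigma> ?x' = (\<Sum>i\<in>I. x i * e i - 2 * s * (e i * e i))"
      unfolding \<sigma>_def by (intro sum.cong) (auto simp: algebra_simps)
    also have "\<dots> = \<sigma> x - 2 * s * (1 - e j * e j)"
      by (simp add: sum_subtractf sum_distrib_left[symmetric] ee \<sigma>_def)
    finally have "(- s - \<sigma> ?x') / e j = (s - \<sigma> x) / e j - 2 * s * e j"
      using j by (simp add: field_simps)
    then have "refl_at p e ?y = ?x'(j := (- s - \<sigma> ?x') / e j)"
      unfolding refl_at_def ipy by (auto simp: I(3) fun_eq_iff I(2))
    then show ?thesis by (simp add: g_def)
  qed
  interpret PI: sigma_finite_measure ?PI by (rule lborel_prod.sigma_finite[OF I(1)])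
  interpret pair_sigma_finite ?PI "lborel :: real measure" ..
  have m2: "(\<lambda>(x, s). g (- s) (\<lambda>i\<in>I. x i + (- 2 * s * e i))) \<in> borel_measurable (?PI \<Otimes>\<^sub>M lborel)"
  proof -
    have "(\<lambda>z. (- snd z, \<lambda>i\<in>I. fst z i + (- 2 * snd z * e i))) \<in> ?PI \<Otimes>\<^sub>M lborel \<rightarrow>\<^sub>M lborel \<Otimes>\<^sub>M ?PI"
      by measurable
    from measurable_compose[OF this g] show ?thesis by (simp add: case_prod_beta')
  qed
  have m3: "(\<lambda>(x, s). g s x) \<in> borel_measurable (?PI \<Otimes>\<^sub>M lborel)"
    using measurable_compose[OF measurable_pair_swap' g] by (simp add: case_prod_beta')
  have "(\<integral>\<^sup>+x. (\<integral>\<^sup>+s. g (- s) (\<lambda>i\<in>I. x i + (- 2 * s * e i)) \<partial>lborel) \<partial>?PI)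
      = (\<integral>\<^sup>+s. (\<integral>\<^sup>+x. g (- s) (\<lambda>i\<in>I. x i + (- 2 * s * e i)) \<partial>?PI) \<partial>lborel)"
    using Fubini'[OF m2] by simp
  also have "\<dots> = (\<integral>\<^sup>+s. (\<integral>\<^sup>+x. g (- s) x \<partial>?PI) \<partial>lborel)"
    by (intro nn_integral_cong nn_integral_PiM_lborel_translate[OF I(1)] g_x)
  also have "\<dots> = (\<integral>\<^sup>+s. (\<integral>\<^sup>+x. g s x \<partial>?PI) \<partial>lborel)"
    using nn_integral_real_affine[of "\<lambda>s. \<integral>\<^sup>+x. g s x \<partial>?PI" "- 1" 0]
    by simp
  also have "\<dots> = (\<integral>\<^sup>+x. (\<integral>\<^sup>+s. g s x \<partial>lborel) \<partial>?PI)"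
    using Fubini'[OF m3] by simp
  finally have main: "(\<integral>\<^sup>+x. (\<integral>\<^sup>+s. g (- s) (\<lambda>i\<in>I. x i + (- 2 * s * e i)) \<partial>lborel) \<partial>?PI)
      = (\<integral>\<^sup>+x. (\<integral>\<^sup>+s. g s x \<partial>lborel) \<partial>?PI)" .
  have "(\<integral>\<^sup>+x. f (refl_at p e x) \<partial>Pi\<^sub>M {..<p} (\<lambda>_. lborel))
      = (\<integral>\<^sup>+x. \<bar>1 / e j\<bar> * (\<integral>\<^sup>+s. f (refl_at p e (x(j := (s - \<sigma> x) / e j))) \<partial>lborel) \<partial>?PI)"
    by (rule subst) (use f in measurable)
  also have "\<dots> = (\<integral>\<^sup>+x. \<bar>1 / e j\<bar> * (\<integral>\<^sup>+s. g (- s) (\<lambda>i\<in>I. x i + (- 2 * s * e i)) \<partial>lborel) \<partial>?PI)"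
    using inner by (intro nn_integral_cong) (auto intro!: arg_cong2[where f = "(*)"] nn_integral_cong)
  also have "\<dots> = \<bar>1 / e j\<bar> * (\<integral>\<^sup>+x. (\<integral>\<^sup>+s. g (- s) (\<lambda>i\<in>I. x i + (- 2 * s * e i)) \<partial>lborel) \<partial>?PI)"
    by (rule nn_integral_cmult) (rule lborel.borel_measurable_nn_integral[OF m2])
  also have "\<dots> = \<bar>1 / e j\<bar> * (\<integral>\<^sup>+x. (\<integral>\<^sup>+s. g s x \<partial>lborel) \<partial>?PI)"
    by (simp only: main)
  also have "\<dots> = (\<integral>\<^sup>+x. \<bar>1 / e j\<bar> * (\<integral>\<^sup>+s. g s x \<partial>lborel) \<partial>?PI)"
    by (rule nn_integral_cmult[symmetric]) (rule lborel.borel_measurable_nn_integral[OF m3])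
  also have "\<dots> = (\<integral>\<^sup>+x. f x \<partial>Pi\<^sub>M {..<p} (\<lambda>_. lborel))"
    unfolding g_def by (rule subst[OF f, symmetric])
  finally show ?thesis .
qed

lemma distr_PiM_lborel_refl_at:
  assumes "ip p e e = 1"
  shows "distr (Pi\<^sub>M {..<p} (\<lambda>_. lborel)) (Pi\<^sub>M {..<p} (\<lambda>_. lborel)) (refl_at p e) = Pi\<^sub>M {..<p} (\<lambda>_. lborel)"
proof (rule measure_eqI)
  fix A assume "A \<in> sets (distr (Pi\<^sub>M {..<p} (\<lambda>_. lborel :: real measure)) (Pi\<^sub>M {..<p} (\<lambda>_. lborel)) (refl_at p e))"
  then have A[measurable]: "A \<in> sets (Pi\<^sub>M {..<p} (\<lambda>_. lborel))" by simp
  have "emeasure (distr (Pi\<^sub>M {..<p} (\<lambda>_. lborel)) (Pi\<^sub>M {..<p} (\<lambda>_. lborel)) (refl_at p e)) A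
      = (\<integral>\<^sup>+x. indicator A x \<partial>distr (Pi\<^sub>M {..<p} (\<lambda>_. lborel)) (Pi\<^sub>M {..<p} (\<lambda>_. lborel)) (refl_at p e))"
    by simp
  also have "\<dots> = (\<integral>\<^sup>+x. indicator A (refl_at p e x) \<partial>Pi\<^sub>M {..<p} (\<lambda>_. lborel))"
    by (rule nn_integral_distr) measurable
  also have "\<dots> = (\<integral>\<^sup>+x. indicator A x \<partial>Pi\<^sub>M {..<p} (\<lambda>_. lborel))"
    by (rule nn_integral_refl_at[OF assms]) measurable
  finally show "emeasure (distr (Pi\<^sub>M {..<p} (\<lambda>_. lborel)) (Pi\<^sub>M {..<p} (\<lambda>_. lborel)) (refl_at p e)) A
      = emeasure (Pi\<^sub>M {..<p} (\<lambda>_. lborel)) A" by simp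
qed simp

section \<open>Uniform distribution on the ball and its radial projection\<close>

lemma sets_PiM_lborel: "sets (Pi\<^sub>M {..<p} (\<lambda>_. lborel)) = sets (RV p)"
  by (rule sets_PiM_cong) auto

lemma measurable_PiM_lborel_cong: "(f \<in> Pi\<^sub>M {..<p} (\<lambda>_. lborel) \<rightarrow>\<^sub>M N) = (f \<in> RV p \<rightarrow>\<^sub>M N)"
  by (rule arg_cong[where f = "\<lambda>X. f \<in> X"], rule measurable_cong_sets[OF sets_PiM_lborel refl])

lemma nrm_measurable [measurable]: "nrm p \<in> borel_measurable (RV p)"
  unfolding nrm_def L2_set_def by measurable

lemma ip_measurable [measurable]:
  assumes [measurable]: "f \<in> N \<rightarrow>\<^sub>M RV p" "g \<in> N \<rightarrow>\<^sub>M RV p"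
  shows "(\<lambda>z. ip p (f z) (g z)) \<in> borel_measurable N"
  unfolding ip_def by measurable

lemma ip_measurable_const [measurable]:
  assumes [measurable]: "f \<in> N \<rightarrow>\<^sub>M RV p"
  shows "(\<lambda>z. ip p (f z) e) \<in> borel_measurable N" "(\<lambda>z. ip p e (f z)) \<in> borel_measurable N"
  unfolding ip_def by measurable

abbreviation unit_ball :: "nat \<Rightarrow> (nat \<Rightarrow> real) set" where
  "unit_ball p \<equiv> {x \<in> Rp p. nrm p x \<le> 1}"

lemma nrm_le_1_iff: "nrm p x \<le> 1 \<longleftrightarrow> ip p x x \<le> 1"
  by (simp add: nrm_sq[symmetric] power_le_one_iff)

lemma unit_ball_sets [measurable]: "unit_ball p \<in> sets (RV p)"
proof -
  have "{x \<in> space (RV p). nrm p x \<le> 1} \<in> sets (RV p)" by measurable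
  then show ?thesis by (simp add: space_RV)
qed

text \<open>The ball contains the cube of half side 1/p, since p (1/p)^2 <= 1, and lies in the cube
  of half side 1. Hence conditioning Lebesgue measure on it is legitimate.\<close>

lemma emeasure_unit_ball:
  assumes "1 \<le> p"
  shows "emeasure (Pi\<^sub>M {..<p} (\<lambda>_. lborel)) (unit_ball p) \<noteq> 0"
    "emeasure (Pi\<^sub>M {..<p} (\<lambda>_. lborel)) (unit_ball p) \<noteq> \<infinity>"
proof -
  let ?l = "Pi\<^sub>M {..<p} (\<lambda>_. lborel :: real measure)"
  have cube: "emeasure ?l (Pi\<^sub>E {..<p} (\<lambda>_. {-c..c})) = ennreal (2 * c) ^ p" if "0 \<le> c" for c :: real
    using that by (subst lborel_prod.emeasure_PiM) auto
  have "Pi\<^sub>E {..<p} (\<lambda>_. {-(1 / real p)..1 / real p}) \<subseteq> unit_ball p"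
  proof
    fix x assume x: "x \<in> Pi\<^sub>E {..<p} (\<lambda>_. {-(1 / real p)..1 / real p})"
    have "(x i)\<^sup>2 \<le> 1 / real p" if "i < p" for i
    proof -
      have "- (1 / real p) \<le> x i" "x i \<le> 1 / real p" using x that by (auto simp: PiE_iff)
      then have "\<bar>x i\<bar> \<le> 1 / real p" by linarith
      then have "\<bar>x i\<bar>\<^sup>2 \<le> (1 / real p)\<^sup>2" by (intro power_mono) auto
      also have "\<dots> \<le> 1 / real p" using assms by (simp add: power2_eq_square field_simps)
      finally show ?thesis by simp
    qed
    then have "(\<Sum>i<p. (x i)\<^sup>2) \<le> (\<Sum>i<p. 1 / real p)" by (intro sum_mono) auto
    then show "x \<in> unit_ball p" using x assms by (auto simp: nrm_le_1_iff ip_self PiE_iff)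
  qed
  then have "emeasure ?l (Pi\<^sub>E {..<p} (\<lambda>_. {-(1 / real p)..1 / real p})) \<le> emeasure ?l (unit_ball p)"
    by (intro emeasure_mono) (auto simp: sets_PiM_lborel)
  moreover have "0 < ennreal (2 * (1 / real p)) ^ p"
    using assms by (auto simp: ennreal_power)
  ultimately show "emeasure ?l (unit_ball p) \<noteq> 0"
    using cube[of "1 / real p"] by auto
  have "unit_ball p \<subseteq> Pi\<^sub>E {..<p} (\<lambda>_. {-1..1})"
  proof
    fix x assume x: "x \<in> unit_ball p"
    have "\<bar>x i\<bar> \<le> 1" if "i < p" for i
    proof -
      have "(x i)\<^sup>2 \<le> (\<Sum>i<p. (x i)\<^sup>2)" using that by (intro member_le_sum) auto
      also have "\<dots> \<le> 1" using x by (auto simp: nrm_le_1_iff ip_self)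
      finally show ?thesis by (simp add: abs_square_le_1)
    qed
    then show "x \<in> Pi\<^sub>E {..<p} (\<lambda>_. {-1..1})" using x by (auto simp: abs_le_iff PiE_iff minus_le_iff)
  qed
  then have "emeasure ?l (unit_ball p) \<le> emeasure ?l (Pi\<^sub>E {..<p} (\<lambda>_. {-1..1}))"
    by (intro emeasure_mono) (auto intro!: sets_PiM_I_finite)
  also have "\<dots> < \<infinity>" using cube[of 1] by (simp add: power_less_top_ennreal)
  finally show "emeasure ?l (unit_ball p) \<noteq> \<infinity>" by simp
qed

text \<open>At the origin division by zero yields the zero vector; for p >= 1 the origin is a null
  set.\<close>

definition radial :: "nat \<Rightarrow> (nat \<Rightarrow> real) \<Rightarrow> nat \<Rightarrow> real" where
  "radial p x = (\<lambda>j\<in>{..<p}. x j / nrm p x)"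

lemma radial_measurable [measurable]: "radial p \<in> RV p \<rightarrow>\<^sub>M RV p"
  unfolding radial_def by measurable

context
  fixes p :: nat
  assumes p: "1 \<le> p"
begin

abbreviation (input) "ball_measure \<equiv> uniform_measure (Pi\<^sub>M {..<p} (\<lambda>_. lborel)) (unit_ball p)"

lemma unif_sphere_eq: "unif_sphere p = distr ball_measure (RV p) (radial p)"
  by (simp add: unif_sphere_def radial_def[abs_def])

lemma sets_unif_sphere [simp, measurable_cong]: "sets (unif_sphere p) = sets (RV p)"
  by (simp add: unif_sphere_def)

lemma space_unif_sphere: "space (unif_sphere p) = Rp p"
  by (simp add: unif_sphere_def space_RV)

lemma ball_measure_meas: "(f \<in> ball_measure \<rightarrow>\<^sub>M N) = (f \<in> RV p \<rightarrow>\<^sub>M N)"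
  by (rule arg_cong[where f = "\<lambda>X. f \<in> X"], rule measurable_cong_sets) (auto simp: sets_PiM_lborel)

lemma prob_space_unif_sphere: "prob_space (unif_sphere p)"
proof -
  interpret prob_space ball_measure
    using emeasure_unit_ball[OF p] by (rule prob_space_uniform_measure)
  show ?thesis
    unfolding unif_sphere_eq by (rule prob_space_distr) (simp add: ball_measure_meas)
qed

lemma AE_unif_sphere: "AE u in unif_sphere p. ip p u u = 1"
proof -
  let ?l = "Pi\<^sub>M {..<p} (\<lambda>_. lborel :: real measure)"
  have "emeasure ?l (Pi\<^sub>E {..<p} (\<lambda>_. {0})) = 0"
    using p by (subst lborel_prod.emeasure_PiM) auto
  then have "AE x in ?l. x \<notin> Pi\<^sub>E {..<p} (\<lambda>_. {0})"
    by (intro AE_not_in null_setsI sets_PiM_I_finite) simp_all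
  then have "AE x in ?l. nrm p x \<noteq> 0"
  proof (rule AE_mp, intro AE_I2 impI notI)
    fix x assume x: "x \<in> space ?l" "x \<notin> Pi\<^sub>E {..<p} (\<lambda>_. {0})" "nrm p x = 0"
    then have "ip p x x = 0" by (simp add: nrm_sq[symmetric])
    then have "x i = 0" if "i < p" for i using that by (simp add: ip_self_eq_0)
    then have "x \<in> Pi\<^sub>E {..<p} (\<lambda>_. {0})"
      using x(1) by (intro PiE_I) (auto simp: space_PiM PiE_iff extensional_def)
    then show False using x(2) by blast
  qed
  then have "AE x in ?l. ip p (radial p x) (radial p x) = 1"
  proof (rule AE_mp, intro AE_I2 impI)
    fix x assume x: "nrm p x \<noteq> 0"
    have "ip p (radial p x) (radial p x) = ip p x x / (nrm p x)\<^sup>2"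
      by (simp add: ip_def radial_def sum_divide_distrib power2_eq_square)
    then show "ip p (radial p x) (radial p x) = 1" using x by (simp add: nrm_sq[symmetric])
  qed
  then have "AE x in ball_measure. ip p (radial p x) (radial p x) = 1"
    by (intro AE_uniform_measureI) (auto simp: sets_PiM_lborel)
  then show ?thesis
    unfolding unif_sphere_eq
    by (subst AE_distr_iff) (auto simp: ball_measure_meas)
qed

text \<open>The reflection preserves the norm, hence the ball and Lebesgue measure conditioned on
  it, and it commutes with the radial projection.\<close>

lemma distr_unif_sphere_refl_at:
  assumes e: "ip p e e = 1"
  shows "distr (unif_sphere p) (RV p) (refl_at p e) = unif_sphere p"
proof -
  let ?l = "Pi\<^sub>M {..<p} (\<lambda>_. lborel :: real measure)"
  have nrm: "nrm p (refl_at p e x) = nrm p x" for x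
    using ip_refl_at(2)[OF e, of x] by (simp add: nrm_sq[symmetric] power2_eq_iff_nonneg)
  have comm: "refl_at p e (radial p x) = radial p (refl_at p e x)" for x
  proof
    fix j
    have "ip p (radial p x) e = ip p x e / nrm p x"
      by (simp add: ip_def radial_def sum_divide_distrib)
    then show "refl_at p e (radial p x) j = radial p (refl_at p e x) j"
      using nrm by (simp add: refl_at_def radial_def diff_divide_distrib)
  qed
  have 1: "distr ball_measure ?l (refl_at p e) = ball_measure"
  proof (rule measure_eqI)
    fix A assume "A \<in> sets (distr ball_measure ?l (refl_at p e))"
    then have A: "A \<in> sets ?l" by simp
    have B: "unit_ball p \<in> sets ?l" by (simp add: sets_PiM_lborel)
    have R: "refl_at p e \<in> ?l \<rightarrow>\<^sub>M ?l" by measurable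
    then have R': "refl_at p e \<in> ball_measure \<rightarrow>\<^sub>M ?l" by (simp only: measurable_cong_sets[OF sets_uniform_measure refl])
    let ?A' = "refl_at p e -` A \<inter> space ?l"
    have A': "?A' \<in> sets ?l" using R A by (rule measurable_sets)
    have "emeasure (distr ball_measure ?l (refl_at p e)) A = emeasure ball_measure ?A'"
      using R' A by (subst emeasure_distr) (auto simp: space_uniform_measure)
    also have "\<dots> = emeasure ?l (unit_ball p \<inter> ?A') / emeasure ?l (unit_ball p)"
      using B A' by (rule emeasure_uniform_measure)
    also have "unit_ball p \<inter> ?A' = refl_at p e -` (unit_ball p \<inter> A) \<inter> space ?l"
      using nrm by (auto simp: space_PiM)
    also have "emeasure ?l \<dots> = emeasure (distr ?l ?l (refl_at p e)) (unit_ball p \<inter> A)"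
      using R A B by (subst emeasure_distr) auto
    also have "\<dots> = emeasure ?l (unit_ball p \<inter> A)"
      by (simp add: distr_PiM_lborel_refl_at[OF e])
    also have "\<dots> / emeasure ?l (unit_ball p) = emeasure ball_measure A"
      using B A by (rule emeasure_uniform_measure[symmetric])
    finally show "emeasure (distr ball_measure ?l (refl_at p e)) A = emeasure ball_measure A" .
  qed simp
  have "distr (unif_sphere p) (RV p) (refl_at p e) = distr ball_measure (RV p) (refl_at p e \<circ> radial p)"
    unfolding unif_sphere_eq by (rule distr_distr) (auto simp: ball_measure_meas)
  also have "refl_at p e \<circ> radial p = radial p \<circ> refl_at p e" by (auto simp: comm fun_eq_iff)
  also have "distr ball_measure (RV p) (radial p \<circ> refl_at p e)
      = distr (distr ball_measure ?l (refl_at p e)) (RV p) (radial p)"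
    by (rule distr_distr[symmetric]) (auto simp: measurable_PiM_lborel_cong ball_measure_meas measurable_cong_sets[OF refl sets_PiM_lborel])
  finally show ?thesis by (simp add: 1 unif_sphere_eq)
qed

lemma integral_unif_sphere_refl_at:
  fixes f :: "(nat \<Rightarrow> real) \<Rightarrow> real"
  assumes "ip p e e = 1" and f: "f \<in> borel_measurable (RV p)"
  shows "(\<integral>u. f (refl_at p e u) \<partial>unif_sphere p) = (\<integral>u. f u \<partial>unif_sphere p)"
proof -
  have "(\<integral>u. f u \<partial>unif_sphere p) = (\<integral>u. f u \<partial>distr (unif_sphere p) (RV p) (refl_at p e))"
    by (simp add: distr_unif_sphere_refl_at[OF assms(1)])
  also have "\<dots> = (\<integral>u. f (refl_at p e u) \<partial>unif_sphere p)"
    using f by (intro integral_distr) measurable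
  finally show ?thesis ..
qed

lemma integrable_unif_sphere:
  fixes f :: "(nat \<Rightarrow> real) \<Rightarrow> real"
  assumes [measurable]: "f \<in> borel_measurable (RV p)"
    and "\<And>u. u \<in> Rp p \<Longrightarrow> ip p u u = 1 \<Longrightarrow> \<bar>f u\<bar> \<le> C"
  shows "integrable (unif_sphere p) f"
proof -
  interpret prob_space "unif_sphere p" by (rule prob_space_unif_sphere)
  show ?thesis
  proof (rule integrable_const_bound[where B = C])
    have "AE u in unif_sphere p. u \<in> Rp p" by (rule AE_I2) (simp add: space_unif_sphere)
    then show "AE u in unif_sphere p. norm (f u) \<le> C"
      using AE_unif_sphere by eventually_elim (use assms(2) in auto)
  qed measurable
qed

section \<open>Second moments of the sphere\<close>

lemma coord_le_1: "ip p u u = 1 \<Longrightarrow> i < p \<Longrightarrow> \<bar>u i\<bar> \<le> 1"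
proof -
  assume a: "ip p u u = 1" "i < p"
  then have "(u i)\<^sup>2 \<le> (\<Sum>i<p. (u i)\<^sup>2)" by (intro member_le_sum) auto
  then show ?thesis using a by (simp add: ip_self abs_square_le_1)
qed

lemma coords_measurable [measurable]:
  assumes "i < p" "j < p"
  shows "(\<lambda>u. u i * u j) \<in> borel_measurable (RV p)"
  using assms by (intro borel_measurable_times measurable_component_singleton) auto

lemma integrable_sphere_coords:
  assumes "i < p" "j < p"
  shows "integrable (unif_sphere p) (\<lambda>u. u i * u j)"
proof (rule integrable_unif_sphere[where C = 1])
  show "(\<lambda>u. u i * u j) \<in> borel_measurable (RV p)" using assms by (rule coords_measurable)
  fix u assume "ip p u u = 1"
  then show "\<bar>u i * u j\<bar> \<le> 1"
    using coord_le_1[of u] assms by (simp add: abs_mult mult_le_one)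
qed

text \<open>Two kinds of reflections suffice. The one at e_i changes the sign of u_i and so kills
  the mixed moments; the one at (e_i - e_j) / sqrt 2 exchanges the coordinates i and j, so all
  squares have the same mean. These means add up to 1.\<close>

lemma sphere_moment:
  assumes ij: "i < p" "j < p"
  shows "(\<integral>u. u i * u j \<partial>unif_sphere p) = (if i = j then 1 / real p else 0)"
proof -
  define e :: "nat \<Rightarrow> nat \<Rightarrow> real" where "e i l = (if l = i then 1 else 0)" for i l
  have ipe: "ip p x (e i) = x i" if "i < p" for x i
    using that by (simp add: ip_def e_def if_distrib sum.delta cong: if_cong)
  have off: "(\<integral>u. u i * u j \<partial>unif_sphere p) = 0" if ij: "i < p" "j < p" "i \<noteq> j" for i j
  proof -
    have "ip p (e i) (e i) = 1" using ij by (subst ipe) (auto simp: e_def)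
    moreover have "(\<lambda>u. u i * u j) \<in> borel_measurable (RV p)" using ij by (intro coords_measurable)
    ultimately have "(\<integral>u. u i * u j \<partial>unif_sphere p)
        = (\<integral>u. refl_at p (e i) u i * refl_at p (e i) u j \<partial>unif_sphere p)"
      by (rule integral_unif_sphere_refl_at[symmetric])
    also have "\<dots> = (\<integral>u. - (u i * u j) \<partial>unif_sphere p)"
      using ij by (simp add: refl_at_def ipe) (simp add: e_def)
    finally show ?thesis by simp
  qed
  have diag: "(\<integral>u. u i * u i \<partial>unif_sphere p) = (\<integral>u. u j * u j \<partial>unif_sphere p)" if ij: "i < p" "j < p" for i j
  proof (cases "i = j")
    case False
    define d where "d l = (e i l - e j l) / sqrt 2" for l
    have ipd: "ip p x d = (x i - x j) / sqrt 2" for x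
    proof -
      have "ip p x d = (ip p x (e i) - ip p x (e j)) / sqrt 2"
        by (simp add: ip_def d_def sum_divide_distrib sum_subtractf[symmetric] right_diff_distrib diff_divide_distrib)
      then show ?thesis using ij by (simp add: ipe)
    qed
    have "ip p d d = 1" unfolding ipd using False by (simp add: d_def e_def field_simps)
    moreover have "(\<lambda>u. u i * u i) \<in> borel_measurable (RV p)" using ij by (intro coords_measurable)
    ultimately have "(\<integral>u. u i * u i \<partial>unif_sphere p)
        = (\<integral>u. refl_at p d u i * refl_at p d u i \<partial>unif_sphere p)"
      by (rule integral_unif_sphere_refl_at[symmetric])
    also have "\<dots> = (\<integral>u. u j * u j \<partial>unif_sphere p)"
    proof -
      have "refl_at p d u i = u j" for u
        using False ij by (simp add: refl_at_def ipd) (simp add: d_def e_def field_simps)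
      then show ?thesis by simp
    qed
    finally show ?thesis .
  qed simp
  have "(\<integral>u. ip p u u \<partial>unif_sphere p) = 1"
  proof -
    interpret prob_space "unif_sphere p" by (rule prob_space_unif_sphere)
    have "(\<integral>u. ip p u u \<partial>unif_sphere p) = (\<integral>u. 1 \<partial>unif_sphere p)"
      using AE_unif_sphere by (intro integral_cong_AE) auto
    then show ?thesis by (simp add: prob_space)
  qed
  also have "(\<integral>u. ip p u u \<partial>unif_sphere p) = (\<Sum>l<p. (\<integral>u. u l * u l \<partial>unif_sphere p))"
    unfolding ip_def by (intro Bochner_Integration.integral_sum integrable_sphere_coords) auto
  also have "\<dots> = (\<Sum>l<p. (\<integral>u. u i * u i \<partial>unif_sphere p))"
    using ij by (intro sum.cong diag) auto
  finally have "real p * (\<integral>u. u i * u i \<partial>unif_sphere p) = 1" by simp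
  then show ?thesis using off[OF ij] p by (auto simp: field_simps)
qed

lemma sphere_second_moment:
  shows "integrable (unif_sphere p) (\<lambda>u. ip p x u * ip p y u)"
    and "(\<integral>u. ip p x u * ip p y u \<partial>unif_sphere p) = ip p x y / real p"
proof -
  have *: "(\<lambda>u. ip p x u * ip p y u) = (\<lambda>u. \<Sum>i<p. \<Sum>j<p. x i * y j * (u i * u j))"
    by (auto simp: ip_def sum_product algebra_simps fun_eq_iff)
  have int: "integrable (unif_sphere p) (\<lambda>u. x i * y j * (u i * u j))" if "i < p" "j < p" for i j
    using integrable_sphere_coords[OF that] by simp
  show "integrable (unif_sphere p) (\<lambda>u. ip p x u * ip p y u)"
    unfolding * by (intro Bochner_Integration.integrable_sum int) auto
  have "(\<integral>u. ip p x u * ip p y u \<partial>unif_sphere p)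
      = (\<Sum>i<p. \<Sum>j<p. x i * y j * (\<integral>u. u i * u j \<partial>unif_sphere p))"
  proof -
    have "(\<integral>u. (\<Sum>i<p. \<Sum>j<p. x i * y j * (u i * u j)) \<partial>unif_sphere p)
        = (\<Sum>i<p. (\<integral>u. (\<Sum>j<p. x i * y j * (u i * u j)) \<partial>unif_sphere p))"
      by (intro Bochner_Integration.integral_sum Bochner_Integration.integrable_sum int) auto
    also have "\<dots> = (\<Sum>i<p. \<Sum>j<p. (\<integral>u. x i * y j * (u i * u j) \<partial>unif_sphere p))"
      by (intro sum.cong Bochner_Integration.integral_sum int) auto
    finally show ?thesis unfolding * by (simp only: integral_mult_right_zero)
  qed
  also have "\<dots> = (\<Sum>i<p. \<Sum>j<p. if i = j then x i * y j / real p else 0)"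
    by (intro sum.cong) (auto simp: sphere_moment)
  also have "\<dots> = ip p x y / real p" by (simp add: ip_def sum_divide_distrib)
  finally show "(\<integral>u. ip p x u * ip p y u \<partial>unif_sphere p) = ip p x y / real p" .
qed

text \<open>Antisymmetrizing under the reflection at the hyperplane orthogonal to \<open>e\<close> gains a factor
  \<open>1 / sqrt p\<close> over the Cauchy-Schwarz inequality.\<close>

lemma sphere_reflection_bound:
  assumes e: "ip p e e = 1" and h: "h \<in> borel_measurable (RV p)"
    and hC: "\<And>u. u \<in> Rp p \<Longrightarrow> ip p u u = 1 \<Longrightarrow> \<bar>h u\<bar> \<le> C"
    and hK: "\<And>u. u \<in> Rp p \<Longrightarrow> ip p u u = 1 \<Longrightarrow> \<bar>h u - h (refl_at p e u)\<bar> \<le> 2 * K * \<bar>ip p u e\<bar>"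
  shows "\<bar>\<integral>u. h u * ip p u e \<partial>unif_sphere p\<bar> \<le> K / real p"
proof -
  interpret prob_space "unif_sphere p" by (rule prob_space_unif_sphere)
  note h[measurable]
  have e1: "\<bar>ip p u e\<bar> \<le> 1" if "ip p u u = 1" for u
    using ip_Cauchy_Schwarz[of p u e] that e by (simp add: abs_square_le_1)
  have int: "integrable (unif_sphere p) (\<lambda>u. f u * ip p u e)"
    if "f \<in> borel_measurable (RV p)" "\<And>u. u \<in> Rp p \<Longrightarrow> ip p u u = 1 \<Longrightarrow> \<bar>f u\<bar> \<le> C" for f C
  proof (rule integrable_unif_sphere[where C = "\<bar>C\<bar>"])
    fix u assume u: "u \<in> Rp p" "ip p u u = 1"
    have "\<bar>f u * ip p u e\<bar> \<le> \<bar>f u\<bar> * 1" unfolding abs_mult using e1[OF u(2)] by (intro mult_left_mono) auto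
    then show "\<bar>f u * ip p u e\<bar> \<le> \<bar>C\<bar>" using that(2)[OF u] by simp
  qed (use that in measurable)
  have i1: "integrable (unif_sphere p) (\<lambda>u. h u * ip p u e)" by (rule int[OF h hC])
  have hR: "(\<lambda>u. h (refl_at p e u)) \<in> borel_measurable (RV p)" by measurable
  have i2: "integrable (unif_sphere p) (\<lambda>u. h (refl_at p e u) * ip p u e)"
    using ip_refl_at[OF e] by (intro int[OF hR, of C] hC) auto
  \<comment> \<open>Substituting the reflected point changes the sign of <u, e>; averaging both
    forms leaves half the increment of h under the reflection.\<close>
  have "(\<integral>u. h u * ip p u e \<partial>unif_sphere p)
      = (\<integral>u. h (refl_at p e u) * ip p (refl_at p e u) e \<partial>unif_sphere p)"
    by (rule integral_unif_sphere_refl_at[OF e, symmetric]) measurable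
  also have "\<dots> = - (\<integral>u. h (refl_at p e u) * ip p u e \<partial>unif_sphere p)"
    by (simp add: ip_refl_at[OF e])
  finally have "2 * (\<integral>u. h u * ip p u e \<partial>unif_sphere p)
      = (\<integral>u. h u * ip p u e \<partial>unif_sphere p) - (\<integral>u. h (refl_at p e u) * ip p u e \<partial>unif_sphere p)" by simp
  also have "\<dots> = (\<integral>u. (h u - h (refl_at p e u)) * ip p u e \<partial>unif_sphere p)"
    using i1 i2 by (simp add: left_diff_distrib)
  finally have "2 * \<bar>\<integral>u. h u * ip p u e \<partial>unif_sphere p\<bar>
      = \<bar>\<integral>u. (h u - h (refl_at p e u)) * ip p u e \<partial>unif_sphere p\<bar>" by simp
  also have "\<dots> \<le> (\<integral>u. \<bar>(h u - h (refl_at p e u)) * ip p u e\<bar> \<partial>unif_sphere p)"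
    by (rule integral_abs_bound)
  \<comment> \<open>The increment supplies a second factor <u, e>, and the mean of <u, e>^2 is
    1/p.\<close>
  also have "\<dots> \<le> (\<integral>u. 2 * K * (ip p e u * ip p e u) \<partial>unif_sphere p)"
  proof (rule integral_mono_AE)
    show "integrable (unif_sphere p) (\<lambda>u. \<bar>(h u - h (refl_at p e u)) * ip p u e\<bar>)"
      using i1 i2 by (simp add: left_diff_distrib)
    show "integrable (unif_sphere p) (\<lambda>u. 2 * K * (ip p e u * ip p e u))"
      by (intro integrable_mult_right sphere_second_moment(1))
    have "AE u in unif_sphere p. u \<in> Rp p" by (rule AE_I2) (simp add: space_unif_sphere)
    then show "AE u in unif_sphere p. \<bar>(h u - h (refl_at p e u)) * ip p u e\<bar> \<le> 2 * K * (ip p e u * ip p e u)"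
      using AE_unif_sphere
    proof eventually_elim
      case (elim u)
      have "\<bar>(h u - h (refl_at p e u)) * ip p u e\<bar> \<le> 2 * K * \<bar>ip p u e\<bar> * \<bar>ip p u e\<bar>"
        unfolding abs_mult using hK[OF elim] by (intro mult_right_mono) auto
      then show ?case by (simp add: ip_commute[of p e u] mult.assoc)
    qed
  qed
  also have "\<dots> = 2 * (K / real p)" using e by (simp add: sphere_second_moment)
  finally show ?thesis by simp
qed

end

subsection \<open>Smooth functions on coordinate space\<close>

lemma nrm_sqrt: "nrm p x = sqrt (ip p x x)"
  by (simp add: nrm_def L2_set_def ip_self)

lemma nrm_cong: "(\<And>i. i < p \<Longrightarrow> x i = y i) \<Longrightarrow> nrm p x = nrm p y"
  by (simp add: nrm_sqrt ip_cong[of p x y x y])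

lemma nrm_scale: "nrm p (\<lambda>j. c * x j) = \<bar>c\<bar> * nrm p x"
  by (simp add: nrm_sqrt ip_simps real_sqrt_mult mult.assoc[symmetric] real_sqrt_abs2)

lemma nrm_eq_0: "nrm p x = 0 \<longleftrightarrow> (\<forall>i<p. x i = 0)"
  by (simp add: nrm_sqrt ip_self_eq_0)

text \<open>The point x + t d. The restriction is essential: a pointwise sum of elements of
  \<open>Rp p\<close> is in general not extensional.\<close>

definition step_to :: "nat \<Rightarrow> (nat \<Rightarrow> real) \<Rightarrow> real \<Rightarrow> (nat \<Rightarrow> real) \<Rightarrow> nat \<Rightarrow> real" where
  "step_to p x t d = (\<lambda>l\<in>{..<p}. x l + t * d l)"

lemma step_to_Rp [simp]: "step_to p x t d \<in> Rp p"
  by (simp add: step_to_def)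

lemma step_to_apply [simp]: "i < p \<Longrightarrow> step_to p x t d i = x i + t * d i"
  by (simp add: step_to_def)

lemma Rp_eqI: "x \<in> Rp p \<Longrightarrow> y \<in> Rp p \<Longrightarrow> (\<And>i. i < p \<Longrightarrow> x i = y i) \<Longrightarrow> x = y"
  by (rule PiE_ext) auto

lemma has_grad_ip:
  "has_grad p \<phi> g x \<longleftrightarrow> g \<in> Rp p \<and>
     (\<forall>e>0. \<exists>d>0. \<forall>y\<in>Rp p. nrm p (\<lambda>j. y j - x j) < d \<longrightarrow>
        \<bar>\<phi> y - \<phi> x - ip p g (\<lambda>j. y j - x j)\<bar> \<le> e * nrm p (\<lambda>j. y j - x j))"
  by (simp add: has_grad_def ip_def)

text \<open>A step from x in the direction g - h separates the two linear approximations, which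
  forces |g - h| <= 2 e for every e. This gives meaning to \<open>grad\<close>, a definite
  description.\<close>

lemma has_grad_unique:
  assumes g: "has_grad p \<phi> g x" and h: "has_grad p \<phi> h x"
  shows "g = h"
proof -
  let ?d = "\<lambda>i. g i - h i"
  have "nrm p ?d \<le> 2 * e" if e: "0 < e" for e
  proof (cases "nrm p ?d = 0")
    case False
    then have D: "0 < nrm p ?d" by (simp add: order_less_le)
    obtain d1 where d1: "d1 > 0" "\<And>y. y \<in> Rp p \<Longrightarrow> nrm p (\<lambda>j. y j - x j) < d1 \<Longrightarrow>
        \<bar>\<phi> y - \<phi> x - ip p g (\<lambda>j. y j - x j)\<bar> \<le> e * nrm p (\<lambda>j. y j - x j)"
      using g[unfolded has_grad_ip, THEN conjunct2, rule_format, OF e] by blast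
    obtain d2 where d2: "d2 > 0" "\<And>y. y \<in> Rp p \<Longrightarrow> nrm p (\<lambda>j. y j - x j) < d2 \<Longrightarrow>
        \<bar>\<phi> y - \<phi> x - ip p h (\<lambda>j. y j - x j)\<bar> \<le> e * nrm p (\<lambda>j. y j - x j)"
      using h[unfolded has_grad_ip, THEN conjunct2, rule_format, OF e] by blast
    \<comment> \<open>The step then has length half the smaller of the two radii.\<close>
    define t where "t = min d1 d2 / (2 * nrm p ?d)"
    have t: "0 < t" using d1 d2 D by (simp add: t_def)
    let ?y = "step_to p x t ?d"
    have cong: "ip p z (\<lambda>j. ?y j - x j) = ip p z (\<lambda>j. t * ?d j)" for z
      by (rule ip_cong) auto
    have n: "nrm p (\<lambda>j. ?y j - x j) = t * nrm p ?d"
      using t by (subst nrm_cong[where y = "\<lambda>j. t * ?d j"]) (auto simp: nrm_scale)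
    have "t * nrm p ?d = min d1 d2 / 2" using D by (simp add: t_def)
    then have "nrm p (\<lambda>j. ?y j - x j) < d1" "nrm p (\<lambda>j. ?y j - x j) < d2"
      using d1 d2 unfolding n by auto
    from d1(2)[OF step_to_Rp this(1)] d2(2)[OF step_to_Rp this(2)]
    have "\<bar>ip p g (\<lambda>j. ?y j - x j) - ip p h (\<lambda>j. ?y j - x j)\<bar> \<le> 2 * e * (t * nrm p ?d)"
      unfolding n by linarith
    also have "ip p g (\<lambda>j. ?y j - x j) - ip p h (\<lambda>j. ?y j - x j) = t * ip p ?d ?d"
      by (simp only: cong ip_scale_right ip_diff_left) (rule right_diff_distrib[symmetric])
    finally have "t * (nrm p ?d * nrm p ?d) \<le> t * (2 * e * nrm p ?d)"
      using t by (simp add: nrm_sq[symmetric] power2_eq_square abs_mult algebra_simps)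
    then have "nrm p ?d * nrm p ?d \<le> 2 * e * nrm p ?d" using t by simp
    then show ?thesis using D by simp
  qed (use e in simp)
  then have "nrm p ?d \<le> 0" using field_le_epsilon[of "nrm p ?d" 0]
    by (metis add.left_neutral mult.commute mult_2_right field_sum_of_halves half_gt_zero)
  then have "nrm p ?d = 0" using nrm_nonneg[of p ?d] by linarith
  then have "\<And>i. i < p \<Longrightarrow> g i = h i" by (simp add: nrm_eq_0)
  then show ?thesis using g h by (intro Rp_eqI) (auto simp: has_grad_def)
qed

lemma grad_eqI: "has_grad p \<phi> g x \<Longrightarrow> grad p \<phi> x = g"
  unfolding grad_def by (rule the_equality) (auto intro: has_grad_unique)

lemma smooth_fun_has_grad: "smooth_fun p L \<phi> \<Longrightarrow> x \<in> Rp p \<Longrightarrow> has_grad p \<phi> (grad p \<phi> x) x"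
  unfolding smooth_fun_def by (metis grad_eqI)

lemma smooth_fun_Lipschitz:
  "smooth_fun p L \<phi> \<Longrightarrow> x \<in> Rp p \<Longrightarrow> y \<in> Rp p \<Longrightarrow>
    nrm p (\<lambda>j. grad p \<phi> x j - grad p \<phi> y j) \<le> L * nrm p (\<lambda>j. x j - y j)"
  by (simp add: smooth_fun_def)

lemma smooth_fun_Lipschitz_sq:
  assumes "smooth_fun p L \<phi>" "x \<in> Rp p" "y \<in> Rp p"
  shows "ip p (\<lambda>j. grad p \<phi> x j - grad p \<phi> y j) (\<lambda>j. grad p \<phi> x j - grad p \<phi> y j)
    \<le> L\<^sup>2 * ip p (\<lambda>j. x j - y j) (\<lambda>j. x j - y j)"
  using power_mono[OF smooth_fun_Lipschitz[OF assms], of 2]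
  by (simp add: nrm_sq power_mult_distrib)

text \<open>The one-dimensional mean value theorem along the segment from x to y; the work is the
  chain rule for \<open>has_grad\<close>.\<close>

lemma smooth_fun_mvt:
  assumes sm: "smooth_fun p L \<phi>" and x: "x \<in> Rp p" and y: "y \<in> Rp p"
  obtains t where "0 < t" "t < 1"
    "\<phi> y - \<phi> x = ip p (grad p \<phi> (step_to p x t (\<lambda>j. y j - x j))) (\<lambda>j. y j - x j)"
proof -
  let ?d = "\<lambda>j. y j - x j"
  let ?s = "\<lambda>t. step_to p x t ?d"
  have der: "((\<lambda>t. \<phi> (?s t)) has_real_derivative ip p (grad p \<phi> (?s t)) ?d) (at t)" for t
    unfolding has_field_derivative_def has_derivative_at_alt
  proof (intro conjI allI impI)
    show "bounded_linear ((*) (ip p (grad p \<phi> (?s t)) ?d))" by (rule bounded_linear_mult_right)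
    fix e :: real assume e: "0 < e"
    \<comment> \<open>The added 1 keeps the divisor positive when y = x.\<close>
    define e' where "e' = e / (nrm p ?d + 1)"
    have pos: "0 < nrm p ?d + 1" using nrm_nonneg[of p ?d] by linarith
    have e': "0 < e'" using e pos by (simp add: e'_def)
    obtain d where d: "d > 0 \<and> (\<forall>z\<in>Rp p. nrm p (\<lambda>j. z j - ?s t j) < d \<longrightarrow>
        \<bar>\<phi> z - \<phi> (?s t) - ip p (grad p \<phi> (?s t)) (\<lambda>j. z j - ?s t j)\<bar> \<le> e' * nrm p (\<lambda>j. z j - ?s t j))"
      using smooth_fun_has_grad[OF sm step_to_Rp, unfolded has_grad_ip, THEN conjunct2, rule_format, OF e'] ..
    show "\<exists>\<delta>>0. \<forall>s. norm (s - t) < \<delta> \<longrightarrow>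
        norm (\<phi> (?s s) - \<phi> (?s t) - ip p (grad p \<phi> (?s t)) ?d * (s - t)) \<le> e * norm (s - t)"
    proof (intro exI conjI allI impI)
      show "0 < d / (nrm p ?d + 1)" using d[THEN conjunct1] pos by simp
      fix s assume s: "norm (s - t) < d / (nrm p ?d + 1)"
      have c: "?s s j - ?s t j = (s - t) * ?d j" if "j < p" for j
        using that by (simp add: algebra_simps)
      have n: "nrm p (\<lambda>j. ?s s j - ?s t j) = \<bar>s - t\<bar> * nrm p ?d"
        using nrm_cong[of p "\<lambda>j. ?s s j - ?s t j" "\<lambda>j. (s - t) * ?d j", OF c]
        by (simp only: nrm_scale)
      have i: "ip p (grad p \<phi> (?s t)) (\<lambda>j. ?s s j - ?s t j) = ip p (grad p \<phi> (?s t)) ?d * (s - t)"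
        using ip_cong[of p "grad p \<phi> (?s t)" "grad p \<phi> (?s t)" "\<lambda>j. ?s s j - ?s t j" "\<lambda>j. (s - t) * ?d j", OF refl c]
        by (simp only: ip_scale_right mult.commute)
      have le: "\<bar>s - t\<bar> * nrm p ?d \<le> \<bar>s - t\<bar> * (nrm p ?d + 1)" by (intro mult_left_mono) auto
      also have "\<dots> < d" using s pos by (simp add: pos_less_divide_eq)
      finally have "nrm p (\<lambda>j. ?s s j - ?s t j) < d" unfolding n .
      from d[THEN conjunct2, rule_format, OF step_to_Rp this]
      have "\<bar>\<phi> (?s s) - \<phi> (?s t) - ip p (grad p \<phi> (?s t)) ?d * (s - t)\<bar> \<le> e' * (\<bar>s - t\<bar> * nrm p ?d)"
        unfolding n i .
      also have "\<dots> \<le> e' * (\<bar>s - t\<bar> * (nrm p ?d + 1))" using le e' by (intro mult_left_mono) auto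
      also have "\<dots> = e * \<bar>s - t\<bar>" using pos by (simp add: e'_def)
      finally show "norm (\<phi> (?s s) - \<phi> (?s t) - ip p (grad p \<phi> (?s t)) ?d * (s - t)) \<le> e * norm (s - t)"
        by simp
    qed
  qed
  have ends: "?s 0 = x" "?s 1 = y"
    by (rule Rp_eqI[OF step_to_Rp x], simp) (rule Rp_eqI[OF step_to_Rp y], simp)
  have "\<exists>t>0. t < 1 \<and> \<phi> (?s 1) - \<phi> (?s 0) = (1 - 0) * ip p (grad p \<phi> (?s t)) ?d"
    by (rule MVT2) (simp, rule der)
  then obtain t where t: "0 < t" "t < 1" "\<phi> (?s 1) - \<phi> (?s 0) = (1 - 0) * ip p (grad p \<phi> (?s t)) ?d"
    by (elim exE conjE)
  show ?thesis
    using t(3) unfolding ends by (intro that[OF t(1,2)]) simp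
qed

text \<open>The constant is L and not L/2, since the gradient is compared at a single intermediate
  point and is not integrated along the segment.\<close>

lemma smooth_fun_quadratic_bound:
  assumes sm: "smooth_fun p L \<phi>" and L: "0 \<le> L" and x: "x \<in> Rp p" and y: "y \<in> Rp p"
  shows "\<bar>\<phi> y - \<phi> x - ip p (grad p \<phi> x) (\<lambda>j. y j - x j)\<bar> \<le> L * ip p (\<lambda>j. y j - x j) (\<lambda>j. y j - x j)"
proof -
  let ?d = "\<lambda>j. y j - x j"
  obtain t where t: "0 < t" "t < 1" "\<phi> y - \<phi> x = ip p (grad p \<phi> (step_to p x t ?d)) ?d"
    using smooth_fun_mvt[OF sm x y] by blast
  let ?z = "step_to p x t ?d"
  have "\<phi> y - \<phi> x - ip p (grad p \<phi> x) ?d = ip p (\<lambda>j. grad p \<phi> ?z j - grad p \<phi> x j) ?d"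
    by (simp add: t ip_diff_left)
  then have "\<bar>\<phi> y - \<phi> x - ip p (grad p \<phi> x) ?d\<bar>
      \<le> nrm p (\<lambda>j. grad p \<phi> ?z j - grad p \<phi> x j) * nrm p ?d"
    by (simp add: ip_le_nrm)
  also have "\<dots> \<le> (L * nrm p (\<lambda>j. ?z j - x j)) * nrm p ?d"
    by (intro mult_right_mono smooth_fun_Lipschitz[OF sm _ x]) auto
  also have "nrm p (\<lambda>j. ?z j - x j) = t * nrm p ?d"
    using t by (subst nrm_cong[where y = "\<lambda>j. t * ?d j"]) (simp_all add: nrm_scale)
  also have "(L * (t * nrm p ?d)) * nrm p ?d = t * (L * (nrm p ?d)\<^sup>2)" by (simp add: power2_eq_square)
  also have "\<dots> \<le> 1 * (L * (nrm p ?d)\<^sup>2)" using t L by (intro mult_right_mono) auto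
  finally show ?thesis by (simp add: nrm_sq)
qed

lemma infval_le: "bdd_below (\<phi> ` Rp p) \<Longrightarrow> x \<in> Rp p \<Longrightarrow> infval p \<phi> \<le> \<phi> x"
  unfolding infval_def by (rule cINF_lower)

text \<open>A gradient step of length 1 / (2 L), the minimizer of the quadratic upper bound,
  decreases \<phi> by at least |grad|^2 / (4 L), and the result cannot fall below the
  infimum.\<close>

lemma grad_sq_le:
  assumes sm: "smooth_fun p L \<phi>" and L: "0 < L" and bd: "bdd_below (\<phi> ` Rp p)" and x: "x \<in> Rp p"
  shows "ip p (grad p \<phi> x) (grad p \<phi> x) \<le> 4 * L * (\<phi> x - infval p \<phi>)"
proof -
  let ?g = "grad p \<phi> x" and ?c = "- 1 / (2 * L)"
  let ?y = "step_to p x ?c ?g"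
  have d: "ip p z (\<lambda>j. ?y j - x j) = ?c * ip p z ?g" for z
    using ip_scale_right[of p z ?c ?g] by (subst ip_cong[where x' = z and y' = "\<lambda>j. ?c * ?g j"]) simp_all
  have "ip p (\<lambda>j. ?y j - x j) (\<lambda>j. ?y j - x j) = ?c * ?c * ip p ?g ?g"
  proof -
    have "ip p (\<lambda>j. ?y j - x j) (\<lambda>j. ?y j - x j) = ?c * ip p ?g (\<lambda>j. ?y j - x j)"
      using d[of "\<lambda>j. ?y j - x j"] by (simp only: ip_commute)
    then show ?thesis by (simp only: d mult.assoc)
  qed
  then have "\<phi> ?y \<le> \<phi> x + ?c * ip p ?g ?g + L * (?c * ?c * ip p ?g ?g)"
    using smooth_fun_quadratic_bound[OF sm _ x, of ?y] L by (simp only: d) simp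
  also have "\<dots> = \<phi> x - ip p ?g ?g / (4 * L)"
    using L by (simp add: field_simps)
  finally have "ip p ?g ?g / (4 * L) \<le> \<phi> x - infval p \<phi>"
    using infval_le[OF bd, of ?y] by simp
  then show ?thesis using L by (simp add: field_simps)
qed

text \<open>Lets gradients of expectations and averages be recognized from an averaged quadratic
  bound, without differentiating under the integral.\<close>

lemma has_gradI_quadratic:
  assumes g: "g \<in> Rp p" and C: "0 \<le> C"
    and b: "\<And>y. y \<in> Rp p \<Longrightarrow>
      \<bar>\<phi> y - \<phi> x - ip p g (\<lambda>j. y j - x j)\<bar> \<le> C * ip p (\<lambda>j. y j - x j) (\<lambda>j. y j - x j)"
  shows "has_grad p \<phi> g x"
  unfolding has_grad_ip
proof (intro conjI allI impI g)
  fix e :: real assume e: "0 < e"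
  show "\<exists>d>0. \<forall>y\<in>Rp p. nrm p (\<lambda>j. y j - x j) < d \<longrightarrow>
      \<bar>\<phi> y - \<phi> x - ip p g (\<lambda>j. y j - x j)\<bar> \<le> e * nrm p (\<lambda>j. y j - x j)"
  proof (intro exI conjI ballI impI)
    show "0 < e / (C + 1)" using e C by simp
    fix y assume y: "y \<in> Rp p" "nrm p (\<lambda>j. y j - x j) < e / (C + 1)"
    have "(C + 1) * nrm p (\<lambda>j. y j - x j) \<le> e" using y C by (simp add: field_simps)
    moreover have "C * nrm p (\<lambda>j. y j - x j) \<le> (C + 1) * nrm p (\<lambda>j. y j - x j)"
      by (intro mult_right_mono) auto
    ultimately have "(C * nrm p (\<lambda>j. y j - x j)) * nrm p (\<lambda>j. y j - x j) \<le> e * nrm p (\<lambda>j. y j - x j)"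
      by (intro mult_right_mono) auto
    then show "\<bar>\<phi> y - \<phi> x - ip p g (\<lambda>j. y j - x j)\<bar> \<le> e * nrm p (\<lambda>j. y j - x j)"
      using b[OF y(1)] by (simp add: nrm_sq[symmetric] power2_eq_square mult.assoc)
  qed
qed

subsection \<open>Stochastic gradients\<close>

text \<open>Measurability of \<open>grad\<close> in \<open>z\<close> is not available on the null set where \<open>\<Phi>\<close> is not smooth; for the
  limit of difference quotients it is.\<close>

definition pdiff :: "nat \<Rightarrow> ((nat \<Rightarrow> real) \<Rightarrow> 'z \<Rightarrow> real) \<Rightarrow> (nat \<Rightarrow> real) \<Rightarrow> 'z \<Rightarrow> nat \<Rightarrow> real" where
  "pdiff p \<Phi> x z = (\<lambda>j\<in>{..<p}. lim (\<lambda>m.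
     (\<Phi> (step_to p x (1 / real (Suc m)) (\<lambda>l. if l = j then 1 else 0)) z - \<Phi> x z) * real (Suc m)))"

locale smooth_objective = prob_space D for D :: "'z measure" +
  fixes p :: nat and \<Phi> :: "(nat \<Rightarrow> real) \<Rightarrow> 'z \<Rightarrow> real" and L :: real
  assumes p: "1 \<le> p" and L: "0 < L"
    and meas: "(\<lambda>(x, z). \<Phi> x z) \<in> borel_measurable (RV p \<Otimes>\<^sub>M D)"
    and int: "\<And>x. x \<in> Rp p \<Longrightarrow> integrable D (\<Phi> x)"
    and smooth: "AE z in D. smooth_fun p L (\<lambda>y. \<Phi> y z)"
begin

definition obj :: "(nat \<Rightarrow> real) \<Rightarrow> real" where
  "obj x = (\<integral>z. \<Phi> x z \<partial>D)"

definition mean_grad :: "(nat \<Rightarrow> real) \<Rightarrow> nat \<Rightarrow> real" where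
  "mean_grad x = (\<lambda>j\<in>{..<p}. \<integral>z. pdiff p \<Phi> x z j \<partial>D)"

lemma meas_section [measurable]: "x \<in> Rp p \<Longrightarrow> \<Phi> x \<in> borel_measurable D"
  using int by auto

lemma pdiff_measurable: "x \<in> Rp p \<Longrightarrow> j < p \<Longrightarrow> (\<lambda>z. pdiff p \<Phi> x z j) \<in> borel_measurable D"
  unfolding pdiff_def
  by (auto intro!: borel_measurable_lim_metric borel_measurable_times borel_measurable_diff meas_section)

text \<open>Along a coordinate direction the quadratic bound makes the error of the difference
  quotient with step 1 / (m + 1) at most L / (m + 1).\<close>

lemma pdiff_eq_grad:
  assumes sm: "smooth_fun p L (\<lambda>y. \<Phi> y z)" and x: "x \<in> Rp p"
  shows "pdiff p \<Phi> x z = grad p (\<lambda>y. \<Phi> y z) x"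
proof -
  let ?g = "grad p (\<lambda>y. \<Phi> y z) x"
  have g: "?g \<in> Rp p" using smooth_fun_has_grad[OF sm x] by (simp add: has_grad_def)
  have lim: "lim (\<lambda>m. (\<Phi> (step_to p x (1 / real (Suc m)) (\<lambda>l. if l = j then 1 else 0)) z - \<Phi> x z) * real (Suc m))
      = ?g j" if j: "j < p" for j
  proof (rule limI)
    define e :: "nat \<Rightarrow> real" where "e l = (if l = j then 1 else 0)" for l
    have ipe: "ip p y e = y j" for y
      using j by (simp add: ip_def e_def if_distrib sum.delta cong: if_cong)
    have bd: "\<bar>(\<Phi> (step_to p x (1 / real (Suc m)) e) z - \<Phi> x z) * real (Suc m) - ?g j\<bar>
        \<le> L * inverse (real (Suc m))" for m
    proof -
      let ?t = "1 / real (Suc m)"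
      let ?y = "step_to p x ?t e"
      have d: "ip p y (\<lambda>l. ?y l - x l) = ?t * y j" for y
      proof -
        have "ip p y (\<lambda>l. ?y l - x l) = ip p y (\<lambda>l. ?t * e l)" by (intro ip_cong) auto
        then show ?thesis by (simp only: ip_scale_right ipe)
      qed
      have dd: "ip p (\<lambda>l. ?y l - x l) (\<lambda>l. ?y l - x l) = ?t * ?t"
        unfolding d using j by (simp add: e_def)
      have "\<bar>\<Phi> ?y z - \<Phi> x z - ?t * ?g j\<bar> \<le> L * (?t * ?t)"
        using smooth_fun_quadratic_bound[OF sm less_imp_le[OF L] x step_to_Rp[of p x ?t e]]
        unfolding dd unfolding d .
      then have "\<bar>\<Phi> ?y z - \<Phi> x z - ?t * ?g j\<bar> * real (Suc m) \<le> L * (?t * ?t) * real (Suc m)"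
        by (intro mult_right_mono) auto
      moreover have "\<bar>\<Phi> ?y z - \<Phi> x z - ?t * ?g j\<bar> * real (Suc m)
          = \<bar>(\<Phi> ?y z - \<Phi> x z - ?t * ?g j) * real (Suc m)\<bar>"
        by (simp add: abs_mult)
      moreover have "(\<Phi> ?y z - \<Phi> x z - ?t * ?g j) * real (Suc m) = (\<Phi> ?y z - \<Phi> x z) * real (Suc m) - ?g j"
        by (simp add: left_diff_distrib del: of_nat_Suc)
      moreover have "L * (?t * ?t) * real (Suc m) = L * inverse (real (Suc m))"
        by (simp add: divide_inverse del: of_nat_Suc)
      ultimately show ?thesis by simp
    qed
    have "(\<lambda>m. L * inverse (real (Suc m))) \<longlonglongrightarrow> L * 0"
      by (intro tendsto_intros LIMSEQ_inverse_real_of_nat)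
    then have "(\<lambda>m. L * inverse (real (Suc m))) \<longlonglongrightarrow> 0" by simp
    then have "(\<lambda>m. (\<Phi> (step_to p x (1 / real (Suc m)) e) z - \<Phi> x z) * real (Suc m) - ?g j) \<longlonglongrightarrow> 0"
      by (rule Lim_null_comparison[rotated]) (use bd in \<open>simp del: of_nat_Suc\<close>)
    then show "(\<lambda>m. (\<Phi> (step_to p x (1 / real (Suc m)) (\<lambda>l. if l = j then 1 else 0)) z - \<Phi> x z) * real (Suc m))
        \<longlonglongrightarrow> ?g j"
      unfolding e_def[abs_def] by (rule LIM_zero_cancel)
  qed
  have "pdiff p \<Phi> x z \<in> Rp p" by (simp only: pdiff_def restrict_PiE_iff UNIV_I) simp
  from this g show ?thesis
    by (rule Rp_eqI) (simp only: pdiff_def restrict_apply' lessThan_iff lim)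
qed

lemma AE_pdiff: "AE z in D. \<forall>x\<in>Rp p. pdiff p \<Phi> x z = grad p (\<lambda>y. \<Phi> y z) x"
  using smooth by eventually_elim (auto intro: pdiff_eq_grad)

lemma AE_pdiff_quadratic: "AE z in D. \<forall>x\<in>Rp p. \<forall>y\<in>Rp p.
    \<bar>\<Phi> y z - \<Phi> x z - ip p (pdiff p \<Phi> x z) (\<lambda>j. y j - x j)\<bar> \<le> L * ip p (\<lambda>j. y j - x j) (\<lambda>j. y j - x j)"
  using smooth
proof eventually_elim
  case (elim z)
  then show ?case
    using smooth_fun_quadratic_bound[OF elim less_imp_le[OF L]] by (simp add: pdiff_eq_grad[OF elim])
qed

text \<open>With a step of length one the partial derivative differs from an integrable increment of
  \<Phi> by at most L.\<close>

lemma pdiff_integrable: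
  assumes x: "x \<in> Rp p" and j: "j < p"
  shows "integrable D (\<lambda>z. pdiff p \<Phi> x z j)"
proof -
  define e :: "nat \<Rightarrow> real" where "e l = (if l = j then 1 else 0)" for l
  let ?y = "step_to p x 1 e"
  have ipe: "ip p y e = y j" for y
    using j by (simp add: ip_def e_def if_distrib sum.delta cong: if_cong)
  have d: "ip p y (\<lambda>l. ?y l - x l) = y j" for y
    using ip_cong[of p y y "\<lambda>l. ?y l - x l" e] ipe[of y] by simp
  have dd: "ip p (\<lambda>l. ?y l - x l) (\<lambda>l. ?y l - x l) = 1"
    unfolding d using j by (simp add: e_def)
  show ?thesis
  proof (rule Bochner_Integration.integrable_bound)
    show "integrable D (\<lambda>z. \<bar>\<Phi> ?y z - \<Phi> x z\<bar> + L)"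
      using x by (intro Bochner_Integration.integrable_add integrable_abs Bochner_Integration.integrable_diff int) auto
    show "AE z in D. norm (pdiff p \<Phi> x z j) \<le> norm (\<bar>\<Phi> ?y z - \<Phi> x z\<bar> + L)"
      using AE_pdiff_quadratic
    proof eventually_elim
      case (elim z)
      have "\<bar>\<Phi> ?y z - \<Phi> x z - pdiff p \<Phi> x z j\<bar> \<le> L"
        using elim[rule_format, OF x step_to_Rp[of p x 1 e]] unfolding dd unfolding d by simp
      then show ?case using L by simp
    qed
  qed (rule pdiff_measurable[OF x j])
qed

lemma ip_pdiff_integrable: "x \<in> Rp p \<Longrightarrow> integrable D (\<lambda>z. ip p (pdiff p \<Phi> x z) w)"
  unfolding ip_def by (intro Bochner_Integration.integrable_sum integrable_mult_left pdiff_integrable) auto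

lemma ip_mean_grad: "x \<in> Rp p \<Longrightarrow> (\<integral>z. ip p (pdiff p \<Phi> x z) w \<partial>D) = ip p (mean_grad x) w"
  unfolding ip_def
  by (subst Bochner_Integration.integral_sum)
     (auto simp: mean_grad_def pdiff_integrable intro!: integrable_mult_left)

text \<open>The pointwise quadratic bound is integrated over z; it identifies
  \<open>mean_grad\<close> as the gradient of \<open>obj\<close>.\<close>

lemma obj_quadratic:
  assumes x: "x \<in> Rp p" and y: "y \<in> Rp p"
  shows "\<bar>obj y - obj x - ip p (mean_grad x) (\<lambda>j. y j - x j)\<bar> \<le> L * ip p (\<lambda>j. y j - x j) (\<lambda>j. y j - x j)"
proof -
  let ?d = "\<lambda>j. y j - x j"
  have i: "integrable D (\<lambda>z. \<Phi> y z - \<Phi> x z - ip p (pdiff p \<Phi> x z) ?d)"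
    using x y by (intro Bochner_Integration.integrable_diff int ip_pdiff_integrable) auto
  have "obj y - obj x - ip p (mean_grad x) ?d = (\<integral>z. \<Phi> y z - \<Phi> x z - ip p (pdiff p \<Phi> x z) ?d \<partial>D)"
    using x y by (simp add: obj_def int ip_pdiff_integrable ip_mean_grad)
  also have "\<bar>\<dots>\<bar> \<le> (\<integral>z. \<bar>\<Phi> y z - \<Phi> x z - ip p (pdiff p \<Phi> x z) ?d\<bar> \<partial>D)"
    by (rule integral_abs_bound)
  also have "\<dots> \<le> (\<integral>z. L * ip p ?d ?d \<partial>D)"
  proof (rule integral_mono_AE)
    show "AE z in D. \<bar>\<Phi> y z - \<Phi> x z - ip p (pdiff p \<Phi> x z) ?d\<bar> \<le> L * ip p ?d ?d"
      using AE_pdiff_quadratic by eventually_elim (use x y in auto)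
  qed (use i in auto)
  also have "\<dots> = L * ip p ?d ?d" by (simp add: prob_space)
  finally show ?thesis .
qed

lemma mean_grad_Rp [simp]: "mean_grad x \<in> Rp p"
  by (simp add: mean_grad_def)

lemma obj_has_grad: "x \<in> Rp p \<Longrightarrow> has_grad p obj (mean_grad x) x"
  using L by (intro has_gradI_quadratic[where C = L] obj_quadratic) auto

lemma grad_obj: "x \<in> Rp p \<Longrightarrow> grad p obj x = mean_grad x"
  by (rule grad_eqI[OF obj_has_grad])

text \<open>The difference of the mean gradients is tested against itself, which reduces the norm of
  a vector-valued integral to a scalar one.\<close>

lemma smooth_obj: "smooth_fun p L obj"
  unfolding smooth_fun_def
proof (intro conjI ballI)
  fix x assume x: "x \<in> Rp p"
  then show "\<exists>g. has_grad p obj g x" using obj_has_grad by blast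
  fix y assume y: "y \<in> Rp p"
  let ?d = "\<lambda>j. mean_grad x j - mean_grad y j"
  have "ip p ?d ?d = (\<integral>z. ip p (pdiff p \<Phi> x z) ?d - ip p (pdiff p \<Phi> y z) ?d \<partial>D)"
    using x y by (simp add: ip_pdiff_integrable ip_mean_grad ip_diff_left[of p "mean_grad x" "mean_grad y" ?d])
  also have "\<dots> \<le> (\<integral>z. L * nrm p (\<lambda>j. x j - y j) * nrm p ?d \<partial>D)"
  proof (rule integral_mono_AE)
    show "AE z in D. ip p (pdiff p \<Phi> x z) ?d - ip p (pdiff p \<Phi> y z) ?d \<le> L * nrm p (\<lambda>j. x j - y j) * nrm p ?d"
      using smooth
    proof eventually_elim
      case (elim z)
      have "ip p (pdiff p \<Phi> x z) ?d - ip p (pdiff p \<Phi> y z) ?d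
          = ip p (\<lambda>j. pdiff p \<Phi> x z j - pdiff p \<Phi> y z j) ?d"
        by (rule ip_diff_left[symmetric])
      also have "\<dots> \<le> nrm p (\<lambda>j. pdiff p \<Phi> x z j - pdiff p \<Phi> y z j) * nrm p ?d"
        using ip_le_nrm[of p "\<lambda>j. pdiff p \<Phi> x z j - pdiff p \<Phi> y z j" ?d] by linarith
      also have "\<dots> \<le> L * nrm p (\<lambda>j. x j - y j) * nrm p ?d"
        using smooth_fun_Lipschitz[OF elim x y] x y
        by (intro mult_right_mono) (auto simp: pdiff_eq_grad[OF elim])
      finally show ?case .
    qed
  qed (use x y in \<open>simp_all add: ip_pdiff_integrable\<close>)
  also have "\<dots> = L * nrm p (\<lambda>j. x j - y j) * nrm p ?d" by (simp add: prob_space)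
  finally have *: "nrm p ?d * nrm p ?d \<le> L * nrm p (\<lambda>j. x j - y j) * nrm p ?d"
    by (simp add: nrm_sq[symmetric] power2_eq_square)
  have "nrm p ?d \<le> L * nrm p (\<lambda>j. x j - y j)"
  proof (cases "nrm p ?d = 0")
    case False
    then have "0 < nrm p ?d" by (simp add: order_less_le)
    with * show ?thesis by (rule mult_right_le_imp_le)
  qed (use L in simp)
  then show "nrm p (\<lambda>j. grad p obj x j - grad p obj y j) \<le> L * nrm p (\<lambda>j. x j - y j)"
    using x y by (simp add: grad_obj)
qed

end

locale smooth_objective_variance = smooth_objective +
  fixes \<sigma>\<^sub>0 \<sigma>\<^sub>1 :: real
  assumes var: "\<And>x. x \<in> Rp p \<Longrightarrow>
    (\<integral>\<^sup>+ z. ennreal ((nrm p (\<lambda>j. grad p (\<lambda>y. \<Phi> y z) x j - grad p obj x j))\<^sup>2) \<partial>D)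
        \<le> ennreal (\<sigma>\<^sub>0\<^sup>2 * (nrm p (grad p obj x))\<^sup>2 + \<sigma>\<^sub>1\<^sup>2)"
begin

lemma ip_pdiff_measurable:
  "x \<in> Rp p \<Longrightarrow> (\<lambda>z. ip p (pdiff p \<Phi> x z) (pdiff p \<Phi> x z)) \<in> borel_measurable D"
  unfolding ip_def by (intro borel_measurable_sum borel_measurable_times pdiff_measurable) auto

text \<open>Splitting off the mean costs a factor 2. Stated with the nonnegative integral, the bound
  also proves finiteness.\<close>

lemma pdiff_second_moment:
  assumes x: "x \<in> Rp p"
  shows "(\<integral>\<^sup>+ z. ennreal (ip p (pdiff p \<Phi> x z) (pdiff p \<Phi> x z)) \<partial>D)
    \<le> ennreal (2 * ((1 + \<sigma>\<^sub>0\<^sup>2) * ip p (mean_grad x) (mean_grad x) + \<sigma>\<^sub>1\<^sup>2))"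
proof -
  let ?m = "mean_grad x"
  let ?d = "\<lambda>z j. pdiff p \<Phi> x z j - ?m j"
  have md[measurable]: "(\<lambda>z. ip p (?d z) (?d z)) \<in> borel_measurable D"
    unfolding ip_def using x by (intro borel_measurable_sum borel_measurable_times borel_measurable_diff pdiff_measurable) auto
  have "(\<integral>\<^sup>+ z. ennreal (ip p (?d z) (?d z)) \<partial>D)
      = (\<integral>\<^sup>+ z. ennreal ((nrm p (\<lambda>j. grad p (\<lambda>y. \<Phi> y z) x j - grad p obj x j))\<^sup>2) \<partial>D)"
    using AE_pdiff x by (intro nn_integral_cong_AE) (auto simp: nrm_sq grad_obj elim!: eventually_mono)
  also have "\<dots> \<le> ennreal (\<sigma>\<^sub>0\<^sup>2 * ip p ?m ?m + \<sigma>\<^sub>1\<^sup>2)"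
    using var[OF x] by (simp add: nrm_sq grad_obj x)
  finally have v: "(\<integral>\<^sup>+ z. ennreal (ip p (?d z) (?d z)) \<partial>D) \<le> ennreal (\<sigma>\<^sub>0\<^sup>2 * ip p ?m ?m + \<sigma>\<^sub>1\<^sup>2)" .
  have "(\<integral>\<^sup>+ z. ennreal (ip p (pdiff p \<Phi> x z) (pdiff p \<Phi> x z)) \<partial>D)
      \<le> (\<integral>\<^sup>+ z. 2 * ennreal (ip p (?d z) (?d z)) + ennreal (2 * ip p ?m ?m) \<partial>D)"
  proof (intro nn_integral_mono)
    fix z
    have "ip p (pdiff p \<Phi> x z) (pdiff p \<Phi> x z) \<le> 2 * ip p (?d z) (?d z) + 2 * ip p ?m ?m"
      using ip_sum_le[of p "?d z" ?m] by simp
    then have "ennreal (ip p (pdiff p \<Phi> x z) (pdiff p \<Phi> x z))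
        \<le> ennreal (2 * ip p (?d z) (?d z) + 2 * ip p ?m ?m)" by (rule ennreal_leI)
    then show "ennreal (ip p (pdiff p \<Phi> x z) (pdiff p \<Phi> x z))
        \<le> 2 * ennreal (ip p (?d z) (?d z)) + ennreal (2 * ip p ?m ?m)"
      by (simp add: ennreal_mult)
  qed
  also have "\<dots> = 2 * (\<integral>\<^sup>+ z. ennreal (ip p (?d z) (?d z)) \<partial>D) + ennreal (2 * ip p ?m ?m)"
    by (simp add: nn_integral_add nn_integral_cmult emeasure_space_1)
  also have "\<dots> \<le> 2 * ennreal (\<sigma>\<^sub>0\<^sup>2 * ip p ?m ?m + \<sigma>\<^sub>1\<^sup>2) + ennreal (2 * ip p ?m ?m)"
    by (intro add_right_mono mult_left_mono v) auto
  also have "\<dots> = ennreal (2 * (\<sigma>\<^sub>0\<^sup>2 * ip p ?m ?m + \<sigma>\<^sub>1\<^sup>2) + 2 * ip p ?m ?m)"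
    by (subst ennreal_plus) (auto simp: ennreal_mult')
  also have "2 * (\<sigma>\<^sub>0\<^sup>2 * ip p ?m ?m + \<sigma>\<^sub>1\<^sup>2) + 2 * ip p ?m ?m = 2 * ((1 + \<sigma>\<^sub>0\<^sup>2) * ip p ?m ?m + \<sigma>\<^sub>1\<^sup>2)"
    by (simp add: algebra_simps)
  finally show ?thesis .
qed

end

subsection \<open>The two-point gradient estimator\<close>

lemma step_to_measurable [measurable]:
  assumes [measurable]: "f \<in> N \<rightarrow>\<^sub>M RV p" "g \<in> N \<rightarrow>\<^sub>M RV p"
  shows "(\<lambda>\<omega>. step_to p (f \<omega>) t (g \<omega>)) \<in> N \<rightarrow>\<^sub>M RV p"
  unfolding step_to_def by measurable

lemma grad_est_eq: "grad_est p \<Phi> d x u z = (\<lambda>j\<in>{..<p}. real p * (\<Phi> (step_to p x d u) z - \<Phi> x z) / d * u j)"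
  by (simp add: grad_est_def step_to_def)

lemma ip_grad_est: "ip p (grad_est p \<Phi> d x u z) w = real p * ((\<Phi> (step_to p x d u) z - \<Phi> x z) / d) * ip p u w"
  by (simp add: grad_est_eq ip_def sum_distrib_left mult.assoc)

lemma ip_grad_est_self:
  "ip p (grad_est p \<Phi> d x u z) (grad_est p \<Phi> d x u z)
    = (real p)\<^sup>2 * ((\<Phi> (step_to p x d u) z - \<Phi> x z) / d)\<^sup>2 * ip p u u"
  unfolding ip_grad_est ip_commute[of p u "grad_est p \<Phi> d x u z"] ip_grad_est
  by (simp add: power2_eq_square)

lemma (in smooth_objective) Phi_measurable:
  assumes "f \<in> N \<rightarrow>\<^sub>M RV p" "h \<in> N \<rightarrow>\<^sub>M D"
  shows "(\<lambda>\<omega>. \<Phi> (f \<omega>) (h \<omega>)) \<in> borel_measurable N"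
  using measurable_compose[OF measurable_Pair[OF assms] meas] by simp

lemma (in smooth_objective) grad_est_measurable:
  assumes [measurable]: "f \<in> N \<rightarrow>\<^sub>M RV p" "g \<in> N \<rightarrow>\<^sub>M RV p" "h \<in> N \<rightarrow>\<^sub>M D"
  shows "(\<lambda>\<omega>. grad_est p \<Phi> d (f \<omega>) (g \<omega>) (h \<omega>)) \<in> N \<rightarrow>\<^sub>M RV p"
proof -
  have [measurable]: "(\<lambda>\<omega>. \<Phi> (step_to p (f \<omega>) d (g \<omega>)) (h \<omega>)) \<in> borel_measurable N"
    "(\<lambda>\<omega>. \<Phi> (f \<omega>) (h \<omega>)) \<in> borel_measurable N"
    by (intro Phi_measurable step_to_measurable assms)+
  show ?thesis unfolding grad_est_eq by measurable
qed

locale gradient_estimator = smooth_objective_variance +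
  fixes d :: real
  assumes d: "0 < d"
begin

sublocale sph: prob_space "unif_sphere p"
  by (rule prob_space_unif_sphere[OF p])

abbreviation "Q \<equiv> unif_sphere p \<Otimes>\<^sub>M D"

sublocale QP: pair_prob_space "unif_sphere p" D ..

lemma sets_S [simp, measurable_cong]: "sets (unif_sphere p) = sets (RV p)"
  by (rule sets_unif_sphere[OF p])

text \<open>Error of the difference quotient as a directional derivative; the estimator is p
  (\<open>rem\<close> + <g, u>) u with g the sampled gradient.\<close>

definition rem :: "(nat \<Rightarrow> real) \<Rightarrow> (nat \<Rightarrow> real) \<Rightarrow> 'a \<Rightarrow> real" where
  "rem x u z = (\<Phi> (step_to p x d u) z - \<Phi> x z) / d - ip p (pdiff p \<Phi> x z) u"

lemma rem_bound:
  assumes sm: "smooth_fun p L (\<lambda>y. \<Phi> y z)" and x: "x \<in> Rp p" and u: "ip p u u = 1"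
  shows "\<bar>rem x u z\<bar> \<le> L * d"
proof -
  let ?y = "step_to p x d u" and ?g = "pdiff p \<Phi> x z"
  have c: "ip p w (\<lambda>j. ?y j - x j) = d * ip p w u" for w
    using ip_cong[of p w w "\<lambda>j. ?y j - x j" "\<lambda>j. d * u j"] by (simp add: ip_scale_right)
  have cc: "ip p (\<lambda>j. ?y j - x j) (\<lambda>j. ?y j - x j) = d * d"
    unfolding c using c[of u] u by (simp add: ip_commute)
  have "\<bar>\<Phi> ?y z - \<Phi> x z - d * ip p ?g u\<bar> \<le> L * (d * d)"
    using smooth_fun_quadratic_bound[OF sm less_imp_le[OF L] x step_to_Rp[of p x d u]]
    unfolding cc unfolding c pdiff_eq_grad[OF sm x] .
  then have "\<bar>\<Phi> ?y z - \<Phi> x z - d * ip p ?g u\<bar> / d \<le> L * (d * d) / d"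
    using d by (intro divide_right_mono) auto
  moreover have "\<bar>\<Phi> ?y z - \<Phi> x z - d * ip p ?g u\<bar> / d = \<bar>rem x u z\<bar>"
    using d by (simp add: rem_def diff_divide_distrib abs_divide[symmetric] del: abs_divide)
       (simp add: abs_divide diff_divide_distrib[symmetric] field_simps)
  ultimately show ?thesis using d by simp
qed

text \<open>u and its reflection differ by 2 <u, e> e, so the evaluation points differ by 2 d <u, e>
  e. The mean value theorem between them leaves 2 <u, e> times a component of a gradient increment
  over a distance of at most d.\<close>

lemma rem_reflection:
  assumes sm: "smooth_fun p L (\<lambda>y. \<Phi> y z)" and x: "x \<in> Rp p" and u: "ip p u u = 1" and e: "ip p e e = 1"
  shows "\<bar>rem x u z - rem x (refl_at p e u) z\<bar> \<le> 2 * (L * d) * \<bar>ip p u e\<bar>"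
proof -
  let ?r = "refl_at p e u" and ?G = "grad p (\<lambda>y. \<Phi> y z)"
  let ?a = "step_to p x d ?r" and ?b = "step_to p x d u"
  let ?D = "\<lambda>j. ?b j - ?a j"
  have c: "ip p w ?D = 2 * d * ip p u e * ip p w e" for w
  proof -
    have "ip p w ?D = ip p w (\<lambda>j. (2 * d * ip p u e) * e j)"
      by (rule ip_cong) (auto simp: refl_at_def algebra_simps)
    then show ?thesis by (simp only: ip_scale_right)
  qed
  obtain t where t: "0 < t" "t < 1" "\<Phi> ?b z - \<Phi> ?a z = ip p (?G (step_to p ?a t ?D)) ?D"
    using smooth_fun_mvt[OF sm step_to_Rp[of p x d ?r] step_to_Rp[of p x d u]] by blast
  let ?y = "step_to p ?a t ?D"
  \<comment> \<open>The intermediate point stays in the ball of radius d about x by convexity: both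
    endpoints lie on its boundary.\<close>
  have "nrm p (\<lambda>j. ?y j - x j) \<le> d"
  proof -
    let ?v = "\<lambda>j. (1 - t) * ?r j + t * u j"
    have "nrm p (\<lambda>j. ?y j - x j) = nrm p (\<lambda>j. d * ?v j)"
      by (rule nrm_cong) (simp add: algebra_simps)
    also have "\<dots> = d * nrm p ?v" using d by (simp only: nrm_scale)
    also have "nrm p ?v \<le> 1"
    proof -
      have "nrm p ?v \<le> nrm p (\<lambda>j. (1 - t) * ?r j) + nrm p (\<lambda>j. t * u j)"
        unfolding nrm_def by (rule L2_set_triangle_ineq)
      also have "\<dots> = 1"
        unfolding nrm_scale using t u ip_refl_at(2)[OF e, of u] by (simp add: nrm_sqrt)
      finally show ?thesis .
    qed
    finally show ?thesis using d by (simp add: mult_left_le)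
  qed
  moreover have "nrm p (\<lambda>j. ?G ?y j - ?G x j) \<le> L * nrm p (\<lambda>j. ?y j - x j)"
    by (rule smooth_fun_Lipschitz[OF sm step_to_Rp x])
  ultimately have n: "nrm p (\<lambda>j. ?G ?y j - ?G x j) \<le> L * d"
    using L by (meson less_imp_le mult_left_mono order_trans)
  have g: "pdiff p \<Phi> x z = ?G x" by (rule pdiff_eq_grad[OF sm x])
  have ur: "ip p w u - ip p w ?r = 2 * ip p u e * ip p w e" for w
  proof -
    have "ip p w ?r = ip p w (\<lambda>i. u i - (2 * ip p u e) * e i)" by (intro ip_cong) (auto simp: refl_at_def)
    then show ?thesis by (simp only: ip_diff_right ip_scale_right)
  qed
  have "rem x u z - rem x ?r z = (\<Phi> ?b z - \<Phi> ?a z) / d - (ip p (?G x) u - ip p (?G x) ?r)"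
    by (simp add: rem_def g diff_divide_distrib)
  also have "\<dots> = 2 * ip p u e * ip p (?G ?y) e - 2 * ip p u e * ip p (?G x) e"
    unfolding t(3) c ur using d by simp
  also have "\<dots> = 2 * ip p u e * ip p (\<lambda>j. ?G ?y j - ?G x j) e"
    by (simp add: ip_diff_left right_diff_distrib)
  finally have "\<bar>rem x u z - rem x ?r z\<bar> = 2 * \<bar>ip p u e\<bar> * \<bar>ip p (\<lambda>j. ?G ?y j - ?G x j) e\<bar>"
    by (simp add: abs_mult)
  also have "\<dots> \<le> 2 * \<bar>ip p u e\<bar> * (L * d)"
  proof (intro mult_left_mono)
    have "nrm p e = 1" using e by (simp add: nrm_sqrt)
    then show "\<bar>ip p (\<lambda>j. ?G ?y j - ?G x j) e\<bar> \<le> L * d"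
      using ip_le_nrm[of p "\<lambda>j. ?G ?y j - ?G x j" e] n by simp
  qed auto
  finally show ?thesis by (simp add: ac_simps)
qed

lemma est_meas:
  assumes x: "x \<in> Rp p"
  shows "(\<lambda>(u, z). grad_est p \<Phi> d x u z) \<in> Q \<rightarrow>\<^sub>M RV p"
proof -
  have "(\<lambda>w. grad_est p \<Phi> d x (fst w) (snd w)) \<in> Q \<rightarrow>\<^sub>M RV p"
    using x by (intro grad_est_measurable measurable_const) (auto simp: space_RV intro!: measurable_fst'')
  then show ?thesis by (simp add: case_prod_beta')
qed

text \<open>The first term stems from the remainder of the difference quotient. The second stems
  from p^2 <g, u>^2, whose mean over the sphere is p |g|^2; the factor 4 comes from splitting the
  square and from \<open>pdiff_second_moment\<close>.\<close>

definition second_moment_bound :: "(nat \<Rightarrow> real) \<Rightarrow> real" where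
  "second_moment_bound x = 2 * (real p)\<^sup>2 * L\<^sup>2 * d\<^sup>2
     + 4 * real p * ((1 + \<sigma>\<^sub>0\<^sup>2) * ip p (mean_grad x) (mean_grad x) + \<sigma>\<^sub>1\<^sup>2)"

text \<open>For fixed z the sphere is integrated first: the second moment of u reduces p^2 to p in
  the gradient part, while the remainder is already of order d.\<close>

lemma est_second_moment:
  assumes x: "x \<in> Rp p"
  shows "(\<integral>\<^sup>+(u, z). ennreal (ip p (grad_est p \<Phi> d x u z) (grad_est p \<Phi> d x u z)) \<partial>Q)
    \<le> ennreal (second_moment_bound x)"
proof -
  let ?g = "pdiff p \<Phi> x"
  let ?c = "2 * (real p)\<^sup>2 * L\<^sup>2 * d\<^sup>2"
  have "(\<lambda>w. ip p (grad_est p \<Phi> d x (fst w) (snd w)) (grad_est p \<Phi> d x (fst w) (snd w))) \<in> borel_measurable Q"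
    using est_meas[OF x] by (intro ip_measurable) (simp_all add: case_prod_beta')
  then have "(\<integral>\<^sup>+(u, z). ennreal (ip p (grad_est p \<Phi> d x u z) (grad_est p \<Phi> d x u z)) \<partial>Q)
      = (\<integral>\<^sup>+z. (\<integral>\<^sup>+u. ennreal (ip p (grad_est p \<Phi> d x u z) (grad_est p \<Phi> d x u z)) \<partial>unif_sphere p) \<partial>D)"
    by (subst QP.nn_integral_snd[symmetric]) (auto simp: case_prod_beta')
  also have "\<dots> \<le> (\<integral>\<^sup>+z. ennreal ?c + ennreal (2 * real p) * ennreal (ip p (?g z) (?g z)) \<partial>D)"
  proof (rule nn_integral_mono_AE)
    show "AE z in D. (\<integral>\<^sup>+u. ennreal (ip p (grad_est p \<Phi> d x u z) (grad_est p \<Phi> d x u z)) \<partial>unif_sphere p)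
        \<le> ennreal ?c + ennreal (2 * real p) * ennreal (ip p (?g z) (?g z))"
      using smooth
    proof eventually_elim
      case (elim z)
      note sph = sphere_second_moment[OF p, of "?g z" "?g z"]
      have "(\<integral>\<^sup>+u. ennreal (ip p (grad_est p \<Phi> d x u z) (grad_est p \<Phi> d x u z)) \<partial>unif_sphere p)
          \<le> (\<integral>\<^sup>+u. ennreal (?c + 2 * (real p)\<^sup>2 * (ip p (?g z) u * ip p (?g z) u)) \<partial>unif_sphere p)"
      proof (rule nn_integral_mono_AE)
        show "AE u in unif_sphere p. ennreal (ip p (grad_est p \<Phi> d x u z) (grad_est p \<Phi> d x u z))
            \<le> ennreal (?c + 2 * (real p)\<^sup>2 * (ip p (?g z) u * ip p (?g z) u))"
          using AE_unif_sphere[OF p]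
        proof eventually_elim
          case (elim u)
          let ?r = "rem x u z" and ?s = "ip p (?g z) u"
          have "ip p (grad_est p \<Phi> d x u z) (grad_est p \<Phi> d x u z) = (real p)\<^sup>2 * (?r + ?s)\<^sup>2"
            unfolding ip_grad_est_self by (simp add: elim rem_def)
          also have "\<dots> \<le> (real p)\<^sup>2 * (2 * (L * d)\<^sup>2 + 2 * ?s\<^sup>2)"
          proof (intro mult_left_mono)
            have "?r\<^sup>2 \<le> (L * d)\<^sup>2"
              using power_mono[OF rem_bound[OF \<open>smooth_fun p L (\<lambda>y. \<Phi> y z)\<close> x elim], of 2] by simp
            moreover have "(?r + ?s)\<^sup>2 \<le> 2 * ?r\<^sup>2 + 2 * ?s\<^sup>2"
              using sum_squares_bound[of ?r ?s] by (simp add: power2_sum)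
            ultimately show "(?r + ?s)\<^sup>2 \<le> 2 * (L * d)\<^sup>2 + 2 * ?s\<^sup>2" by linarith
          qed auto
          finally show ?case
            by (intro ennreal_leI) (simp add: power2_eq_square algebra_simps)
        qed
      qed
      also have "\<dots> = ennreal (\<integral>u. ?c + 2 * (real p)\<^sup>2 * (ip p (?g z) u * ip p (?g z) u) \<partial>unif_sphere p)"
        using sph(1) by (intro nn_integral_eq_integral) auto
      also have "(\<integral>u. ?c + 2 * (real p)\<^sup>2 * (ip p (?g z) u * ip p (?g z) u) \<partial>unif_sphere p)
          = ?c + 2 * (real p)\<^sup>2 * (ip p (?g z) (?g z) / real p)"
        using sph by (simp add: sph.prob_space)
      also have "\<dots> = ?c + 2 * real p * ip p (?g z) (?g z)" using p by (simp add: power2_eq_square)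
      also have "ennreal \<dots> = ennreal ?c + ennreal (2 * real p) * ennreal (ip p (?g z) (?g z))"
        by (subst ennreal_plus) (auto simp: ennreal_mult)
      finally show ?case .
    qed
  qed
  also have "\<dots> = ennreal ?c + ennreal (2 * real p) * (\<integral>\<^sup>+z. ennreal (ip p (?g z) (?g z)) \<partial>D)"
    using ip_pdiff_measurable[OF x] by (simp add: nn_integral_add nn_integral_cmult emeasure_space_1)
  also have "\<dots> \<le> ennreal ?c + ennreal (2 * real p)
      * ennreal (2 * ((1 + \<sigma>\<^sub>0\<^sup>2) * ip p (mean_grad x) (mean_grad x) + \<sigma>\<^sub>1\<^sup>2))"
    by (intro add_left_mono mult_left_mono pdiff_second_moment x) auto
  also have "\<dots> = ennreal (second_moment_bound x)"
    unfolding second_moment_bound_def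
    by (subst ennreal_mult[symmetric], simp, simp, subst ennreal_plus[symmetric]) (auto simp: algebra_simps)
  finally show ?thesis .
qed

lemma est_comp_integrable:
  assumes x: "x \<in> Rp p"
  shows "integrable Q (\<lambda>(u, z). ip p (grad_est p \<Phi> d x u z) w)"
proof -
  let ?E = "\<lambda>a. grad_est p \<Phi> d x (fst a) (snd a)"
  have m[measurable]: "?E \<in> Q \<rightarrow>\<^sub>M RV p" using est_meas[OF x] by (simp add: case_prod_beta')
  have sq: "integrable Q (\<lambda>a. ip p (?E a) (?E a))"
  proof (rule integrableI_nonneg)
    show "(\<integral>\<^sup>+a. ennreal (ip p (?E a) (?E a)) \<partial>Q) < \<infinity>"
      using est_second_moment[OF x] by (simp add: case_prod_beta' le_less_trans[OF _ ennreal_less_top])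
  qed auto
  have "integrable Q (\<lambda>a. ip p (?E a) w)"
  proof (rule Bochner_Integration.integrable_bound)
    show "integrable Q (\<lambda>a. ip p (?E a) (?E a) + ip p w w)" using sq by auto
    show "AE a in Q. norm (ip p (?E a) w) \<le> norm (ip p (?E a) (?E a) + ip p w w)"
    proof (intro AE_I2)
      fix a
      show "norm (ip p (?E a) w) \<le> norm (ip p (?E a) (?E a) + ip p w w)"
        using ip_Young[of 1 p "?E a" w] ip_self_nonneg[of p "?E a"] ip_self_nonneg[of p w]
        by (simp del: ip_self_nonneg)
    qed
  qed measurable
  then show ?thesis by (simp add: case_prod_beta')
qed

definition est_mean :: "(nat \<Rightarrow> real) \<Rightarrow> nat \<Rightarrow> real" where
  "est_mean x = (\<lambda>j\<in>{..<p}. \<integral>(u, z). grad_est p \<Phi> d x u z j \<partial>Q)"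

lemma ip_est_mean:
  assumes x: "x \<in> Rp p"
  shows "(\<integral>(u, z). ip p (grad_est p \<Phi> d x u z) w \<partial>Q) = ip p (est_mean x) w"
proof -
  have comp: "integrable Q (\<lambda>a. grad_est p \<Phi> d x (fst a) (snd a) j)" if "j < p" for j
    using est_comp_integrable[OF x, of "\<lambda>i. if i = j then 1 else 0"] that
    by (simp add: ip_def if_distrib sum.delta case_prod_beta' cong: if_cong)
  show ?thesis
    unfolding ip_def case_prod_beta'
    by (subst Bochner_Integration.integral_sum)
       (auto simp: est_mean_def case_prod_beta' intro!: integrable_mult_left comp)
qed

text \<open>Over the sphere the linear part p <g, u> <u, e> has mean exactly <g, e>. The remainder
  goes through \<open>sphere_reflection_bound\<close> with K = L d and contributes at most p times L
  d / p, so no factor p survives.\<close>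

lemma est_bias_unit:
  assumes x: "x \<in> Rp p" and e: "ip p e e = 1"
  shows "\<bar>ip p (est_mean x) e - ip p (mean_grad x) e\<bar> \<le> L * d"
proof -
  have int: "integrable Q (\<lambda>(u, z). ip p (grad_est p \<Phi> d x u z) e)" by (rule est_comp_integrable[OF x])
  have inner_int: "integrable D (\<lambda>z. \<integral>u. ip p (grad_est p \<Phi> d x u z) e \<partial>unif_sphere p)"
    using QP.integrable_snd[OF int] by simp
  have "ip p (est_mean x) e = (\<integral>z. (\<integral>u. ip p (grad_est p \<Phi> d x u z) e \<partial>unif_sphere p) \<partial>D)"
    using QP.integral_snd[OF int] by (simp add: ip_est_mean[OF x, symmetric])
  then have eq: "ip p (est_mean x) e - ip p (mean_grad x) e
      = (\<integral>z. (\<integral>u. ip p (grad_est p \<Phi> d x u z) e \<partial>unif_sphere p) - ip p (pdiff p \<Phi> x z) e \<partial>D)"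
    by (simp only: Bochner_Integration.integral_diff[OF inner_int ip_pdiff_integrable[OF x]] ip_mean_grad[OF x])
  have "\<bar>ip p (est_mean x) e - ip p (mean_grad x) e\<bar>
      \<le> (\<integral>z. \<bar>(\<integral>u. ip p (grad_est p \<Phi> d x u z) e \<partial>unif_sphere p) - ip p (pdiff p \<Phi> x z) e\<bar> \<partial>D)"
    unfolding eq by (rule integral_abs_bound)
  also have "\<dots> \<le> (\<integral>z. L * d \<partial>D)"
  proof (rule integral_mono_AE)
    show "integrable D (\<lambda>z. \<bar>(\<integral>u. ip p (grad_est p \<Phi> d x u z) e \<partial>unif_sphere p) - ip p (pdiff p \<Phi> x z) e\<bar>)"
      by (intro integrable_abs Bochner_Integration.integrable_diff inner_int ip_pdiff_integrable[OF x])
    show "AE z in D. \<bar>(\<integral>u. ip p (grad_est p \<Phi> d x u z) e \<partial>unif_sphere p) - ip p (pdiff p \<Phi> x z) e\<bar> \<le> L * d"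
      using smooth AE_space
    proof eventually_elim
      case (elim z)
      let ?g = "pdiff p \<Phi> x z"
      have rm: "(\<lambda>u. rem x u z) \<in> borel_measurable (RV p)"
      proof -
        have "(\<lambda>u. \<Phi> (step_to p x d u) z) \<in> borel_measurable (RV p)"
          using elim x by (intro Phi_measurable step_to_measurable measurable_const) (auto simp: space_RV)
        then show ?thesis unfolding rem_def by measurable
      qed
      have ri: "integrable (unif_sphere p) (\<lambda>u. rem x u z * ip p u e)"
      proof (rule integrable_unif_sphere[OF p, where C = "L * d"])
        show "(\<lambda>u. rem x u z * ip p u e) \<in> borel_measurable (RV p)" using rm by measurable
        fix u assume u: "ip p u u = 1"
        have "\<bar>ip p u e\<bar> \<le> 1" using ip_Cauchy_Schwarz[of p u e] u e by (simp add: abs_square_le_1)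
        then show "\<bar>rem x u z * ip p u e\<bar> \<le> L * d"
          using rem_bound[OF elim(1) x u] mult_mono[of "\<bar>rem x u z\<bar>" "L * d" "\<bar>ip p u e\<bar>" 1] L d
          by (simp add: abs_mult)
      qed
      note sph = sphere_second_moment[OF p, of ?g e]
      have "ip p (grad_est p \<Phi> d x u z) e
          = real p * (rem x u z * ip p u e) + real p * (ip p ?g u * ip p e u)" for u
        unfolding ip_grad_est by (simp add: rem_def ip_commute[of p e u] algebra_simps)
      then have "(\<integral>u. ip p (grad_est p \<Phi> d x u z) e \<partial>unif_sphere p)
          = real p * (\<integral>u. rem x u z * ip p u e \<partial>unif_sphere p) + real p * (ip p ?g e / real p)"
        using ri sph by simp
      then have "\<bar>(\<integral>u. ip p (grad_est p \<Phi> d x u z) e \<partial>unif_sphere p) - ip p ?g e\<bar>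
          = real p * \<bar>\<integral>u. rem x u z * ip p u e \<partial>unif_sphere p\<bar>"
        using p by (simp add: abs_mult)
      also have "\<dots> \<le> real p * (L * d / real p)"
      proof (intro mult_left_mono sphere_reflection_bound[OF p e rm, where C = "L * d"])
        fix u assume u: "ip p u u = 1"
        show "\<bar>rem x u z\<bar> \<le> L * d" by (rule rem_bound[OF elim(1) x u])
        show "\<bar>rem x u z - rem x (refl_at p e u) z\<bar> \<le> 2 * (L * d) * \<bar>ip p u e\<bar>"
          by (rule rem_reflection[OF elim(1) x u e])
      qed auto
      finally show ?case using p by simp
    qed
  qed auto
  also have "\<dots> = L * d" by (simp add: prob_space)
  finally show ?thesis .
qed

text \<open>The bound for unit vectors is applied to the normalized bias vector itself.\<close>

lemma est_bias:
  assumes x: "x \<in> Rp p"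
  shows "ip p (\<lambda>j. est_mean x j - mean_grad x j) (\<lambda>j. est_mean x j - mean_grad x j) \<le> L\<^sup>2 * d\<^sup>2"
proof (cases "ip p (\<lambda>j. est_mean x j - mean_grad x j) (\<lambda>j. est_mean x j - mean_grad x j) = 0")
  case False
  let ?D = "\<lambda>j. est_mean x j - mean_grad x j"
  let ?n = "nrm p ?D"
  have sq: "ip p ?D ?D = ?n * ?n" by (simp add: nrm_sq[symmetric] power2_eq_square)
  then have n: "?n > 0" using False nrm_nonneg[of p ?D] by (auto simp: order_less_le)
  let ?e = "\<lambda>j. (1 / ?n) * ?D j"
  have "ip p ?e ?e = (1 / ?n) * ((1 / ?n) * ip p ?D ?D)" by (simp only: ip_scale_left ip_scale_right)
  then have "ip p ?e ?e = 1" using n unfolding sq by simp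
  from est_bias_unit[OF x this] have "\<bar>ip p ?D ?e\<bar> \<le> L * d" by (simp only: ip_diff_left)
  then have "\<bar>(1 / ?n) * ip p ?D ?D\<bar> \<le> L * d" by (simp only: ip_scale_right)
  then have "?n \<le> L * d" using n unfolding sq by simp
  then have "?n * ?n \<le> (L * d) * (L * d)" using n by (intro mult_mono) auto
  then show ?thesis unfolding sq by (simp add: power2_eq_square ac_simps)
qed simp

end

subsection \<open>Independence of the samples\<close>

text \<open>Disjoint groups of independent intersection-stable families generate independent
  \<sigma>-algebras; the two groups are indexed by a boolean.\<close>

lemma (in prob_space) indep_sets_two_groups:
  assumes ind: "indep_sets E I" and st: "\<And>i. i \<in> I \<Longrightarrow> Int_stable (E i)"
    and I12: "I1 \<subseteq> I" "I2 \<subseteq> I" "I1 \<inter> I2 = {}"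
    and A: "A \<in> sigma_sets (space M) (\<Union>i\<in>I1. E i)" and B: "B \<in> sigma_sets (space M) (\<Union>i\<in>I2. E i)"
  shows "prob (A \<inter> B) = prob A * prob B"
proof -
  define J where "J b = (if b then I1 else I2)" for b
  have "indep_sets (\<lambda>b. sigma_sets (space M) (\<Union>i\<in>J b. E i)) (UNIV :: bool set)"
  proof (rule indep_sets_collect_sigma)
    show "indep_sets E (\<Union>b\<in>UNIV. J b)"
      using I12 by (intro indep_sets_mono_index[OF _ ind]) (auto simp: J_def split: if_splits)
    show "Int_stable (E i)" if "i \<in> J b" for i b
      using that I12 by (intro st) (auto simp: J_def split: if_splits)
    show "disjoint_family_on J UNIV"
      using I12 by (auto simp: disjoint_family_on_def J_def)
  qed
  from indep_setsD[OF this, of UNIV "\<lambda>b. if b then A else B"]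
  have "prob (\<Inter>b\<in>UNIV. if b then A else B) = (\<Prod>b\<in>UNIV. prob (if b then A else B))"
    using A B by (auto simp: J_def)
  moreover have "(\<Inter>b\<in>UNIV. if b then A else B) = A \<inter> B" by (auto simp: UNIV_bool)
  ultimately show ?thesis by (simp add: UNIV_bool mult.commute)
qed

locale samples = prob_space M for M :: "'w measure" +
  fixes n p :: nat and D :: "nat \<Rightarrow> 'z measure"
    and u :: "nat \<Rightarrow> nat \<Rightarrow> 'w \<Rightarrow> nat \<Rightarrow> real" and \<xi> :: "nat \<Rightarrow> nat \<Rightarrow> 'w \<Rightarrow> 'z"
  assumes p1: "1 \<le> p" and D: "\<And>i. i < n \<Longrightarrow> prob_space (D i)" and samp: "sampling n p D M u \<xi>"
begin

definition gens :: "nat \<times> nat + nat \<times> nat \<Rightarrow> 'w set set" where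
  "gens = case_sum (\<lambda>(i, k). {u i k -` A \<inter> space M |A. A \<in> sets (RV p)})
                 (\<lambda>(i, k). {\<xi> i k -` A \<inter> space M |A. A \<in> sets (D i)})"

definition idx :: "(nat \<times> nat + nat \<times> nat) set" where
  "idx = ({..<n} \<times> UNIV) <+> ({..<n} \<times> UNIV)"

lemma indep: "indep_sets gens idx"
  using samp by (simp add: sampling_def gens_def idx_def)

lemma u_meas: "i < n \<Longrightarrow> u i k \<in> M \<rightarrow>\<^sub>M RV p"
  and \<xi>_meas: "i < n \<Longrightarrow> \<xi> i k \<in> M \<rightarrow>\<^sub>M D i"
  and distr_u: "i < n \<Longrightarrow> distr M (RV p) (u i k) = unif_sphere p"
  and distr_\<xi>: "i < n \<Longrightarrow> distr M (D i) (\<xi> i k) = D i"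
  using samp by (auto simp: sampling_def)

lemma Int_stable_vimage_sets: "Int_stable {f -` A \<inter> space M |A. A \<in> sets N}"
proof (rule Int_stableI)
  fix a b assume "a \<in> {f -` A \<inter> space M |A. A \<in> sets N}" "b \<in> {f -` A \<inter> space M |A. A \<in> sets N}"
  then obtain A B where "a = f -` A \<inter> space M" "b = f -` B \<inter> space M" "A \<in> sets N" "B \<in> sets N" by auto
  then have "a \<inter> b = f -` (A \<inter> B) \<inter> space M" "A \<inter> B \<in> sets N" by auto
  then show "a \<inter> b \<in> {f -` A \<inter> space M |A. A \<in> sets N}" by blast
qed

lemma Int_stable_gens: "Int_stable (gens s)"
  by (cases s) (auto simp: gens_def Int_stable_vimage_sets split: prod.splits)

lemma gens_sets: "s \<in> idx \<Longrightarrow> gens s \<subseteq> sets M"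
  using u_meas \<xi>_meas by (auto simp: gens_def idx_def measurable_sets)

text \<open>Only independence from the samples of agent \<open>i\<close> at time \<open>k\<close> is needed, not a filtration, so the
  samples of later times may be included.\<close>

definition others :: "nat \<Rightarrow> nat \<Rightarrow> 'w measure" where
  "others i k = sigma (space M) (\<Union>s\<in>idx - {Inl (i, k), Inr (i, k)}. gens s)"

lemma gens_Pow: "(\<Union>s\<in>I. gens s) \<subseteq> Pow (space M)"
  by (auto simp: gens_def split: sum.splits prod.splits)

lemma space_others [simp]: "space (others i k) = space M"
  by (simp add: others_def space_measure_of_conv)

lemma sets_others: "sets (others i k) = sigma_sets (space M) (\<Union>s\<in>idx - {Inl (i, k), Inr (i, k)}. gens s)"
  unfolding others_def by (rule sets_measure_of) (rule gens_Pow)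

lemma subalgebra_others: "subalgebra M (others i k)"
  unfolding subalgebra_def
proof
  show "sets (others i k) \<subseteq> sets M"
    unfolding sets_others using gens_sets by (intro sets.sigma_sets_subset) auto
qed simp

lemma others_measurable:
  assumes "j < n" "(j, l) \<noteq> (i, k)"
  shows "u j l \<in> others i k \<rightarrow>\<^sub>M RV p" "\<xi> j l \<in> others i k \<rightarrow>\<^sub>M D j"
proof -
  have "u j l -` A \<inter> space M \<in> sets (others i k)" if "A \<in> sets (RV p)" for A
    unfolding sets_others
    by (rule sigma_sets.Basic, rule UN_I[of "Inl (j, l)"]) (use that assms in \<open>auto simp: gens_def idx_def\<close>)
  then show "u j l \<in> others i k \<rightarrow>\<^sub>M RV p"
    using measurable_space[OF u_meas[OF assms(1)], of _ l] by (intro measurableI) auto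
  have "\<xi> j l -` A \<inter> space M \<in> sets (others i k)" if "A \<in> sets (D j)" for A
    unfolding sets_others
    by (rule sigma_sets.Basic, rule UN_I[of "Inr (j, l)"]) (use that assms in \<open>auto simp: gens_def idx_def\<close>)
  then show "\<xi> j l \<in> others i k \<rightarrow>\<^sub>M D j"
    using measurable_space[OF \<xi>_meas[OF assms(1)], of _ l] by (intro measurableI) auto
qed

text \<open>M restricted to \<open>others\<close>, so that a product with the law of the fresh
  sample can be formed.\<close>

definition past :: "nat \<Rightarrow> nat \<Rightarrow> 'w measure" where
  "past i k = restr_to_subalg M (others i k)"

lemma sets_past [measurable_cong]: "sets (past i k) = sets (others i k)"
  unfolding past_def by (rule sets_restr_to_subalg[OF subalgebra_others])

lemma space_past: "space (past i k) = space M"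
  by (simp add: past_def space_restr_to_subalg)

lemma prob_space_past: "prob_space (past i k)"
proof
  show "emeasure (past i k) (space (past i k)) = 1"
    unfolding space_past unfolding past_def
    using sets.top[of "others i k"] by (simp add: emeasure_restr_to_subalg[OF subalgebra_others] emeasure_space_1)
qed

abbreviation sample_law :: "nat \<Rightarrow> ((nat \<Rightarrow> real) \<times> 'z) measure" where
  "sample_law i \<equiv> unif_sphere p \<Otimes>\<^sub>M D i"

lemma prob_space_sample_law: "i < n \<Longrightarrow> prob_space (sample_law i)"
proof -
  assume i: "i < n"
  interpret a: prob_space "unif_sphere p" by (rule prob_space_unif_sphere[OF p1])
  interpret b: prob_space "D i" by (rule D[OF i])
  interpret pair_prob_space "unif_sphere p" "D i" ..
  show ?thesis by (rule prob_space_axioms)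
qed

lemma sets_sample_law: "sets (sample_law i) = sets (RV p \<Otimes>\<^sub>M D i)"
  by (rule sets_pair_measure_cong) (auto simp: sets_unif_sphere[OF p1])

lemma sample_measurable:
  assumes "i < n"
  shows "(\<lambda>\<omega>. (u i k \<omega>, \<xi> i k \<omega>)) \<in> M \<rightarrow>\<^sub>M sample_law i"
  using u_meas[OF assms] \<xi>_meas[OF assms]
  by (simp add: measurable_cong_sets[OF refl sets_sample_law] measurable_Pair)

text \<open>Direction and data of one agent at one time are themselves independent, so their joint
  law is the product of the prescribed ones.\<close>

lemma distr_sample:
  assumes i: "i < n"
  shows "distr M (sample_law i) (\<lambda>\<omega>. (u i k \<omega>, \<xi> i k \<omega>)) = sample_law i"
proof (rule pair_measure_eqI[symmetric])
  interpret a: prob_space "unif_sphere p" by (rule prob_space_unif_sphere[OF p1])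
  interpret b: prob_space "D i" by (rule D[OF i])
  show "sigma_finite_measure (unif_sphere p)" "sigma_finite_measure (D i)" by unfold_locales
  fix A B assume AB: "A \<in> sets (unif_sphere p)" "B \<in> sets (D i)"
  then have A: "A \<in> sets (RV p)" by (simp add: sets_unif_sphere[OF p1])
  have gA: "u i k -` A \<inter> space M \<in> sigma_sets (space M) (\<Union>s\<in>{Inl (i, k)}. gens s)"
    using A by (intro sigma_sets.Basic) (auto simp: gens_def)
  have gB: "\<xi> i k -` B \<inter> space M \<in> sigma_sets (space M) (\<Union>s\<in>{Inr (i, k)}. gens s)"
    using AB by (intro sigma_sets.Basic) (auto simp: gens_def)
  have "prob ((u i k -` A \<inter> space M) \<inter> (\<xi> i k -` B \<inter> space M))
      = prob (u i k -` A \<inter> space M) * prob (\<xi> i k -` B \<inter> space M)"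
    by (rule indep_sets_two_groups[OF indep Int_stable_gens _ _ _ gA gB]) (use i in \<open>auto simp: idx_def\<close>)
  moreover have "(u i k -` A \<inter> space M) \<inter> (\<xi> i k -` B \<inter> space M)
      = (\<lambda>\<omega>. (u i k \<omega>, \<xi> i k \<omega>)) -` (A \<times> B) \<inter> space M" by auto
  ultimately have "emeasure M ((\<lambda>\<omega>. (u i k \<omega>, \<xi> i k \<omega>)) -` (A \<times> B) \<inter> space M)
      = emeasure M (u i k -` A \<inter> space M) * emeasure M (\<xi> i k -` B \<inter> space M)"
    by (simp add: emeasure_eq_measure ennreal_mult[symmetric])
  moreover have "emeasure M (u i k -` A \<inter> space M) = emeasure (unif_sphere p) A"
    unfolding distr_u[OF i, symmetric, of k] using A u_meas[OF i] by (simp add: emeasure_distr)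
  moreover have "emeasure M (\<xi> i k -` B \<inter> space M) = emeasure (D i) B"
  proof -
    have "emeasure (D i) B = emeasure (distr M (D i) (\<xi> i k)) B" by (simp only: distr_\<xi>[OF i])
    then show ?thesis using AB \<xi>_meas[OF i] by (simp add: emeasure_distr)
  qed
  ultimately show "emeasure (unif_sphere p) A * emeasure (D i) B
      = emeasure (distr M (sample_law i) (\<lambda>\<omega>. (u i k \<omega>, \<xi> i k \<omega>))) (A \<times> B)"
    using AB sample_measurable[OF i] by (simp add: emeasure_distr)
qed simp

lemma sample_indep:
  assumes i: "i < n" and A: "A \<in> sets (others i k)" and B: "B \<in> sets (sample_law i)"
  shows "emeasure M (A \<inter> ((\<lambda>\<omega>. (u i k \<omega>, \<xi> i k \<omega>)) -` B \<inter> space M))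
    = emeasure M A * emeasure (sample_law i) B"
proof -
  let ?h = "\<lambda>\<omega>. (u i k \<omega>, \<xi> i k \<omega>)"
  let ?I = "{Inl (i, k), Inr (i, k)}"
  define H where "H = sigma (space M) (\<Union>s\<in>?I. gens s)"
  have sH: "sets H = sigma_sets (space M) (\<Union>s\<in>?I. gens s)"
    unfolding H_def by (rule sets_measure_of) (rule gens_Pow)
  have spH: "space H = space M" by (simp add: H_def space_measure_of_conv)
  have "u i k \<in> H \<rightarrow>\<^sub>M RV p"
    using measurable_space[OF u_meas[OF i], of _ k]
    by (intro measurableI) (auto simp: sH spH gens_def intro!: sigma_sets.Basic)
  moreover have "\<xi> i k \<in> H \<rightarrow>\<^sub>M D i"
    using measurable_space[OF \<xi>_meas[OF i], of _ k]
    by (intro measurableI) (auto simp: sH spH gens_def intro!: sigma_sets.Basic)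
  ultimately have "?h \<in> H \<rightarrow>\<^sub>M sample_law i"
    by (simp add: measurable_cong_sets[OF refl sets_sample_law] measurable_Pair)
  then have "?h -` B \<inter> space H \<in> sets H" using B by (rule measurable_sets)
  then have gB: "?h -` B \<inter> space M \<in> sigma_sets (space M) (\<Union>s\<in>?I. gens s)" by (simp add: sH spH)
  have "prob (A \<inter> (?h -` B \<inter> space M)) = prob A * prob (?h -` B \<inter> space M)"
    by (rule indep_sets_two_groups[OF indep Int_stable_gens _ _ _ A[unfolded sets_others] gB])
       (use i in \<open>auto simp: idx_def\<close>)
  then have "emeasure M (A \<inter> (?h -` B \<inter> space M)) = emeasure M A * emeasure M (?h -` B \<inter> space M)"
    by (simp add: emeasure_eq_measure ennreal_mult[symmetric])
  also have "emeasure M (?h -` B \<inter> space M) = emeasure (distr M (sample_law i) ?h) B"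
    using B sample_measurable[OF i] by (simp add: emeasure_distr)
  finally show ?thesis by (simp only: distr_sample[OF i])
qed

lemma joint_measurable:
  assumes i: "i < n"
  shows "(\<lambda>\<omega>. (\<omega>, (u i k \<omega>, \<xi> i k \<omega>))) \<in> M \<rightarrow>\<^sub>M past i k \<Otimes>\<^sub>M sample_law i"
proof (rule measurable_Pair)
  show "(\<lambda>\<omega>. \<omega>) \<in> M \<rightarrow>\<^sub>M past i k"
    using subalgebra_others[of i k] measurable_ident_sets[of M M]
    by (intro measurableI) (auto simp: space_past sets_past subalgebra_def)
qed (rule sample_measurable[OF i])

text \<open>The outcome, seen only through the remaining samples, is independent of the fresh
  sample; on rectangles this is \<open>sample_indep\<close>.\<close>

lemma distr_joint:
  assumes i: "i < n"
  shows "distr M (past i k \<Otimes>\<^sub>M sample_law i) (\<lambda>\<omega>. (\<omega>, (u i k \<omega>, \<xi> i k \<omega>))) = past i k \<Otimes>\<^sub>M sample_law i"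
proof (rule pair_measure_eqI[symmetric])
  interpret a: prob_space "past i k" by (rule prob_space_past)
  interpret b: prob_space "sample_law i" by (rule prob_space_sample_law[OF i])
  show "sigma_finite_measure (past i k)" "sigma_finite_measure (sample_law i)" by unfold_locales
  fix A B assume AB: "A \<in> sets (past i k)" "B \<in> sets (sample_law i)"
  then have A: "A \<in> sets (others i k)" by (simp add: sets_past)
  then have "A \<subseteq> space M" using sets.sets_into_space by fastforce
  then have "(\<lambda>\<omega>. (\<omega>, (u i k \<omega>, \<xi> i k \<omega>))) -` (A \<times> B) \<inter> space M
      = A \<inter> ((\<lambda>\<omega>. (u i k \<omega>, \<xi> i k \<omega>)) -` B \<inter> space M)" by auto
  then show "emeasure (past i k) A * emeasure (sample_law i) B
      = emeasure (distr M (past i k \<Otimes>\<^sub>M sample_law i) (\<lambda>\<omega>. (\<omega>, (u i k \<omega>, \<xi> i k \<omega>)))) (A \<times> B)"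
    using AB sample_indep[OF i A AB(2)] joint_measurable[OF i]
    by (simp add: emeasure_distr past_def emeasure_restr_to_subalg[OF subalgebra_others A])
qed simp

text \<open>Takes the role of conditional expectation: everything measurable in
  \<open>others\<close> is frozen while the fresh sample is integrated against its law.\<close>

lemma nn_integral_sample:
  assumes i: "i < n" and \<phi>: "\<phi> \<in> borel_measurable (others i k \<Otimes>\<^sub>M (RV p \<Otimes>\<^sub>M D i))"
  shows "(\<integral>\<^sup>+\<omega>. \<phi> (\<omega>, (u i k \<omega>, \<xi> i k \<omega>)) \<partial>M) = (\<integral>\<^sup>+\<omega>. (\<integral>\<^sup>+q. \<phi> (\<omega>, q) \<partial>sample_law i) \<partial>M)"
proof -
  interpret b: prob_space "sample_law i" by (rule prob_space_sample_law[OF i])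
  have eq: "sets (past i k \<Otimes>\<^sub>M sample_law i) = sets (others i k \<Otimes>\<^sub>M (RV p \<Otimes>\<^sub>M D i))"
    by (rule sets_pair_measure_cong[OF sets_past sets_sample_law])
  have m: "\<phi> \<in> borel_measurable (past i k \<Otimes>\<^sub>M sample_law i)"
    unfolding measurable_cong_sets[OF eq refl] by (rule \<phi>)
  have "(\<integral>\<^sup>+\<omega>. \<phi> (\<omega>, (u i k \<omega>, \<xi> i k \<omega>)) \<partial>M)
      = (\<integral>\<^sup>+a. \<phi> a \<partial>distr M (past i k \<Otimes>\<^sub>M sample_law i) (\<lambda>\<omega>. (\<omega>, (u i k \<omega>, \<xi> i k \<omega>))))"
    by (rule nn_integral_distr[OF joint_measurable[OF i], symmetric]) (use m in simp)
  also have "\<dots> = (\<integral>\<^sup>+\<omega>. (\<integral>\<^sup>+q. \<phi> (\<omega>, q) \<partial>sample_law i) \<partial>past i k)"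
    unfolding distr_joint[OF i] by (rule b.nn_integral_fst[OF m, symmetric])
  also have "\<dots> = (\<integral>\<^sup>+\<omega>. (\<integral>\<^sup>+q. \<phi> (\<omega>, q) \<partial>sample_law i) \<partial>M)"
    unfolding past_def
  proof (rule nn_integral_subalgebra2[OF subalgebra_others])
    show "(\<lambda>\<omega>. \<integral>\<^sup>+q. \<phi> (\<omega>, q) \<partial>sample_law i) \<in> borel_measurable (others i k)"
      using b.borel_measurable_nn_integral_fst[OF m] by (simp add: measurable_cong_sets[OF sets_past refl])
  qed
  finally show ?thesis .
qed

lemma integral_sample:
  fixes \<phi> :: "_ \<Rightarrow> real"
  assumes i: "i < n" and \<phi>: "\<phi> \<in> borel_measurable (others i k \<Otimes>\<^sub>M (RV p \<Otimes>\<^sub>M D i))"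
    and int: "integrable M (\<lambda>\<omega>. \<phi> (\<omega>, (u i k \<omega>, \<xi> i k \<omega>)))"
  shows "(\<integral>\<omega>. \<phi> (\<omega>, (u i k \<omega>, \<xi> i k \<omega>)) \<partial>M) = (\<integral>\<omega>. (\<integral>q. \<phi> (\<omega>, q) \<partial>sample_law i) \<partial>M)"
proof -
  interpret a: prob_space "past i k" by (rule prob_space_past)
  interpret b: prob_space "sample_law i" by (rule prob_space_sample_law[OF i])
  interpret ab: pair_prob_space "past i k" "sample_law i" ..
  have eq: "sets (past i k \<Otimes>\<^sub>M sample_law i) = sets (others i k \<Otimes>\<^sub>M (RV p \<Otimes>\<^sub>M D i))"
    by (rule sets_pair_measure_cong[OF sets_past sets_sample_law])
  have m: "\<phi> \<in> borel_measurable (past i k \<Otimes>\<^sub>M sample_law i)"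
    unfolding measurable_cong_sets[OF eq refl] by (rule \<phi>)
  have "integrable (distr M (past i k \<Otimes>\<^sub>M sample_law i) (\<lambda>\<omega>. (\<omega>, (u i k \<omega>, \<xi> i k \<omega>)))) \<phi>"
    using int by (subst integrable_distr_eq[OF joint_measurable[OF i]]) (use m in auto)
  then have int': "integrable (past i k \<Otimes>\<^sub>M sample_law i) \<phi>" by (simp only: distr_joint[OF i])
  have "(\<integral>\<omega>. \<phi> (\<omega>, (u i k \<omega>, \<xi> i k \<omega>)) \<partial>M)
      = (\<integral>a. \<phi> a \<partial>distr M (past i k \<Otimes>\<^sub>M sample_law i) (\<lambda>\<omega>. (\<omega>, (u i k \<omega>, \<xi> i k \<omega>))))"
    by (rule integral_distr[OF joint_measurable[OF i], symmetric]) (use m in simp)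
  also have "\<dots> = (\<integral>\<omega>. (\<integral>q. \<phi> (\<omega>, q) \<partial>sample_law i) \<partial>past i k)"
    unfolding distr_joint[OF i] by (rule ab.integral_fst'[OF int', symmetric])
  also have "\<dots> = (\<integral>\<omega>. (\<integral>q. \<phi> (\<omega>, q) \<partial>sample_law i) \<partial>M)"
    unfolding past_def
  proof (rule integral_subalgebra2[OF subalgebra_others])
    have "(\<lambda>\<omega>. \<integral>q. \<phi> (\<omega>, q) \<partial>sample_law i) \<in> borel_measurable (past i k)"
      by (rule b.borel_measurable_lebesgue_integral) (use m in \<open>simp add: case_prod_beta'\<close>)
    then show "(\<lambda>\<omega>. \<integral>q. \<phi> (\<omega>, q) \<partial>sample_law i) \<in> borel_measurable (others i k)"
      by (simp add: measurable_cong_sets[OF sets_past refl])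
  qed
  finally show ?thesis .
qed

end

subsection \<open>Rates from the coupled recursion\<close>

text \<open>The coefficient of 1/T is q itself, which may vary below Q, whereas C2 and C3 are fixed
  beforehand. Up to an index k0 only geometric growth is used. Afterwards three bounds are carried
  jointly: bounded A makes U of order 1/s^2, this makes the coupling a2 U / s of order 1/s^3, and
  this gives the rate of A. The threshold ensures that the constant of U, which depends on the bound
  of A, does not destroy that bound.\<close>

lemma coupled_recursion_rates:
  fixes a1 a2 a3 b0 b1 b2 c t A0 U0 Q :: real
  assumes nonneg: "0 \<le> a1" "0 \<le> a2" "0 \<le> a3" "0 \<le> b0" "0 \<le> b1" "0 \<le> b2" "0 \<le> Q" "0 \<le> A0" "0 \<le> U0"
    and c: "0 < c" "c < 1" and t: "0 < t"
  shows "\<exists>C2\<ge>0. \<exists>C3\<ge>0. \<forall>A U q.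
    A 0 = A0 \<and> U 0 = U0 \<and> 0 \<le> q \<and> q \<le> Q \<and> (\<forall>k. 0 \<le> A k) \<and> (\<forall>k. 0 \<le> U k) \<and>
    (\<forall>k. A (Suc k) \<le> (1 - 16/3 / (real k + t) + a1 / (real k + t)\<^sup>2) * A k
        + a2 / (real k + t) * U k + q / (real k + t)\<^sup>2 + a3 / (real k + t)^3) \<and>
    (\<forall>k. U (Suc k) \<le> (1 - c) * U k + (b0 + b1 * A k + b2 * U k) / (real k + t)\<^sup>2) \<longrightarrow>
    (\<forall>T\<ge>1. A T \<le> q / real T + C2 / (real T)\<^sup>2 \<and> U T \<le> C3 / (real T)\<^sup>2)"
proof -
  \<comment> \<open>Growth of 1 + A + U in one step, with s replaced by its least value t; the
    summand 1 absorbs the inhomogeneous terms.\<close>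
  define B where "B = 1 + a1 / t\<^sup>2 + a2 / t + Q / t\<^sup>2 + a3 / t^3 + 1 + (b0 + b1 + b2) / t\<^sup>2"
  have B: "1 \<le> B" using nonneg t by (simp add: B_def)
  \<comment> \<open>The entry 6 keeps the factor of A nonnegative, 3 a1 reduces 16/3 to 5, the next
    two serve the step of U, and the last three keep A below \<open>X\<close>.\<close>
  define S where "S = Max {6, 3 * a1, 6 / c, 8 * b2 / c, 4 * a2 * (b0 + b1) / c, Q, a3}"
  have S: "6 \<le> S" "3 * a1 \<le> S" "6 / c \<le> S" "8 * b2 / c \<le> S" "4 * a2 * (b0 + b1) / c \<le> S" "Q \<le> S" "a3 \<le> S"
    unfolding S_def by (rule Max_ge; simp)+
  define k0 where "k0 = nat \<lceil>S\<rceil>"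
  have k0: "S \<le> real k0" using S(1) by (simp add: k0_def)
  define G where "G = B ^ k0 * (1 + A0 + U0)"
  have G: "0 \<le> G" using B nonneg by (simp add: G_def)
  define s0 where "s0 = real k0 + t"
  \<comment> \<open>There is no circularity: S involves none of the bounds, so k0, G, X, Y, Z can be
    chosen in this order. X contains a2 G since Y contains \<open>s0\<^sup>2\<close> G and the step
    of A multiplies Y by a2.\<close>
  define X where "X = 1 + G + a2 * G"
  define Y where "Y = 4 * (b0 + b1 * X) / c + s0\<^sup>2 * G"
  define d where "d = a3 + a2 * Y"
  define Z where "Z = d + s0\<^sup>2 * G"
  have X: "1 \<le> X" "G \<le> X" "a2 * G \<le> X" using G nonneg by (auto simp: X_def)
  have bX: "0 \<le> b0 + b1 * X" using X nonneg by simp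
  have Y: "0 \<le> Y" "4 * (b0 + b1 * X) / c \<le> Y" "s0\<^sup>2 * G \<le> Y"
    using bX G c by (auto simp: Y_def)
  have d: "0 \<le> d" using nonneg Y by (simp add: d_def)
  have Z: "0 \<le> Z" "d \<le> Z" "s0\<^sup>2 * G \<le> Z" using d G by (auto simp: Z_def)
  have main: "A T \<le> q / real T + (Z + G * (real k0)\<^sup>2) / (real T)\<^sup>2 \<and> U T \<le> (Y + G * (real k0)\<^sup>2) / (real T)\<^sup>2"
    if init: "A 0 = A0" "U 0 = U0" and q: "0 \<le> q" "q \<le> Q" and A: "\<And>k. 0 \<le> A k" and U: "\<And>k. 0 \<le> U k"
      and rA: "\<And>k. A (Suc k) \<le> (1 - 16/3 / (real k + t) + a1 / (real k + t)\<^sup>2) * A k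
        + a2 / (real k + t) * U k + q / (real k + t)\<^sup>2 + a3 / (real k + t)^3"
      and rU: "\<And>k. U (Suc k) \<le> (1 - c) * U k + (b0 + b1 * A k + b2 * U k) / (real k + t)\<^sup>2"
      and T: "1 \<le> T" for A U :: "nat \<Rightarrow> real" and q T
  proof -
    have crude: "1 + A k + U k \<le> B ^ k * (1 + A0 + U0)" for k
    proof (induction k)
      case (Suc k)
      let ?s = "real k + t"
      have s: "t \<le> ?s" "0 < ?s" using t by auto
      have d1: "x / ?s \<le> x / t" and d2: "x / ?s\<^sup>2 \<le> x / t\<^sup>2" and d3: "x / ?s^3 \<le> x / t^3" if "0 \<le> x" for x
        using that s t by (auto intro!: divide_left_mono power_mono mult_pos_pos zero_less_power)
      have "A (Suc k) \<le> (1 + a1 / t\<^sup>2) * A k + a2 / t * U k + Q / t\<^sup>2 + a3 / t^3"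
      proof -
        have "0 \<le> 16/3 / ?s" using s by simp
        then have "1 - 16/3 / ?s + a1 / ?s\<^sup>2 \<le> 1 + a1 / t\<^sup>2"
          using d2[OF nonneg(1)] by linarith
        then have "(1 - 16/3 / ?s + a1 / ?s\<^sup>2) * A k \<le> (1 + a1 / t\<^sup>2) * A k"
          by (rule mult_right_mono) (rule A)
        moreover have "a2 / ?s * U k \<le> a2 / t * U k"
          using d1[OF nonneg(2)] U by (intro mult_right_mono) auto
        moreover have "q / ?s\<^sup>2 \<le> Q / t\<^sup>2"
          using d2[OF nonneg(7)] divide_right_mono[OF q(2), of "?s\<^sup>2"] by simp
        ultimately show ?thesis using rA[of k] d3[OF nonneg(3)] by linarith
      qed
      moreover have "U (Suc k) \<le> U k + (b0 + b1 * A k + b2 * U k) / t\<^sup>2"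
      proof -
        have "(1 - c) * U k \<le> 1 * U k" using c U by (intro mult_right_mono) auto
        moreover have "(b0 + b1 * A k + b2 * U k) / ?s\<^sup>2 \<le> (b0 + b1 * A k + b2 * U k) / t\<^sup>2"
          using nonneg A U by (intro d2) simp
        ultimately show ?thesis using rU[of k] by linarith
      qed
      ultimately have "1 + A (Suc k) + U (Suc k) \<le> 1 + (1 + a1 / t\<^sup>2) * A k + a2 / t * U k + Q / t\<^sup>2 + a3 / t^3
          + (U k + (b0 + b1 * A k + b2 * U k) / t\<^sup>2)" by linarith
      also have "\<dots> \<le> B * (1 + A k + U k)"
      proof -
        have "B * (1 + A k + U k) - (1 + (1 + a1 / t\<^sup>2) * A k + a2 / t * U k + Q / t\<^sup>2 + a3 / t^3
          + (U k + (b0 + b1 * A k + b2 * U k) / t\<^sup>2))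
          = (1 + a1 / t\<^sup>2 + a2 / t + b1 / t\<^sup>2 + b2 / t\<^sup>2)
          + (a2 / t + Q / t\<^sup>2 + a3 / t^3 + 1 + b0 / t\<^sup>2 + b2 / t\<^sup>2) * A k
          + (a1 / t\<^sup>2 + Q / t\<^sup>2 + a3 / t^3 + 1 + b0 / t\<^sup>2 + b1 / t\<^sup>2) * U k"
          by (simp add: B_def add_divide_distrib algebra_simps)
        moreover have "0 \<le> \<dots>" using nonneg t A U by (intro add_nonneg_nonneg mult_nonneg_nonneg) auto
        ultimately show ?thesis by linarith
      qed
      also have "\<dots> \<le> B * (B ^ k * (1 + A0 + U0))" using Suc B by (intro mult_left_mono) auto
      finally show ?case by (simp add: mult.assoc)
    qed (simp add: init)
    have early: "A k \<le> G" "U k \<le> G" if "k \<le> k0" for k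
    proof -
      have "B ^ k * (1 + A0 + U0) \<le> G"
        unfolding G_def using that B nonneg by (intro mult_right_mono power_increasing) auto
      then show "A k \<le> G" "U k \<le> G" using crude[of k] A[of k] U[of k] by auto
    qed
    have late: "A k \<le> X \<and> U k \<le> Y / (real k + t)\<^sup>2 \<and> A k \<le> q / (real k + t) + Z / (real k + t)\<^sup>2"
      if "k0 \<le> k" for k
      using that
    proof (induction k rule: dec_induct)
      case base
      have s0: "0 < s0" using t by (simp add: s0_def)
      have "U k0 * s0\<^sup>2 \<le> Y" "A k0 * s0\<^sup>2 \<le> Z"
        using early[of k0] Y(3) Z(3) mult_right_mono[of "U k0" G "s0\<^sup>2"] mult_right_mono[of "A k0" G "s0\<^sup>2"]
        by (auto simp: mult.commute)
      then have "U k0 \<le> Y / s0\<^sup>2" "A k0 \<le> Z / s0\<^sup>2" using s0 by (simp_all add: pos_le_divide_eq)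
      moreover have "0 \<le> q / s0" using q s0 by simp
      ultimately show ?case using early(1)[of k0] X unfolding s0_def by (auto intro: add_increasing)
    next
      case (step k)
      define s where "s = real k + t"
      have sk: "real k0 \<le> s" "s0 \<le> s" using step(1) t by (auto simp: s_def s0_def)
      have s: "6 \<le> s" "3 * a1 \<le> s" "6 / c \<le> s" "8 * b2 / c \<le> s" "4 * a2 * (b0 + b1) / c \<le> s" "Q \<le> s" "a3 \<le> s"
        using S k0 sk(1) by linarith+
      then have s1: "1 \<le> s" "0 < s" by auto
      have ss: "s \<le> s\<^sup>2" using s1 by (simp add: power2_eq_square)
      have Ak: "A k \<le> X" "A k \<le> q / s + Z / s\<^sup>2" and Uk: "U k \<le> Y / s\<^sup>2"
        using step(3) by (auto simp: s_def)
      let ?\<rho> = "1 - 16/3 / s + a1 / s\<^sup>2"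
      \<comment> \<open>The second-order term costs (1/3)/s, so the contraction of A is at least
        16/3 - 1/3 = 5 over s.\<close>
      have a1s: "a1 / s\<^sup>2 \<le> (1/3) / s" using s(2) s1 by (simp add: field_simps power2_eq_square)
      have \<rho>: "0 \<le> ?\<rho>" "?\<rho> \<le> 1 - 5 / s"
      proof -
        have "16/3 / s \<le> 1" using s(1) s1 by (simp add: field_simps)
        then show "0 \<le> ?\<rho>" using nonneg(1) by (simp add: add_nonneg_nonneg)
        have "16/3 / s = 5 / s + (1/3) / s" by (simp add: add_divide_distrib[symmetric])
        then show "?\<rho> \<le> 1 - 5 / s" using a1s by linarith
      qed
      have UY: "a2 / s * U k \<le> (a2 * Y) / s^3"
      proof -
        have "a2 / s * U k \<le> a2 / s * (Y / s\<^sup>2)" using Uk nonneg(2) s1 by (intro mult_left_mono) auto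
        then show ?thesis by (simp add: power2_eq_square power3_eq_cube)
      qed
      have rA': "A (Suc k) \<le> ?\<rho> * A k + q / s\<^sup>2 + d / s^3"
        using rA[of k] UY by (simp add: s_def[symmetric] d_def add_divide_distrib)
      have UN: "U (Suc k) \<le> Y / (s + 1)\<^sup>2"
      proof -
        have "b1 * A k \<le> b1 * X" using Ak nonneg by (intro mult_left_mono) auto
        moreover have "b0 + b1 * X \<le> (c / 4) * Y"
        proof -
          have "c * (4 * (b0 + b1 * X) / c) \<le> c * Y" using Y(2) c by (intro mult_left_mono) auto
          then show ?thesis using c by simp
        qed
        moreover have "b2 * U k \<le> (c / 8) * Y"
        proof -
          have "8 * b2 \<le> c * s" using s(4) c by (simp add: field_simps)
          also have "\<dots> \<le> c * s\<^sup>2" using ss c by simp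
          finally have "b2 / s\<^sup>2 \<le> c / 8" using s1 by (simp add: field_simps)
          then have "b2 / s\<^sup>2 * Y \<le> c / 8 * Y" using Y(1) by (rule mult_right_mono)
          moreover have "b2 * U k \<le> b2 * (Y / s\<^sup>2)" using Uk nonneg by (intro mult_left_mono) auto
          moreover have "b2 * (Y / s\<^sup>2) = b2 / s\<^sup>2 * Y" by simp
          ultimately show ?thesis by linarith
        qed
        ultimately have "(b0 + b1 * A k + b2 * U k) / s\<^sup>2 \<le> ((c / 4 + c / 8) * Y) / s\<^sup>2"
          by (intro divide_right_mono) (auto simp: algebra_simps)
        moreover have "(1 - c) * U k \<le> (1 - c) * (Y / s\<^sup>2)" using Uk c by (intro mult_left_mono) auto
        ultimately have "U (Suc k) \<le> (1 - c) * (Y / s\<^sup>2) + ((c / 4 + c / 8) * Y) / s\<^sup>2"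
          using rU[of k] by (simp add: s_def[symmetric])
        also have "\<dots> = ((1 - c) * Y + (c / 4 + c / 8) * Y) / s\<^sup>2" by (simp add: add_divide_distrib)
        also have "(1 - c) * Y + (c / 4 + c / 8) * Y = (1 - 5 * c / 8) * Y" by (simp add: algebra_simps)
        \<comment> \<open>From c s >= 6 follows (s + 1)^2 <= (1 + c/2) s^2, and (1 - 5c/8) (1 + c/2)
          <= 1.\<close>
        also have "(1 - 5 * c / 8) * Y / s\<^sup>2 \<le> Y / (s + 1)\<^sup>2"
        proof -
          have "6 \<le> c * s" using s(3) c by (simp add: field_simps)
          then have "6 * s \<le> (c * s) * s" using s1 by (intro mult_right_mono) auto
          moreover have "(1 + c / 2) * s\<^sup>2 - (s + 1)\<^sup>2 = (c * s) * s / 2 - 2 * s - 1"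
            by (simp add: power2_eq_square algebra_simps)
          ultimately have "(s + 1)\<^sup>2 \<le> (1 + c / 2) * s\<^sup>2" using s1 by linarith
          then have "(1 - 5 * c / 8) * (s + 1)\<^sup>2 \<le> (1 - 5 * c / 8) * ((1 + c / 2) * s\<^sup>2)"
            using c by (intro mult_left_mono) auto
          also have "\<dots> = ((1 - 5 * c / 8) * (1 + c / 2)) * s\<^sup>2" by simp
          also have "\<dots> \<le> 1 * s\<^sup>2"
            using c by (intro mult_right_mono) (auto simp: algebra_simps)
          finally have "Y * ((1 - 5 * c / 8) * (s + 1)\<^sup>2) \<le> Y * (1 * s\<^sup>2)" using Y by (intro mult_left_mono) auto
          then have le: "(1 - 5 * c / 8) * Y * (s + 1)\<^sup>2 - Y * s\<^sup>2 \<le> 0" by (simp only: ac_simps)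
          have ne: "s\<^sup>2 \<noteq> 0" "(s + 1)\<^sup>2 \<noteq> 0" and pos: "0 < s\<^sup>2 * (s + 1)\<^sup>2" using s1 by auto
          show ?thesis by (rule frac_le_eq[OF ne, THEN iffD2, OF divide_nonpos_pos[OF le pos]])
        qed
        finally show ?thesis .
      qed
      have AN1: "A (Suc k) \<le> X"
      proof -
        have "?\<rho> * A k \<le> ?\<rho> * X" using \<rho> Ak by (intro mult_left_mono) auto
        also have "\<dots> \<le> (1 - 5 / s) * X" using \<rho> X by (intro mult_right_mono) auto
        finally have "A (Suc k) \<le> (1 - 5 / s) * X + q / s\<^sup>2 + d / s^3" using rA' by linarith
        \<comment> \<open>The contraction frees 5 X / s: one share pays for q, the other four for d,
          of which the threshold on s makes three sufficient.\<close>
        moreover have "q / s\<^sup>2 + d / s^3 \<le> (5 / s) * X"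
        proof -
          have "q / s \<le> 1" using q s(6) s1 by (simp add: divide_le_eq)
          then have "q / s \<le> X" using X(1) by linarith
          moreover have "d / s\<^sup>2 \<le> 4 * X"
          proof -
            have "1 * s\<^sup>2 \<le> X * s\<^sup>2" using X(1) by (intro mult_right_mono) auto
            then have "a3 \<le> X * s\<^sup>2" using s(7) ss by linarith
            moreover have "a2 * Y \<le> 2 * X * s\<^sup>2"
            proof -
              have "a2 * Y = 4 * a2 * (b0 + b1 * X) / c + s0\<^sup>2 * (a2 * G)"
                by (simp add: Y_def algebra_simps)
              also have "s0\<^sup>2 * (a2 * G) \<le> s\<^sup>2 * X"
                using sk X t nonneg G by (intro mult_mono power_mono) (auto simp: s0_def)
              also have "4 * a2 * (b0 + b1 * X) / c \<le> 4 * a2 * ((b0 + b1) * X) / c"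
              proof -
                have "b0 \<le> b0 * X" using mult_left_mono[OF X(1) nonneg(4)] by simp
                then show ?thesis using c nonneg by (intro divide_right_mono mult_left_mono) (auto simp: algebra_simps)
              qed
              also have "\<dots> = (4 * a2 * (b0 + b1) / c) * X" by simp
              also have "\<dots> \<le> s\<^sup>2 * X" using s(5) ss X by (intro mult_right_mono) auto
              finally show ?thesis by (simp add: algebra_simps)
            qed
            ultimately have "d \<le> 3 * X * s\<^sup>2" by (simp add: d_def)
            also have "\<dots> \<le> 4 * X * s\<^sup>2" using X by (intro mult_right_mono) auto
            finally show ?thesis using s1 by (simp add: divide_le_eq)
          qed
          ultimately have "(q / s + d / s\<^sup>2) / s \<le> (5 * X) / s" using s1 by (intro divide_right_mono) auto
          then show ?thesis by (simp add: add_divide_distrib power2_eq_square power3_eq_cube)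
        qed
        ultimately show ?thesis by (simp add: algebra_simps)
      qed
      \<comment> \<open>Passing from s to s + 1 lowers q/s by at most q/s^2 and Z/s^2 by at most 2
        Z/s^3. The factor 5 pays for both, for the new noise q/s^2 and for d <= Z.\<close>
      have AN2: "A (Suc k) \<le> q / (s + 1) + Z / (s + 1)\<^sup>2"
      proof -
        have s5: "0 \<le> 1 - 5 / s" using s(1) s1 by (simp add: field_simps)
        have "?\<rho> * A k \<le> (1 - 5 / s) * A k" using \<rho> A by (intro mult_right_mono) auto
        also have "\<dots> \<le> (1 - 5 / s) * (q / s + Z / s\<^sup>2)" using s5 Ak by (intro mult_left_mono) auto
        also have "\<dots> = q / s + Z / s\<^sup>2 - 5 * q / s\<^sup>2 - 5 * Z / s^3"
          using s1 by (simp add: field_simps power2_eq_square power3_eq_cube)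
        finally have "A (Suc k) \<le> q / s + Z / s\<^sup>2 - 4 * q / s\<^sup>2 - (5 * Z - d) / s^3"
          using rA' by (simp add: diff_divide_distrib)
        moreover have "q / s - 4 * q / s\<^sup>2 \<le> q / (s + 1)"
        proof -
          have "q / s - q / (s + 1) = q / (s * (s + 1))" using s1 by (simp add: field_simps)
          also have "\<dots> \<le> q / (s * s)" using s1 q by (intro divide_left_mono) auto
          also have "\<dots> \<le> 4 * q / s\<^sup>2" using q s1 by (simp add: power2_eq_square divide_right_mono)
          finally show ?thesis by simp
        qed
        moreover have "Z / s\<^sup>2 - (5 * Z - d) / s^3 \<le> Z / (s + 1)\<^sup>2"
        proof -
          have "1 / s\<^sup>2 - 1 / (s + 1)\<^sup>2 \<le> 2 / s^3"
          proof -
            have "s^3 * ((s + 1)\<^sup>2 - s\<^sup>2) \<le> 2 * (s\<^sup>2 * (s + 1)\<^sup>2)"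
              using s1 by (simp add: power2_eq_square power3_eq_cube algebra_simps)
            then have "((s + 1)\<^sup>2 - s\<^sup>2) / (s\<^sup>2 * (s + 1)\<^sup>2) \<le> 2 / s^3"
              using s1 by (simp add: divide_le_eq le_divide_eq) (simp add: mult.commute)
            moreover have "1 / s\<^sup>2 - 1 / (s + 1)\<^sup>2 = ((s + 1)\<^sup>2 - s\<^sup>2) / (s\<^sup>2 * (s + 1)\<^sup>2)"
              using s1 by (simp add: diff_frac_eq)
            ultimately show ?thesis by simp
          qed
          from mult_left_mono[OF this Z(1)]
          have "Z / s\<^sup>2 - Z / (s + 1)\<^sup>2 \<le> 2 * Z / s^3" by (simp add: right_diff_distrib mult.commute)
          also have "\<dots> \<le> (5 * Z - d) / s^3" using Z s1 by (intro divide_right_mono) auto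
          finally show ?thesis by simp
        qed
        ultimately show ?thesis by linarith
      qed
      have "real (Suc k) + t = s + 1" by (simp add: s_def)
      with AN1 AN2 UN show ?case by metis
    qed
    have T': "0 < real T" using T by simp
    show ?thesis
    \<comment> \<open>For T < k0 the rate holds only because G \<open>k0\<^sup>2\<close> was added
      to the constants; for larger T, replacing T + t by T weakens the bound.\<close>
    proof (cases "k0 \<le> T")
      case True
      have "q / (real T + t) \<le> q / real T" using T' t q by (intro divide_left_mono) auto
      moreover have le: "x / (real T + t)\<^sup>2 \<le> (x + G * (real k0)\<^sup>2) / (real T)\<^sup>2" if "0 \<le> x" for x
        using T' t that G by (intro frac_le power_mono) auto
      ultimately show ?thesis
        using late[OF True] le[OF Z(1)] le[OF Y(1)] by linarith
    next
      case False
      then have "G * (real T)\<^sup>2 \<le> G * (real k0)\<^sup>2" using G by (intro mult_left_mono power_mono) auto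
      then have "G \<le> (G * (real k0)\<^sup>2) / (real T)\<^sup>2" using T' by (simp add: pos_le_divide_eq)
      moreover have "0 \<le> q / real T" "0 \<le> Z / (real T)\<^sup>2" "0 \<le> Y / (real T)\<^sup>2" using q Z Y by auto
      ultimately show ?thesis using early[of T] False by (auto simp: add_divide_distrib)
    qed
  qed
  show ?thesis
    by (rule exI[of _ "Z + G * (real k0)\<^sup>2"], intro conjI, use Z G in simp,
        rule exI[of _ "Y + G * (real k0)\<^sup>2"], intro conjI, use Y G in simp)
       (use main in blast)
qed

subsection \<open>Square-integrable random variables\<close>

context prob_space
begin

text \<open>Closure under linear combinations and integrability of products settle the integrability
  conditions of the iteration.\<close>

definition l2 :: "('a \<Rightarrow> real) \<Rightarrow> bool" where
  "l2 X \<longleftrightarrow> X \<in> borel_measurable M \<and> integrable M (\<lambda>\<omega>. (X \<omega>)\<^sup>2)"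

lemma l2_dominated:
  assumes X: "X \<in> borel_measurable M" and Y: "integrable M Y" and le: "\<And>\<omega>. \<omega> \<in> space M \<Longrightarrow> (X \<omega>)\<^sup>2 \<le> Y \<omega>"
  shows "l2 X"
  unfolding l2_def
proof
  show "integrable M (\<lambda>\<omega>. (X \<omega>)\<^sup>2)"
  proof (rule Bochner_Integration.integrable_bound[OF Y])
    show "AE \<omega> in M. norm ((X \<omega>)\<^sup>2) \<le> norm (Y \<omega>)"
    proof (rule AE_I2)
      fix \<omega> assume "\<omega> \<in> space M"
      from le[OF this] show "norm ((X \<omega>)\<^sup>2) \<le> norm (Y \<omega>)" by simp
    qed
  qed (use X in measurable)
qed (rule X)

lemma l2_add: "l2 X \<Longrightarrow> l2 Y \<Longrightarrow> l2 (\<lambda>\<omega>. X \<omega> + Y \<omega>)"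
proof (rule l2_dominated)
  assume XY: "l2 X" "l2 Y"
  then show "integrable M (\<lambda>\<omega>. 2 * (X \<omega>)\<^sup>2 + 2 * (Y \<omega>)\<^sup>2)" by (auto simp: l2_def)
  show "(\<lambda>\<omega>. X \<omega> + Y \<omega>) \<in> borel_measurable M" using XY by (auto simp: l2_def)
  show "(X \<omega> + Y \<omega>)\<^sup>2 \<le> 2 * (X \<omega>)\<^sup>2 + 2 * (Y \<omega>)\<^sup>2" for \<omega>
    using sum_squares_bound[of "X \<omega>" "Y \<omega>"] by (simp add: power2_sum)
qed

lemma l2_scale: "l2 X \<Longrightarrow> l2 (\<lambda>\<omega>. c * X \<omega>)"
  by (auto simp: l2_def power_mult_distrib)

lemma l2_const: "l2 (\<lambda>_. c)"
  by (simp add: l2_def)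

lemma l2_diff: "l2 X \<Longrightarrow> l2 Y \<Longrightarrow> l2 (\<lambda>\<omega>. X \<omega> - Y \<omega>)"
  using l2_add[of X "\<lambda>\<omega>. -1 * Y \<omega>"] l2_scale[of Y "-1"] by simp

lemma l2_sum: "(\<And>i. i \<in> I \<Longrightarrow> l2 (X i)) \<Longrightarrow> l2 (\<lambda>\<omega>. \<Sum>i\<in>I. X i \<omega>)"
  by (induction I rule: infinite_finite_induct) (auto intro: l2_add l2_const)

lemma l2_cong: "(\<And>\<omega>. \<omega> \<in> space M \<Longrightarrow> X \<omega> = Y \<omega>) \<Longrightarrow> l2 X \<longleftrightarrow> l2 Y"
  unfolding l2_def
  by (intro arg_cong2[where f = "(\<and>)"] measurable_cong Bochner_Integration.integrable_cong) auto

lemma l2_mult_integrable: "l2 X \<Longrightarrow> l2 Y \<Longrightarrow> integrable M (\<lambda>\<omega>. X \<omega> * Y \<omega>)"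
proof (rule Bochner_Integration.integrable_bound)
  assume XY: "l2 X" "l2 Y"
  then show "integrable M (\<lambda>\<omega>. (X \<omega>)\<^sup>2 + (Y \<omega>)\<^sup>2)" by (auto simp: l2_def)
  show "(\<lambda>\<omega>. X \<omega> * Y \<omega>) \<in> borel_measurable M" using XY by (auto simp: l2_def)
  show "AE \<omega> in M. norm (X \<omega> * Y \<omega>) \<le> norm ((X \<omega>)\<^sup>2 + (Y \<omega>)\<^sup>2)"
  proof (rule AE_I2)
    fix \<omega>
    have "2 * \<bar>X \<omega> * Y \<omega>\<bar> \<le> (X \<omega>)\<^sup>2 + (Y \<omega>)\<^sup>2"
      using sum_squares_bound[of "\<bar>X \<omega>\<bar>" "\<bar>Y \<omega>\<bar>"] by (simp add: abs_mult)
    moreover have "0 \<le> \<bar>X \<omega> * Y \<omega>\<bar>" by simp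
    ultimately have "\<bar>X \<omega> * Y \<omega>\<bar> \<le> (X \<omega>)\<^sup>2 + (Y \<omega>)\<^sup>2" by linarith
    then show "norm (X \<omega> * Y \<omega>) \<le> norm ((X \<omega>)\<^sup>2 + (Y \<omega>)\<^sup>2)" by simp
  qed
qed

definition l2v :: "nat \<Rightarrow> ('a \<Rightarrow> nat \<Rightarrow> real) \<Rightarrow> bool" where
  "l2v p X \<longleftrightarrow> (\<forall>j<p. l2 (\<lambda>\<omega>. X \<omega> j))"

lemma l2v_ip_integrable: "l2v p X \<Longrightarrow> l2v p Y \<Longrightarrow> integrable M (\<lambda>\<omega>. ip p (X \<omega>) (Y \<omega>))"
  unfolding ip_def l2v_def by (intro Bochner_Integration.integrable_sum l2_mult_integrable) auto

lemma l2v_diff: "l2v p X \<Longrightarrow> l2v p Y \<Longrightarrow> l2v p (\<lambda>\<omega> j. X \<omega> j - Y \<omega> j)"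
  and l2v_const: "l2v p (\<lambda>_. z)"
  by (auto simp: l2v_def intro: l2_diff l2_const)

lemma l2v_dominated:
  assumes X: "X \<in> M \<rightarrow>\<^sub>M RV p" and Y: "integrable M Y"
    and le: "\<And>\<omega>. \<omega> \<in> space M \<Longrightarrow> ip p (X \<omega>) (X \<omega>) \<le> Y \<omega>"
  shows "l2v p X"
  unfolding l2v_def
proof (intro allI impI)
  fix j assume j: "j < p"
  show "l2 (\<lambda>\<omega>. X \<omega> j)"
  proof (rule l2_dominated[OF _ Y])
    show "(\<lambda>\<omega>. X \<omega> j) \<in> borel_measurable M"
      using j by (intro measurable_compose[OF X measurable_component_singleton]) simp
    fix \<omega> assume "\<omega> \<in> space M"
    have "(X \<omega> j)\<^sup>2 \<le> ip p (X \<omega>) (X \<omega>)" unfolding ip_self using j by (intro member_le_sum) auto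
    then show "(X \<omega> j)\<^sup>2 \<le> Y \<omega>" using le[OF \<open>\<omega> \<in> space M\<close>] by simp
  qed
qed

lemma l2v_dominated_nn:
  assumes X: "X \<in> M \<rightarrow>\<^sub>M RV p" and fin: "(\<integral>\<^sup>+\<omega>. ennreal (ip p (X \<omega>) (X \<omega>)) \<partial>M) < \<infinity>"
  shows "l2v p X"
proof (rule l2v_dominated[OF X])
  show "integrable M (\<lambda>\<omega>. ip p (X \<omega>) (X \<omega>))"
    using fin by (intro integrableI_nonneg ip_measurable X) auto
qed simp

end

text \<open>Joint measurability in (x, z) passes from the difference quotients to
  \<open>pdiff\<close>, and integration over z preserves measurability in x.\<close>

lemma (in smooth_objective) mean_grad_measurable: "mean_grad \<in> RV p \<rightarrow>\<^sub>M RV p"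
proof -
  have "(\<lambda>x. \<integral>z. pdiff p \<Phi> x z j \<partial>D) \<in> borel_measurable (RV p)" if j: "j < p" for j
  proof (rule borel_measurable_lebesgue_integral)
    have st: "(\<lambda>w. step_to p (fst w) t e) \<in> RV p \<Otimes>\<^sub>M D \<rightarrow>\<^sub>M RV p" for t and e :: "nat \<Rightarrow> real"
      unfolding step_to_def by measurable
    have "(\<lambda>w. lim (\<lambda>m. (\<Phi> (step_to p (fst w) (1 / real (Suc m)) (\<lambda>l. if l = j then 1 else 0)) (snd w)
        - \<Phi> (fst w) (snd w)) * real (Suc m))) \<in> borel_measurable (RV p \<Otimes>\<^sub>M D)"
      by (intro borel_measurable_lim_metric borel_measurable_times borel_measurable_diff Phi_measurable st
          measurable_fst measurable_snd borel_measurable_const)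
    then show "(\<lambda>(x, z). pdiff p \<Phi> x z j) \<in> borel_measurable (RV p \<Otimes>\<^sub>M D)"
      using j by (simp add: pdiff_def case_prod_beta')
  qed
  then show ?thesis unfolding mean_grad_def by (intro measurable_restrict) auto
qed

lemma (in smooth_objective) obj_measurable: "obj \<in> borel_measurable (RV p)"
  unfolding obj_def[abs_def] by (rule borel_measurable_lebesgue_integral) (rule meas)

lemma (in gradient_estimator) est_mean_measurable: "est_mean \<in> RV p \<rightarrow>\<^sub>M RV p"
proof -
  have "(\<lambda>x. \<integral>w. grad_est p \<Phi> d x (fst w) (snd w) j \<partial>Q) \<in> borel_measurable (RV p)" if j: "j < p" for j
  proof (rule QP.P.borel_measurable_lebesgue_integral)
    have "(\<lambda>a. grad_est p \<Phi> d (fst a) (fst (snd a)) (snd (snd a))) \<in> RV p \<Otimes>\<^sub>M Q \<rightarrow>\<^sub>M RV p"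
      by (rule grad_est_measurable) measurable
    then have "(\<lambda>a. grad_est p \<Phi> d (fst a) (fst (snd a)) (snd (snd a)) j) \<in> borel_measurable (RV p \<Otimes>\<^sub>M Q)"
      by (rule measurable_compose) (use j in \<open>intro measurable_component_singleton, simp\<close>)
    then show "(\<lambda>(x, w). grad_est p \<Phi> d x (fst w) (snd w) j) \<in> borel_measurable (RV p \<Otimes>\<^sub>M Q)"
      by (simp add: case_prod_beta')
  qed
  then show ?thesis unfolding est_mean_def case_prod_beta' by (intro measurable_restrict) auto
qed

lemma smooth_fun_grad_growth:
  assumes sm: "smooth_fun p L \<phi>" and x: "x \<in> Rp p" and z: "z \<in> Rp p"
  shows "ip p (grad p \<phi> x) (grad p \<phi> x)
    \<le> 2 * L\<^sup>2 * ip p (\<lambda>j. x j - z j) (\<lambda>j. x j - z j) + 2 * ip p (grad p \<phi> z) (grad p \<phi> z)"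
  using ip_sum_le[of p "\<lambda>j. grad p \<phi> x j - grad p \<phi> z j" "grad p \<phi> z"] smooth_fun_Lipschitz_sq[OF sm x z]
  by simp

lemma smooth_fun_growth:
  assumes sm: "smooth_fun p L \<phi>" and L: "0 \<le> L" and x: "x \<in> Rp p" and z: "z \<in> Rp p"
  shows "\<bar>\<phi> x\<bar> \<le> \<bar>\<phi> z\<bar> + ip p (grad p \<phi> z) (grad p \<phi> z) + (L + 1) * ip p (\<lambda>j. x j - z j) (\<lambda>j. x j - z j)"
proof -
  let ?d = "\<lambda>j. x j - z j"
  have "2 * \<bar>ip p (grad p \<phi> z) ?d\<bar> \<le> ip p (grad p \<phi> z) (grad p \<phi> z) + ip p ?d ?d"
    using ip_Young[of 1 p "grad p \<phi> z" ?d] by simp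
  moreover have "\<bar>\<phi> x - \<phi> z - ip p (grad p \<phi> z) ?d\<bar> \<le> L * ip p ?d ?d"
    by (rule smooth_fun_quadratic_bound[OF sm L z x])
  moreover have "0 \<le> ip p (grad p \<phi> z) (grad p \<phi> z)" "0 \<le> ip p ?d ?d" by simp_all
  ultimately show ?thesis unfolding distrib_right by linarith
qed

subsection \<open>The iteration\<close>

lemma ip_avg: "ip p (\<lambda>j. (\<Sum>i<n. X i j) / real n) w = (\<Sum>i<n. ip p (X i) w) / real n"
proof -
  have "ip p (\<lambda>j. (\<Sum>i<n. X i j) / real n) w = (\<Sum>j<p. \<Sum>i<n. X i j * w j / real n)"
    by (simp add: ip_def sum_distrib_right sum_divide_distrib)
  also have "\<dots> = (\<Sum>i<n. \<Sum>j<p. X i j * w j / real n)" by (rule sum.swap)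
  finally show ?thesis by (simp add: ip_def sum_divide_distrib)
qed

lemma ip_avg_right: "ip p w (\<lambda>j. (\<Sum>i<n. X i j) / real n) = (\<Sum>i<n. ip p w (X i)) / real n"
  using ip_avg[of p X n w] by (simp add: ip_commute)

lemma ip_avg_Jensen:
  assumes "1 \<le> n"
  shows "ip p (\<lambda>j. (\<Sum>i<n. X i j) / real n) (\<lambda>j. (\<Sum>i<n. X i j) / real n) \<le> (\<Sum>i<n. ip p (X i) (X i)) / real n"
proof -
  have "ip p (\<lambda>j. (\<Sum>i<n. X i j) / real n) (\<lambda>j. (\<Sum>i<n. X i j) / real n)
      = (\<Sum>j<p. (\<Sum>i<n. X i j)\<^sup>2 / (real n)\<^sup>2)"
    by (simp add: ip_self power_divide)
  also have "\<dots> \<le> (\<Sum>j<p. (\<Sum>i<n. (X i j)\<^sup>2) / real n)"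
  proof (rule sum_mono)
    fix j
    have "(\<Sum>i<n. X i j)\<^sup>2 \<le> (\<Sum>i<n. (X i j)\<^sup>2) * real (card {..<n})"
      by (rule sum_squared_le_sum_of_squares)
    then have "(\<Sum>i<n. X i j)\<^sup>2 / (real n)\<^sup>2 \<le> (\<Sum>i<n. (X i j)\<^sup>2) * real n / (real n)\<^sup>2"
      by (intro divide_right_mono) auto
    then show "(\<Sum>i<n. X i j)\<^sup>2 / (real n)\<^sup>2 \<le> (\<Sum>i<n. (X i j)\<^sup>2) / real n"
      using assms by (simp add: power2_eq_square)
  qed
  also have "\<dots> = (\<Sum>i<n. \<Sum>j<p. (X i j)\<^sup>2) / real n"
    unfolding sum_divide_distrib[symmetric] by (subst sum.swap) simp
  finally show ?thesis by (simp add: ip_self)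
qed

lemma agent_mean_Rp [simp]: "agent_mean n p y \<in> Rp p"
  by (simp add: agent_mean_def)

lemma agent_mean_apply: "j < p \<Longrightarrow> agent_mean n p y j = (\<Sum>i<n. y i j) / real n"
  by (simp add: agent_mean_def)

lemma consensus_error_ip:
  "consensus_error n p y
    = (\<Sum>i<n. ip p (\<lambda>j. y i j - agent_mean n p y j) (\<lambda>j. y i j - agent_mean n p y j)) / real n"
  by (simp add: consensus_error_def nrm_sq)

lemma lap_const: "lap n a (\<lambda>_. c) i = 0"
  by (simp add: lap_def)

text \<open>The schedules enter through the positivity of \<eta> and the constant products \<eta>
  \<alpha> and \<eta> \<beta>; the decay of \<eta> is inserted only when the recursions are
  solved.\<close>

locale zo_primal_dual = samples M n p D u \<xi>
  for M :: "'w measure" and n p :: nat and D :: "nat \<Rightarrow> 'z measure"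
    and u :: "nat \<Rightarrow> nat \<Rightarrow> 'w \<Rightarrow> nat \<Rightarrow> real" and \<xi> :: "nat \<Rightarrow> nat \<Rightarrow> 'w \<Rightarrow> 'z" +
  fixes E :: "(nat \<times> nat) set" and a :: "nat \<Rightarrow> nat \<Rightarrow> real" and F :: "nat \<Rightarrow> (nat \<Rightarrow> real) \<Rightarrow> 'z \<Rightarrow> real"
    and Lf \<sigma>\<^sub>0 \<sigma>\<^sub>1 \<nu> \<kappa>\<^sub>1 \<kappa>\<^sub>2 :: real and \<alpha> \<beta> \<eta> :: "nat \<Rightarrow> real" and \<delta> :: "nat \<Rightarrow> nat \<Rightarrow> real"
    and x0 :: "nat \<Rightarrow> nat \<Rightarrow> real" and x v :: "nat \<Rightarrow> nat \<Rightarrow> 'w \<Rightarrow> nat \<Rightarrow> real"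
  assumes n1: "1 \<le> n" and net: "network n E a" and Lf: "0 < Lf"
    and ge: "\<And>i k. i < n \<Longrightarrow> gradient_estimator (D i) p (F i) Lf \<sigma>\<^sub>0 \<sigma>\<^sub>1 (\<delta> i k)"
    and \<eta>: "\<And>k. 0 < \<eta> k" and \<eta>\<alpha>: "\<And>k. \<eta> k * \<alpha> k = \<kappa>\<^sub>1 * \<kappa>\<^sub>2" and \<eta>\<beta>: "\<And>k. \<eta> k * \<beta> k = \<kappa>\<^sub>2"
    and x0: "\<And>i. i < n \<Longrightarrow> x0 i \<in> Rp p"
    and it: "primal_dual_iterates n p (laplacian n a) F \<alpha> \<beta> \<eta> \<delta> x0 M u \<xi> x v"
    and lb: "\<And>i. i < n \<Longrightarrow> bdd_below (local_obj F D i ` Rp p)"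
begin

abbreviation "f \<equiv> global_obj n F D"
abbreviation "fi \<equiv> local_obj F D"

text \<open>Three gradients of agent i are distinguished: \<open>mg\<close> the true one,
  \<open>em\<close> the mean of the estimate at a fixed point, \<open>gr\<close> the estimate drawn
  at time k.\<close>

definition mg :: "nat \<Rightarrow> (nat \<Rightarrow> real) \<Rightarrow> nat \<Rightarrow> real" where
  "mg i = grad p (fi i)"

definition em :: "nat \<Rightarrow> nat \<Rightarrow> (nat \<Rightarrow> real) \<Rightarrow> nat \<Rightarrow> real" where
  "em i k = gradient_estimator.est_mean (D i) p (F i) (\<delta> i k)"

definition gr :: "nat \<Rightarrow> nat \<Rightarrow> 'w \<Rightarrow> nat \<Rightarrow> real" where
  "gr i k \<omega> = grad_est p (F i) (\<delta> i k) (x i k \<omega>) (u i k \<omega>) (\<xi> i k \<omega>)"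

definition xbar :: "nat \<Rightarrow> 'w \<Rightarrow> nat \<Rightarrow> real" where
  "xbar k \<omega> = agent_mean n p (\<lambda>i. x i k \<omega>)"

lemma fi_smooth: "i < n \<Longrightarrow> smooth_fun p Lf (fi i)"
  and mg_eq: "i < n \<Longrightarrow> y \<in> Rp p \<Longrightarrow> mg i y = smooth_objective.mean_grad (D i) p (F i) y"
  and mg_measurable: "i < n \<Longrightarrow> mg i \<in> RV p \<rightarrow>\<^sub>M RV p"
  and fi_measurable: "i < n \<Longrightarrow> fi i \<in> borel_measurable (RV p)"
  and em_measurable: "i < n \<Longrightarrow> em i k \<in> RV p \<rightarrow>\<^sub>M RV p"
  and em_bias: "i < n \<Longrightarrow> y \<in> Rp p \<Longrightarrow>
      ip p (\<lambda>j. em i k y j - mg i y j) (\<lambda>j. em i k y j - mg i y j) \<le> Lf\<^sup>2 * (\<delta> i k)\<^sup>2"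
proof -
  assume i: "i < n"
  interpret g: gradient_estimator "D i" p "F i" Lf \<sigma>\<^sub>0 \<sigma>\<^sub>1 "\<delta> i k" by (rule ge[OF i])
  have eq: "fi i = g.obj" by (simp add: fun_eq_iff local_obj_def g.obj_def)
  show "smooth_fun p Lf (fi i)" unfolding eq by (rule g.smooth_obj)
  have mg: "mg i y = g.mean_grad y" if "y \<in> Rp p" for y
    unfolding mg_def eq by (rule g.grad_obj[OF that])
  then show "y \<in> Rp p \<Longrightarrow> mg i y = g.mean_grad y" .
  show "mg i \<in> RV p \<rightarrow>\<^sub>M RV p"
    using g.mean_grad_measurable mg by (subst measurable_cong[where g = g.mean_grad]) (auto simp: space_RV)
  show "fi i \<in> borel_measurable (RV p)" unfolding eq by (rule g.obj_measurable)
  show "em i k \<in> RV p \<rightarrow>\<^sub>M RV p" unfolding em_def by (rule g.est_mean_measurable)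
  show "ip p (\<lambda>j. em i k y j - mg i y j) (\<lambda>j. em i k y j - mg i y j) \<le> Lf\<^sup>2 * (\<delta> i k)\<^sup>2" if "y \<in> Rp p"
    using g.est_bias[OF that] by (simp add: em_def mg[OF that])
qed

lemma f_grad:
  assumes y: "y \<in> Rp p"
  shows "has_grad p f (\<lambda>j\<in>{..<p}. (\<Sum>i<n. mg i y j) / real n) y"
proof (rule has_gradI_quadratic[where C = Lf])
  fix z assume z: "z \<in> Rp p"
  let ?d = "\<lambda>j. z j - y j"
  have n: "0 < real n" using n1 by simp
  have "ip p (\<lambda>j\<in>{..<p}. (\<Sum>i<n. mg i y j) / real n) ?d = (\<Sum>i<n. ip p (mg i y) ?d) / real n"
    unfolding ip_avg[symmetric] by (rule ip_cong) auto
  then have "\<bar>f z - f y - ip p (\<lambda>j\<in>{..<p}. (\<Sum>i<n. mg i y j) / real n) ?d\<bar>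
      = \<bar>\<Sum>i<n. fi i z - fi i y - ip p (mg i y) ?d\<bar> / real n"
    using n by (simp add: global_obj_def sum_subtractf diff_divide_distrib[symmetric])
  also have "\<dots> \<le> (\<Sum>i<n. \<bar>fi i z - fi i y - ip p (mg i y) ?d\<bar>) / real n"
    by (intro divide_right_mono sum_abs) auto
  also have "\<dots> \<le> (\<Sum>i<n. Lf * ip p ?d ?d) / real n"
    unfolding mg_def using Lf
    by (intro divide_right_mono sum_mono smooth_fun_quadratic_bound[OF fi_smooth _ y z]) auto
  also have "\<dots> = Lf * ip p ?d ?d" using n by simp
  finally show "\<bar>f z - f y - ip p (\<lambda>j\<in>{..<p}. (\<Sum>i<n. mg i y j) / real n) ?d\<bar> \<le> Lf * ip p ?d ?d" .
qed (use Lf in auto)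

lemma grad_f: "y \<in> Rp p \<Longrightarrow> grad p f y = (\<lambda>j\<in>{..<p}. (\<Sum>i<n. mg i y j) / real n)"
  by (rule grad_eqI[OF f_grad])

lemma f_smooth: "smooth_fun p Lf f"
  unfolding smooth_fun_def
proof (intro conjI ballI)
  fix y assume y: "y \<in> Rp p"
  show "\<exists>g. has_grad p f g y" using f_grad[OF y] by blast
  fix z assume z: "z \<in> Rp p"
  let ?X = "\<lambda>i j. mg i y j - mg i z j" and ?d = "\<lambda>j. y j - z j"
  have "ip p (\<lambda>j. grad p f y j - grad p f z j) (\<lambda>j. grad p f y j - grad p f z j)
      = ip p (\<lambda>j. (\<Sum>i<n. ?X i j) / real n) (\<lambda>j. (\<Sum>i<n. ?X i j) / real n)"
    by (rule ip_cong) (simp_all add: grad_f[OF y] grad_f[OF z] sum_subtractf diff_divide_distrib)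
  also have "\<dots> \<le> (\<Sum>i<n. ip p (?X i) (?X i)) / real n" by (rule ip_avg_Jensen[OF n1])
  also have "\<dots> \<le> (\<Sum>i<n. Lf\<^sup>2 * ip p ?d ?d) / real n"
    unfolding mg_def by (intro divide_right_mono sum_mono smooth_fun_Lipschitz_sq[OF fi_smooth y z]) auto
  also have "\<dots> = (Lf * nrm p ?d)\<^sup>2" using n1 by (simp add: power_mult_distrib nrm_sq)
  finally have "(nrm p (\<lambda>j. grad p f y j - grad p f z j))\<^sup>2 \<le> (Lf * nrm p ?d)\<^sup>2" by (simp only: nrm_sq)
  then show "nrm p (\<lambda>j. grad p f y j - grad p f z j) \<le> Lf * nrm p ?d"
    by (rule power2_le_imp_le) (use Lf in simp)
qed

lemma f_measurable: "f \<in> borel_measurable (RV p)"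
  unfolding global_obj_def[abs_def] using fi_measurable by (intro borel_measurable_divide borel_measurable_sum) auto

lemma x_0: "\<omega> \<in> space M \<Longrightarrow> i < n \<Longrightarrow> x i 0 \<omega> = x0 i"
  and v_0: "\<omega> \<in> space M \<Longrightarrow> i < n \<Longrightarrow> v i 0 \<omega> = (\<lambda>j\<in>{..<p}. 0)"
  using it by (auto simp: primal_dual_iterates_def)

lemma x_Suc:
  assumes "\<omega> \<in> space M" "i < n"
  shows "x i (Suc k) \<omega> =
    (\<lambda>j\<in>{..<p}. x i k \<omega> j - (\<kappa>\<^sub>1 * \<kappa>\<^sub>2 * lap n a (\<lambda>l. x l k \<omega> j) i + \<kappa>\<^sub>2 * v i k \<omega> j + \<eta> k * gr i k \<omega> j))"
proof -
  have "x i (Suc k) \<omega> = (\<lambda>j\<in>{..<p}. x i k \<omega> j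
      - \<eta> k * (\<alpha> k * lap n a (\<lambda>l. x l k \<omega> j) i + \<beta> k * v i k \<omega> j + gr i k \<omega> j))"
    using it assms by (simp add: primal_dual_iterates_def laplacian_row[OF net] gr_def)
  then show ?thesis by (simp only: distrib_left mult.assoc[symmetric] \<eta>\<alpha> \<eta>\<beta>)
qed

lemma v_Suc: "\<omega> \<in> space M \<Longrightarrow> i < n \<Longrightarrow> v i (Suc k) \<omega> =
    (\<lambda>j\<in>{..<p}. v i k \<omega> j + \<kappa>\<^sub>2 * lap n a (\<lambda>l. x l k \<omega> j) i)"
  using it \<eta>\<beta>[of k, symmetric]
  by (simp add: primal_dual_iterates_def laplacian_row[OF net])

lemma RV_component: "X \<in> N \<rightarrow>\<^sub>M RV p \<Longrightarrow> j < p \<Longrightarrow> (\<lambda>\<omega>. X \<omega> j) \<in> borel_measurable N"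
  by (rule measurable_compose[OF _ measurable_component_singleton]) auto

lemma gr_measurable_of:
  assumes i: "i < n" and "x i k \<in> N \<rightarrow>\<^sub>M RV p" "u i k \<in> N \<rightarrow>\<^sub>M RV p" "\<xi> i k \<in> N \<rightarrow>\<^sub>M D i"
  shows "gr i k \<in> N \<rightarrow>\<^sub>M RV p"
proof -
  interpret g: gradient_estimator "D i" p "F i" Lf \<sigma>\<^sub>0 \<sigma>\<^sub>1 "\<delta> i k" by (rule ge[OF i])
  show ?thesis unfolding gr_def[abs_def] by (rule g.grad_est_measurable) (rule assms)+
qed

text \<open>Iterates up to time k use samples of times strictly before k, none of which is excluded
  from \<open>others m k\<close>.\<close>

lemma iterates_measurable:
  assumes "l \<le> k"
  shows "\<forall>i<n. x i l \<in> others m k \<rightarrow>\<^sub>M RV p \<and> v i l \<in> others m k \<rightarrow>\<^sub>M RV p"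
  using assms
proof (induction l)
  case 0
  have "x i 0 \<in> others m k \<rightarrow>\<^sub>M RV p" if "i < n" for i
    by (subst measurable_cong[where g = "\<lambda>_. x0 i"]) (use x_0 x0 that in \<open>auto simp: space_RV\<close>)
  moreover have "v i 0 \<in> others m k \<rightarrow>\<^sub>M RV p" if "i < n" for i
    by (subst measurable_cong[where g = "\<lambda>_. \<lambda>j\<in>{..<p}. 0"]) (use v_0 that in \<open>auto simp: space_RV\<close>)
  ultimately show ?case by blast
next
  case (Suc l)
  then have X: "x i l \<in> others m k \<rightarrow>\<^sub>M RV p" and V: "v i l \<in> others m k \<rightarrow>\<^sub>M RV p" if "i < n" for i
    using that by auto
  have G: "gr i l \<in> others m k \<rightarrow>\<^sub>M RV p" if "i < n" for i
    using that Suc(2) by (intro gr_measurable_of X others_measurable) auto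
  have lapm: "(\<lambda>\<omega>. lap n a (\<lambda>l'. x l' l \<omega> j) i) \<in> borel_measurable (others m k)" if "i < n" "j < p" for i j
    unfolding lap_def using that
    by (intro borel_measurable_sum borel_measurable_times borel_measurable_diff RV_component[OF X]) auto
  have "x i (Suc l) \<in> others m k \<rightarrow>\<^sub>M RV p" if "i < n" for i
    by (subst measurable_cong[OF x_Suc]) (use that in \<open>auto intro!: measurable_restrict
        borel_measurable_diff borel_measurable_add borel_measurable_times lapm RV_component[OF X]
        RV_component[OF V] RV_component[OF G]\<close>)
  moreover have "v i (Suc l) \<in> others m k \<rightarrow>\<^sub>M RV p" if "i < n" for i
    by (subst measurable_cong[OF v_Suc]) (use that in \<open>auto intro!: measurable_restrict
        borel_measurable_diff borel_measurable_add borel_measurable_times lapm RV_component[OF X]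
        RV_component[OF V]\<close>)
  ultimately show ?case by blast
qed

lemma x_measurable_others: "i < n \<Longrightarrow> x i k \<in> others m k \<rightarrow>\<^sub>M RV p"
  using iterates_measurable[of k k m] by auto

lemma from_others: "X \<in> others m k \<rightarrow>\<^sub>M N \<Longrightarrow> X \<in> M \<rightarrow>\<^sub>M N"
  by (rule measurable_from_subalg[OF subalgebra_others])

lemma x_measurable: "i < n \<Longrightarrow> x i k \<in> M \<rightarrow>\<^sub>M RV p"
  by (rule from_others[OF x_measurable_others])

lemma x_Rp: "\<omega> \<in> space M \<Longrightarrow> i < n \<Longrightarrow> x i k \<omega> \<in> Rp p"
  using measurable_space[OF x_measurable] by (simp add: space_RV)

lemma gr_measurable: "i < n \<Longrightarrow> gr i k \<in> M \<rightarrow>\<^sub>M RV p"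
  by (intro gr_measurable_of x_measurable u_meas \<xi>_meas)

lemma gr_measurable_others: "i < n \<Longrightarrow> i \<noteq> m \<Longrightarrow> gr i k \<in> others m k \<rightarrow>\<^sub>M RV p"
  by (intro gr_measurable_of x_measurable_others others_measurable) auto

lemma xbar_Rp [simp]: "xbar k \<omega> \<in> Rp p"
  by (simp add: xbar_def)

lemma xbar_apply: "j < p \<Longrightarrow> xbar k \<omega> j = (\<Sum>i<n. x i k \<omega> j) / real n"
  by (simp add: xbar_def agent_mean_apply)

lemma xbar_measurable_others: "xbar k \<in> others m k \<rightarrow>\<^sub>M RV p"
  unfolding xbar_def[abs_def] agent_mean_def
  by (intro measurable_restrict borel_measurable_divide borel_measurable_sum
      RV_component[OF x_measurable_others]) auto

lemma l2v_mg:
  assumes i: "i < n" and Y: "Y \<in> M \<rightarrow>\<^sub>M RV p" "l2v p Y"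
  shows "l2v p (\<lambda>\<omega>. mg i (Y \<omega>))"
proof -
  let ?z = "\<lambda>j\<in>{..<p}. 0 :: real"
  let ?d = "\<lambda>\<omega> j. Y \<omega> j - ?z j"
  have "integrable M (\<lambda>\<omega>. ip p (?d \<omega>) (?d \<omega>))"
    by (intro l2v_ip_integrable l2v_diff Y l2v_const)
  then have "integrable M (\<lambda>\<omega>. 2 * Lf\<^sup>2 * ip p (?d \<omega>) (?d \<omega>) + 2 * ip p (mg i ?z) (mg i ?z))"
    by (intro Bochner_Integration.integrable_add integrable_mult_right) auto
  then show ?thesis
  proof (rule l2v_dominated[OF measurable_compose[OF Y(1) mg_measurable[OF i]]])
    fix \<omega> assume "\<omega> \<in> space M"
    then have "Y \<omega> \<in> Rp p" using measurable_space[OF Y(1)] by (simp add: space_RV)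
    then show "ip p (mg i (Y \<omega>)) (mg i (Y \<omega>)) \<le> 2 * Lf\<^sup>2 * ip p (?d \<omega>) (?d \<omega>) + 2 * ip p (mg i ?z) (mg i ?z)"
      unfolding mg_def by (intro smooth_fun_grad_growth[OF fi_smooth[OF i]]) auto
  qed
qed

lemma gr_nn_moment:
  assumes i: "i < n"
  shows "(\<integral>\<^sup>+\<omega>. ennreal (ip p (gr i k \<omega>) (gr i k \<omega>)) \<partial>M)
    \<le> (\<integral>\<^sup>+\<omega>. ennreal (2 * (real p)\<^sup>2 * Lf\<^sup>2 * (\<delta> i k)\<^sup>2
      + 4 * real p * ((1 + \<sigma>\<^sub>0\<^sup>2) * ip p (mg i (x i k \<omega>)) (mg i (x i k \<omega>)) + \<sigma>\<^sub>1\<^sup>2)) \<partial>M)"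
proof -
  interpret g: gradient_estimator "D i" p "F i" Lf \<sigma>\<^sub>0 \<sigma>\<^sub>1 "\<delta> i k" by (rule ge[OF i])
  let ?e = "\<lambda>a. grad_est p (F i) (\<delta> i k) (x i k (fst a)) (fst (snd a)) (snd (snd a))"
  let ?H = "others i k \<Otimes>\<^sub>M (RV p \<Otimes>\<^sub>M D i)"
  have e: "?e \<in> ?H \<rightarrow>\<^sub>M RV p"
    by (rule g.grad_est_measurable) (auto intro: measurable_compose[OF measurable_fst x_measurable_others[OF i]])
  have "(\<lambda>a. ennreal (ip p (?e a) (?e a))) \<in> borel_measurable ?H"
    using ip_measurable[OF e e] by measurable
  from nn_integral_sample[OF i this]
  have "(\<integral>\<^sup>+\<omega>. ennreal (ip p (gr i k \<omega>) (gr i k \<omega>)) \<partial>M)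
      = (\<integral>\<^sup>+\<omega>. (\<integral>\<^sup>+q. ennreal (ip p (grad_est p (F i) (\<delta> i k) (x i k \<omega>) (fst q) (snd q))
          (grad_est p (F i) (\<delta> i k) (x i k \<omega>) (fst q) (snd q))) \<partial>sample_law i) \<partial>M)"
    by (simp add: gr_def)
  also have "\<dots> \<le> (\<integral>\<^sup>+\<omega>. ennreal (g.second_moment_bound (x i k \<omega>)) \<partial>M)"
    using g.est_second_moment x_Rp[OF _ i] by (intro nn_integral_mono) (simp add: case_prod_beta')
  also have "\<dots> = (\<integral>\<^sup>+\<omega>. ennreal (2 * (real p)\<^sup>2 * Lf\<^sup>2 * (\<delta> i k)\<^sup>2
      + 4 * real p * ((1 + \<sigma>\<^sub>0\<^sup>2) * ip p (mg i (x i k \<omega>)) (mg i (x i k \<omega>)) + \<sigma>\<^sub>1\<^sup>2)) \<partial>M)"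
    using x_Rp[OF _ i] by (intro nn_integral_cong) (simp add: g.second_moment_bound_def mg_eq[OF i])
  finally show ?thesis .
qed

text \<open>The nonnegative integral first shows that the second moment is finite; only then can it
  be read as an ordinary expectation.\<close>

lemma gr_moment:
  assumes i: "i < n" and X: "l2v p (x i k)"
  shows "l2v p (gr i k)"
    and "(\<integral>\<omega>. ip p (gr i k \<omega>) (gr i k \<omega>) \<partial>M) \<le> 2 * (real p)\<^sup>2 * Lf\<^sup>2 * (\<delta> i k)\<^sup>2
      + 4 * real p * ((1 + \<sigma>\<^sub>0\<^sup>2) * (\<integral>\<omega>. ip p (mg i (x i k \<omega>)) (mg i (x i k \<omega>)) \<partial>M) + \<sigma>\<^sub>1\<^sup>2)"
proof -
  let ?B = "\<lambda>\<omega>. 2 * (real p)\<^sup>2 * Lf\<^sup>2 * (\<delta> i k)\<^sup>2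
      + 4 * real p * ((1 + \<sigma>\<^sub>0\<^sup>2) * ip p (mg i (x i k \<omega>)) (mg i (x i k \<omega>)) + \<sigma>\<^sub>1\<^sup>2)"
  have m: "integrable M (\<lambda>\<omega>. ip p (mg i (x i k \<omega>)) (mg i (x i k \<omega>)))"
    by (intro l2v_ip_integrable l2v_mg[OF i x_measurable[OF i] X])
  then have B: "integrable M ?B" by auto
  have nn: "(\<integral>\<^sup>+\<omega>. ennreal (?B \<omega>) \<partial>M) = ennreal (\<integral>\<omega>. ?B \<omega> \<partial>M)"
    by (rule nn_integral_eq_integral[OF B]) auto
  have "(\<integral>\<^sup>+\<omega>. ennreal (ip p (gr i k \<omega>) (gr i k \<omega>)) \<partial>M) < \<infinity>"
    using gr_nn_moment[OF i, of k] unfolding nn by (rule le_less_trans) simp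
  then show l2: "l2v p (gr i k)" by (rule l2v_dominated_nn[OF gr_measurable[OF i]])
  have "ennreal (\<integral>\<omega>. ip p (gr i k \<omega>) (gr i k \<omega>) \<partial>M) = (\<integral>\<^sup>+\<omega>. ennreal (ip p (gr i k \<omega>) (gr i k \<omega>)) \<partial>M)"
    using l2v_ip_integrable[OF l2 l2] by (intro nn_integral_eq_integral[symmetric]) auto
  also have "\<dots> \<le> ennreal (\<integral>\<omega>. ?B \<omega> \<partial>M)" using gr_nn_moment[OF i, of k] unfolding nn .
  finally have "(\<integral>\<omega>. ip p (gr i k \<omega>) (gr i k \<omega>) \<partial>M) \<le> (\<integral>\<omega>. ?B \<omega> \<partial>M)"
    by (subst (asm) ennreal_le_iff) (auto intro!: integral_nonneg_AE)
  also have "(\<integral>\<omega>. ?B \<omega> \<partial>M) = 2 * (real p)\<^sup>2 * Lf\<^sup>2 * (\<delta> i k)\<^sup>2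
      + 4 * real p * ((1 + \<sigma>\<^sub>0\<^sup>2) * (\<integral>\<omega>. ip p (mg i (x i k \<omega>)) (mg i (x i k \<omega>)) \<partial>M) + \<sigma>\<^sub>1\<^sup>2)"
    using m by (simp add: prob_space)
  finally show "(\<integral>\<omega>. ip p (gr i k \<omega>) (gr i k \<omega>) \<partial>M) \<le> 2 * (real p)\<^sup>2 * Lf\<^sup>2 * (\<delta> i k)\<^sup>2
      + 4 * real p * ((1 + \<sigma>\<^sub>0\<^sup>2) * (\<integral>\<omega>. ip p (mg i (x i k \<omega>)) (mg i (x i k \<omega>)) \<partial>M) + \<sigma>\<^sub>1\<^sup>2)" .
qed

text \<open>Square integrability of the estimate at time k rests on that of the iterate, so both
  propagate in one induction.\<close>

lemma iterates_l2: "\<forall>i<n. l2v p (x i k) \<and> l2v p (v i k)"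
proof (induction k)
  case 0
  have "l2v p (x i 0)" "l2v p (v i 0)" if "i < n" for i
    using l2_cong[of "\<lambda>\<omega>. x i 0 \<omega> _" "\<lambda>_. x0 i _"] l2_cong[of "\<lambda>\<omega>. v i 0 \<omega> _" "\<lambda>_. 0"] that
    by (auto simp: l2v_def x_0 v_0 l2_const)
  then show ?case by blast
next
  case (Suc k)
  then have X: "l2 (\<lambda>\<omega>. x i k \<omega> j)" and V: "l2 (\<lambda>\<omega>. v i k \<omega> j)" if "i < n" "j < p" for i j
    using that by (auto simp: l2v_def)
  have G: "l2 (\<lambda>\<omega>. gr i k \<omega> j)" if "i < n" "j < p" for i j
    using Suc gr_moment(1)[of i k] that by (auto simp: l2v_def)
  have lapl: "l2 (\<lambda>\<omega>. lap n a (\<lambda>l. x l k \<omega> j) i)" if "i < n" "j < p" for i j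
    unfolding lap_def using that by (intro l2_sum l2_scale l2_diff X) auto
  have "l2 (\<lambda>\<omega>. x i (Suc k) \<omega> j)" if ij: "i < n" "j < p" for i j
  proof -
    have "l2 (\<lambda>\<omega>. x i k \<omega> j - (\<kappa>\<^sub>1 * \<kappa>\<^sub>2 * lap n a (\<lambda>l. x l k \<omega> j) i + \<kappa>\<^sub>2 * v i k \<omega> j + \<eta> k * gr i k \<omega> j))"
      by (intro l2_diff l2_add l2_scale lapl X V G ij)
    then show ?thesis by (subst l2_cong) (simp_all add: x_Suc ij)
  qed
  moreover have "l2 (\<lambda>\<omega>. v i (Suc k) \<omega> j)" if ij: "i < n" "j < p" for i j
  proof -
    have "l2 (\<lambda>\<omega>. v i k \<omega> j + \<kappa>\<^sub>2 * lap n a (\<lambda>l. x l k \<omega> j) i)"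
      by (intro l2_add l2_scale lapl V ij)
    then show ?thesis by (subst l2_cong) (simp_all add: v_Suc ij)
  qed
  ultimately show ?case by (auto simp: l2v_def)
qed

lemma x_l2: "i < n \<Longrightarrow> l2v p (x i k)"
  using iterates_l2 by blast

lemma gr_l2: "i < n \<Longrightarrow> l2v p (gr i k)"
  by (intro gr_moment x_l2)

lemma xbar_l2: "l2v p (xbar k)"
  unfolding l2v_def
proof (intro allI impI)
  fix j assume j: "j < p"
  have "l2 (\<lambda>\<omega>. (1 / real n) * (\<Sum>i<n. x i k \<omega> j))"
    using x_l2 j by (intro l2_scale l2_sum) (auto simp: l2v_def)
  then show "l2 (\<lambda>\<omega>. xbar k \<omega> j)" using j by (simp add: xbar_apply)
qed

lemma em_l2:
  assumes i: "i < n"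
  shows "l2v p (\<lambda>\<omega>. em i k (x i k \<omega>))"
proof -
  let ?m = "\<lambda>\<omega>. mg i (x i k \<omega>)"
  have "integrable M (\<lambda>\<omega>. 2 * (Lf\<^sup>2 * (\<delta> i k)\<^sup>2) + 2 * ip p (?m \<omega>) (?m \<omega>))"
    using l2v_ip_integrable[OF l2v_mg[OF i x_measurable[OF i] x_l2[OF i]] l2v_mg[OF i x_measurable[OF i] x_l2[OF i]]]
    by auto
  then show ?thesis
  proof (rule l2v_dominated[OF measurable_compose[OF x_measurable[OF i] em_measurable[OF i]]])
    fix \<omega> assume "\<omega> \<in> space M"
    then have xr: "x i k \<omega> \<in> Rp p" using x_Rp i by blast
    have "ip p (em i k (x i k \<omega>)) (em i k (x i k \<omega>))
        \<le> 2 * ip p (\<lambda>j. em i k (x i k \<omega>) j - ?m \<omega> j) (\<lambda>j. em i k (x i k \<omega>) j - ?m \<omega> j)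
          + 2 * ip p (?m \<omega>) (?m \<omega>)"
      using ip_sum_le[of p "\<lambda>j. em i k (x i k \<omega>) j - ?m \<omega> j" "?m \<omega>"] by simp
    then show "ip p (em i k (x i k \<omega>)) (em i k (x i k \<omega>)) \<le> 2 * (Lf\<^sup>2 * (\<delta> i k)\<^sup>2) + 2 * ip p (?m \<omega>) (?m \<omega>)"
      using em_bias[OF i xr, of k] by linarith
  qed
qed

text \<open>The tower property. Y may involve samples of other agents at the same time k, since
  \<open>others\<close> omits only those of agent i.\<close>

lemma gr_cond:
  assumes i: "i < n" and Y: "Y \<in> others i k \<rightarrow>\<^sub>M RV p" "l2v p Y"
  shows "(\<integral>\<omega>. ip p (gr i k \<omega>) (Y \<omega>) \<partial>M) = (\<integral>\<omega>. ip p (em i k (x i k \<omega>)) (Y \<omega>) \<partial>M)"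
proof -
  interpret g: gradient_estimator "D i" p "F i" Lf \<sigma>\<^sub>0 \<sigma>\<^sub>1 "\<delta> i k" by (rule ge[OF i])
  let ?e = "\<lambda>a. grad_est p (F i) (\<delta> i k) (x i k (fst a)) (fst (snd a)) (snd (snd a))"
  let ?H = "others i k \<Otimes>\<^sub>M (RV p \<Otimes>\<^sub>M D i)"
  have e: "?e \<in> ?H \<rightarrow>\<^sub>M RV p"
    by (rule g.grad_est_measurable) (auto intro: measurable_compose[OF measurable_fst x_measurable_others[OF i]])
  have y: "(\<lambda>a. Y (fst a)) \<in> ?H \<rightarrow>\<^sub>M RV p" by (rule measurable_compose[OF measurable_fst Y(1)])
  have "integrable M (\<lambda>\<omega>. ip p (?e (\<omega>, (u i k \<omega>, \<xi> i k \<omega>))) (Y (fst (\<omega>, (u i k \<omega>, \<xi> i k \<omega>)))))"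
    using l2v_ip_integrable[OF gr_l2[OF i] Y(2), of k] by (simp add: gr_def)
  from integral_sample[OF i ip_measurable[OF e y] this]
  have "(\<integral>\<omega>. ip p (gr i k \<omega>) (Y \<omega>) \<partial>M)
      = (\<integral>\<omega>. (\<integral>q. ip p (grad_est p (F i) (\<delta> i k) (x i k \<omega>) (fst q) (snd q)) (Y \<omega>) \<partial>sample_law i) \<partial>M)"
    by (simp add: gr_def)
  also have "\<dots> = (\<integral>\<omega>. ip p (em i k (x i k \<omega>)) (Y \<omega>) \<partial>M)"
    using g.ip_est_mean x_Rp[OF _ i]
    by (intro Bochner_Integration.integral_cong refl) (simp add: em_def case_prod_beta')
  finally show ?thesis .
qed

text \<open>\<open>gr_cond\<close> is used twice: first the current estimate of the other agent is
  frozen, then the conditional mean just obtained.\<close>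

lemma gr_cross:
  assumes "i < n" "l < n" "i \<noteq> l"
  shows "(\<integral>\<omega>. ip p (gr i k \<omega>) (gr l k \<omega>) \<partial>M) = (\<integral>\<omega>. ip p (em i k (x i k \<omega>)) (em l k (x l k \<omega>)) \<partial>M)"
proof -
  have "(\<integral>\<omega>. ip p (gr i k \<omega>) (gr l k \<omega>) \<partial>M) = (\<integral>\<omega>. ip p (em i k (x i k \<omega>)) (gr l k \<omega>) \<partial>M)"
    using assms by (intro gr_cond gr_measurable_others gr_l2) auto
  also have "\<dots> = (\<integral>\<omega>. ip p (gr l k \<omega>) (em i k (x i k \<omega>)) \<partial>M)" by (simp only: ip_commute)
  also have "\<dots> = (\<integral>\<omega>. ip p (em l k (x l k \<omega>)) (em i k (x i k \<omega>)) \<partial>M)"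
    using assms by (intro gr_cond measurable_compose[OF x_measurable_others em_measurable] em_l2) auto
  finally show ?thesis by (simp only: ip_commute)
qed

end

section \<open>Disagreement, dual variable and energy\<close>

lemma sum_deviation_le:
  fixes y :: "nat \<Rightarrow> real"
  shows "(\<Sum>i<n. (y i - (\<Sum>l<n. y l) / real n)\<^sup>2) \<le> (\<Sum>i<n. (y i)\<^sup>2)"
proof (cases "n = 0")
  case False
  let ?m = "(\<Sum>l<n. y l) / real n"
  have "(\<Sum>i<n. (y i - ?m)\<^sup>2) = (\<Sum>i<n. (y i)\<^sup>2 - 2 * ?m * y i + ?m\<^sup>2)"
    by (intro sum.cong) (auto simp: power2_diff)
  also have "\<dots> = (\<Sum>i<n. (y i)\<^sup>2) - 2 * ?m * (\<Sum>i<n. y i) + real n * ?m\<^sup>2"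
    by (simp add: sum.distrib sum_subtractf sum_distrib_left)
  also have "\<dots> = (\<Sum>i<n. (y i)\<^sup>2) - real n * ?m\<^sup>2"
    using False by (simp add: power2_eq_square)
  finally show ?thesis by simp
qed simp

context zo_primal_dual
begin

text \<open>The coordinate j comes before the agent i, so that for fixed j the value is a vector
  over the agents on which \<open>lap\<close> and \<open>lyap\<close> act.\<close>

definition dev :: "nat \<Rightarrow> 'w \<Rightarrow> nat \<Rightarrow> nat \<Rightarrow> real" where
  "dev k \<omega> j i = x i k \<omega> j - xbar k \<omega> j"

text \<open>The preimage w of the dual variable under \<open>lap\<close>. It starts at zero because
  v does, and its sum over the agents stays zero, as coercivity requires.\<close>

primrec dual :: "nat \<Rightarrow> 'w \<Rightarrow> nat \<Rightarrow> nat \<Rightarrow> real" where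
  "dual 0 \<omega> j i = 0"
| "dual (Suc k) \<omega> j i = dual k \<omega> j i + \<kappa>\<^sub>2 * dev k \<omega> j i"

lemma sum_dev: "j < p \<Longrightarrow> (\<Sum>i<n. dev k \<omega> j i) = 0"
  using n1 by (simp add: dev_def sum_subtractf xbar_apply)

lemma sum_dual: "j < p \<Longrightarrow> (\<Sum>i<n. dual k \<omega> j i) = 0"
  by (induction k) (simp_all add: sum.distrib sum_distrib_left[symmetric] sum_dev)

lemma lap_dev: "lap n a (\<lambda>i. x i k \<omega> j) i = lap n a (dev k \<omega> j) i"
  by (simp add: lap_def dev_def)

lemma v_dual: "\<omega> \<in> space M \<Longrightarrow> i < n \<Longrightarrow> j < p \<Longrightarrow> v i k \<omega> j = lap n a (dual k \<omega> j) i"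
proof (induction k)
  case 0
  have "dual 0 \<omega> j = (\<lambda>_. 0)" by (rule ext) simp
  then show ?case using 0 by (simp add: v_0 lap_const)
next
  case (Suc k)
  have "dual (Suc k) \<omega> j = (\<lambda>i. dual k \<omega> j i + \<kappa>\<^sub>2 * dev k \<omega> j i)" by (rule ext) simp
  then show ?case using Suc by (simp add: v_Suc lap_dev lap_add lap_scale)
qed

text \<open>Both coupling terms lie in the range of \<open>lap\<close>, whose entries sum to zero
  over the agents, so the mean sees only the estimates.\<close>

lemma xbar_Suc:
  assumes w: "\<omega> \<in> space M" and j: "j < p"
  shows "xbar (Suc k) \<omega> j = xbar k \<omega> j - \<eta> k * ((\<Sum>i<n. gr i k \<omega> j) / real n)"
proof -
  have "(\<Sum>i<n. x i (Suc k) \<omega> j) = (\<Sum>i<n. x i k \<omega> j - (\<kappa>\<^sub>1 * \<kappa>\<^sub>2 * lap n a (dev k \<omega> j) i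
      + \<kappa>\<^sub>2 * lap n a (dual k \<omega> j) i + \<eta> k * gr i k \<omega> j))"
    using w j by (intro sum.cong refl) (simp add: x_Suc v_dual lap_dev)
  also have "\<dots> = (\<Sum>i<n. x i k \<omega> j) - (\<kappa>\<^sub>1 * \<kappa>\<^sub>2 * (\<Sum>i<n. lap n a (dev k \<omega> j) i)
      + \<kappa>\<^sub>2 * (\<Sum>i<n. lap n a (dual k \<omega> j) i) + \<eta> k * (\<Sum>i<n. gr i k \<omega> j))"
    by (simp add: sum_subtractf sum.distrib sum_distrib_left)
  also have "\<dots> = (\<Sum>i<n. x i k \<omega> j) - \<eta> k * (\<Sum>i<n. gr i k \<omega> j)"
    by (simp add: sum_lap[OF net])
  finally show ?thesis using j by (simp add: xbar_apply diff_divide_distrib)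
qed

definition gdev :: "nat \<Rightarrow> 'w \<Rightarrow> nat \<Rightarrow> nat \<Rightarrow> real" where
  "gdev k \<omega> j i = gr i k \<omega> j - (\<Sum>l<n. gr l k \<omega> j) / real n"

lemma dev_Suc:
  assumes "\<omega> \<in> space M" "i < n" "j < p"
  shows "dev (Suc k) \<omega> j i = dev k \<omega> j i - \<kappa>\<^sub>1 * \<kappa>\<^sub>2 * lap n a (dev k \<omega> j) i
    - \<kappa>\<^sub>2 * lap n a (dual k \<omega> j) i + (- \<eta> k) * gdev k \<omega> j i"
  using assms by (simp add: dev_def[of "Suc k"] dev_def[of k \<omega> j i] x_Suc v_dual lap_dev xbar_Suc gdev_def algebra_simps)

text \<open>The linear dynamics does not mix the coordinates of \<open>Rp p\<close>, so the Lyapunov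
  function is summed over them.\<close>

definition energy :: "nat \<Rightarrow> 'w \<Rightarrow> real" where
  "energy k \<omega> = (\<Sum>j<p. lyap n a \<kappa>\<^sub>2 (dev k \<omega> j) (dual k \<omega> j))"

definition cons :: "nat \<Rightarrow> 'w \<Rightarrow> real" where
  "cons k \<omega> = consensus_error n p (\<lambda>i. x i k \<omega>)"

lemma cons_dev: "cons k \<omega> = (\<Sum>j<p. ip n (dev k \<omega> j) (dev k \<omega> j)) / real n"
proof -
  have "cons k \<omega> = (\<Sum>i<n. \<Sum>j<p. dev k \<omega> j i * dev k \<omega> j i) / real n"
    unfolding cons_def consensus_error_ip by (simp add: dev_def ip_def xbar_def[symmetric])
  then show ?thesis by (simp add: ip_def sum.swap[of _ "{..<n}"])
qed

lemma cons_ip: "cons k \<omega> = (\<Sum>i<n. ip p (\<lambda>j. x i k \<omega> j - xbar k \<omega> j) (\<lambda>j. x i k \<omega> j - xbar k \<omega> j)) / real n"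
  by (simp add: cons_def consensus_error_ip xbar_def)

lemma cons_nonneg: "0 \<le> cons k \<omega>"
  unfolding cons_dev by (intro divide_nonneg_nonneg sum_nonneg) auto

lemma cons_0:
  assumes w: "\<omega> \<in> space M"
  shows "cons 0 \<omega> = consensus_error n p x0"
proof -
  have "(\<Sum>i<n. x i 0 \<omega> j) = (\<Sum>i<n. x0 i j)" for j
    using x_0[OF w] by (intro sum.cong) auto
  then have m: "agent_mean n p (\<lambda>i. x i 0 \<omega>) = agent_mean n p x0" by (simp add: agent_mean_def)
  have "(\<Sum>i<n. (nrm p (\<lambda>j. x i 0 \<omega> j - agent_mean n p x0 j))\<^sup>2)
      = (\<Sum>i<n. (nrm p (\<lambda>j. x0 i j - agent_mean n p x0 j))\<^sup>2)"
    using x_0[OF w] by (intro sum.cong) auto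
  then show ?thesis by (simp only: cons_def consensus_error_def m)
qed

lemma energy_0: "\<omega> \<in> space M \<Longrightarrow> energy 0 \<omega> = real n * consensus_error n p x0"
proof -
  assume w: "\<omega> \<in> space M"
  have d: "dual 0 \<omega> j = (\<lambda>_. 0)" for j by (rule ext) simp
  have "lap n a (\<lambda>_. 0) = (\<lambda>_. 0)" by (rule ext) (rule lap_const)
  then have "energy 0 \<omega> = (\<Sum>j<p. ip n (dev 0 \<omega> j) (dev 0 \<omega> j))"
    unfolding energy_def lyap_def d by (simp add: ip_def)
  then have "energy 0 \<omega> = real n * cons 0 \<omega>" using n1 by (simp add: cons_dev)
  then show ?thesis by (simp add: cons_0 w)
qed

lemma dev_l2: "i < n \<Longrightarrow> j < p \<Longrightarrow> l2 (\<lambda>\<omega>. dev k \<omega> j i)"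
  using x_l2 xbar_l2 unfolding dev_def l2v_def by (intro l2_diff) auto

lemma dual_l2:
  assumes "i < n" "j < p"
  shows "l2 (\<lambda>\<omega>. dual k \<omega> j i)"
proof (induction k)
  case (Suc k)
  from l2_add[OF this l2_scale[OF dev_l2[OF assms]]] show ?case by simp
qed (simp add: l2_const)

lemma energy_integrable: "integrable M (energy k)"
proof -
  have "l2 (\<lambda>\<omega>. lap n a (dual k \<omega> j) i)" if "i < n" "j < p" for i j
    unfolding lap_def using that by (intro l2_sum l2_scale l2_diff dual_l2) auto
  then show ?thesis
    unfolding energy_def[abs_def] lyap_def ip_def
    by (intro Bochner_Integration.integrable_sum Bochner_Integration.integrable_add integrable_mult_right
        l2_mult_integrable dev_l2 dual_l2) auto
qed

lemma cons_integrable: "integrable M (cons k)"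
proof -
  have "integrable M (\<lambda>\<omega>. (\<Sum>j<p. ip n (dev k \<omega> j) (dev k \<omega> j)) / real n)"
    unfolding ip_def
    by (intro integrable_divide Bochner_Integration.integrable_sum l2_mult_integrable dev_l2) auto
  then show ?thesis unfolding cons_dev[abs_def] .
qed

definition gvar :: "nat \<Rightarrow> real" where
  "gvar k = (\<Sum>i<n. (\<integral>\<omega>. ip p (gr i k \<omega>) (gr i k \<omega>) \<partial>M)) / real n"

text \<open>The contraction is applied pathwise in each coordinate, with -\<eta> times the centred
  estimates as perturbation. Centring only lowers the sum of squares, so raw second moments
  suffice.\<close>

lemma energy_step:
  assumes c: "c < 1" and K: "0 \<le> K"
    and contr: "\<And>x w d. (\<Sum>i<n. x i) = 0 \<Longrightarrow> (\<Sum>i<n. w i) = 0 \<Longrightarrow>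
      lyap n a \<kappa>\<^sub>2 (\<lambda>i. x i - \<kappa>\<^sub>1 * \<kappa>\<^sub>2 * lap n a x i - \<kappa>\<^sub>2 * lap n a w i + d i) (\<lambda>i. w i + \<kappa>\<^sub>2 * x i)
        \<le> (1 - c) * lyap n a \<kappa>\<^sub>2 x w + K * ip n d d"
  shows "(\<integral>\<omega>. energy (Suc k) \<omega> \<partial>M) \<le> (1 - c) * (\<integral>\<omega>. energy k \<omega> \<partial>M) + K * (\<eta> k)\<^sup>2 * (real n * gvar k)"
proof -
  have path: "energy (Suc k) \<omega> \<le> (1 - c) * energy k \<omega> + K * (\<eta> k)\<^sup>2 * (\<Sum>i<n. ip p (gr i k \<omega>) (gr i k \<omega>))"
    if w: "\<omega> \<in> space M" for \<omega>
  proof -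
    have "energy (Suc k) \<omega> \<le> (\<Sum>j<p. (1 - c) * lyap n a \<kappa>\<^sub>2 (dev k \<omega> j) (dual k \<omega> j)
        + K * (\<eta> k)\<^sup>2 * (\<Sum>i<n. (gr i k \<omega> j)\<^sup>2))"
      unfolding energy_def
    proof (rule sum_mono)
      fix j assume "j \<in> {..<p}"
      then have j: "j < p" by simp
      let ?d = "\<lambda>i. (- \<eta> k) * gdev k \<omega> j i"
      let ?y = "\<lambda>i. dev k \<omega> j i - \<kappa>\<^sub>1 * \<kappa>\<^sub>2 * lap n a (dev k \<omega> j) i - \<kappa>\<^sub>2 * lap n a (dual k \<omega> j) i + ?d i"
      have y: "dev (Suc k) \<omega> j i = ?y i" if "i < n" for i using dev_Suc[OF w that j] .
      have dual: "dual (Suc k) \<omega> j = (\<lambda>i. dual k \<omega> j i + \<kappa>\<^sub>2 * dev k \<omega> j i)" by (rule ext) simp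
      have "lyap n a \<kappa>\<^sub>2 (dev (Suc k) \<omega> j) (dual (Suc k) \<omega> j) = lyap n a \<kappa>\<^sub>2 ?y (dual (Suc k) \<omega> j)"
        unfolding lyap_def using ip_cong[of n "dev (Suc k) \<omega> j" ?y "dev (Suc k) \<omega> j" ?y]
          ip_cong[of n "dev (Suc k) \<omega> j" ?y "lap n a (dual (Suc k) \<omega> j)" "lap n a (dual (Suc k) \<omega> j)"] y
        by (simp only:)
      also have "\<dots> \<le> (1 - c) * lyap n a \<kappa>\<^sub>2 (dev k \<omega> j) (dual k \<omega> j) + K * ip n ?d ?d"
        unfolding dual by (rule contr) (simp_all add: sum_dev sum_dual j)
      also have "ip n ?d ?d = (\<eta> k)\<^sup>2 * (\<Sum>i<n. (gdev k \<omega> j i)\<^sup>2)"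
        by (simp add: ip_self power_mult_distrib sum_distrib_left)
      also have "K * ((\<eta> k)\<^sup>2 * (\<Sum>i<n. (gdev k \<omega> j i)\<^sup>2)) \<le> K * ((\<eta> k)\<^sup>2 * (\<Sum>i<n. (gr i k \<omega> j)\<^sup>2))"
        unfolding gdev_def using K by (intro mult_left_mono sum_deviation_le) auto
      finally show "lyap n a \<kappa>\<^sub>2 (dev (Suc k) \<omega> j) (dual (Suc k) \<omega> j)
          \<le> (1 - c) * lyap n a \<kappa>\<^sub>2 (dev k \<omega> j) (dual k \<omega> j) + K * (\<eta> k)\<^sup>2 * (\<Sum>i<n. (gr i k \<omega> j)\<^sup>2)"
        by (simp only: mult.assoc)
    qed
    also have "\<dots> = (1 - c) * energy k \<omega> + K * (\<eta> k)\<^sup>2 * (\<Sum>j<p. \<Sum>i<n. (gr i k \<omega> j)\<^sup>2)"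
      by (simp add: energy_def sum.distrib sum_distrib_left)
    also have "(\<Sum>j<p. \<Sum>i<n. (gr i k \<omega> j)\<^sup>2) = (\<Sum>i<n. ip p (gr i k \<omega>) (gr i k \<omega>))"
      unfolding ip_self by (rule sum.swap)
    finally show ?thesis .
  qed
  have gi: "integrable M (\<lambda>\<omega>. ip p (gr i k \<omega>) (gr i k \<omega>))" if "i < n" for i
    using that by (intro l2v_ip_integrable gr_l2)
  have gs: "integrable M (\<lambda>\<omega>. \<Sum>i<n. ip p (gr i k \<omega>) (gr i k \<omega>))"
    using gi by (intro Bochner_Integration.integrable_sum) auto
  have "(\<integral>\<omega>. energy (Suc k) \<omega> \<partial>M)
      \<le> (\<integral>\<omega>. (1 - c) * energy k \<omega> + K * (\<eta> k)\<^sup>2 * (\<Sum>i<n. ip p (gr i k \<omega>) (gr i k \<omega>)) \<partial>M)"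
    using energy_integrable gs path by (intro integral_mono) auto
  also have "\<dots> = (1 - c) * (\<integral>\<omega>. energy k \<omega> \<partial>M) + K * (\<eta> k)\<^sup>2 * (\<integral>\<omega>. (\<Sum>i<n. ip p (gr i k \<omega>) (gr i k \<omega>)) \<partial>M)"
    using energy_integrable gs by simp
  also have "(\<integral>\<omega>. (\<Sum>i<n. ip p (gr i k \<omega>) (gr i k \<omega>)) \<partial>M) = real n * gvar k"
    using n1 gi by (simp add: gvar_def Bochner_Integration.integral_sum)
  finally show ?thesis .
qed

text \<open>Mean of the local infima, a lower bound for f; its distance to the infimum of f is the
  heterogeneity called \<open>gap\<close> in the theorem.\<close>

definition flow :: "real" where
  "flow = (\<Sum>i<n. infval p (fi i)) / real n"

text \<open>\<open>grad_sq_le\<close> for each agent bounds the local gradient by the local gap, and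
  the local gaps average to f - \<open>flow\<close>. Boundedness below of every local objective
  enters here.\<close>

lemma mg_xbar_le:
  "(\<Sum>i<n. ip p (mg i (xbar k \<omega>)) (mg i (xbar k \<omega>))) / real n \<le> 4 * Lf * (f (xbar k \<omega>) - flow)"
proof -
  have "(\<Sum>i<n. ip p (mg i (xbar k \<omega>)) (mg i (xbar k \<omega>)))
      \<le> (\<Sum>i<n. 4 * Lf * (fi i (xbar k \<omega>) - infval p (fi i)))"
    unfolding mg_def using Lf by (intro sum_mono grad_sq_le fi_smooth lb) auto
  then have "(\<Sum>i<n. ip p (mg i (xbar k \<omega>)) (mg i (xbar k \<omega>))) / real n
      \<le> (\<Sum>i<n. 4 * Lf * (fi i (xbar k \<omega>) - infval p (fi i))) / real n"
    by (intro divide_right_mono) auto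
  also have "\<dots> = 4 * Lf * (f (xbar k \<omega>) - flow)"
    by (simp add: global_obj_def flow_def sum_distrib_left[symmetric] sum_subtractf diff_divide_distrib[symmetric])
  finally show ?thesis .
qed

lemma mg_x_le:
  assumes w: "\<omega> \<in> space M"
  shows "(\<Sum>i<n. ip p (mg i (x i k \<omega>)) (mg i (x i k \<omega>))) / real n
    \<le> 8 * Lf * (f (xbar k \<omega>) - flow) + 2 * Lf\<^sup>2 * cons k \<omega>"
proof -
  have "(\<Sum>i<n. ip p (mg i (x i k \<omega>)) (mg i (x i k \<omega>)))
      \<le> (\<Sum>i<n. 2 * Lf\<^sup>2 * ip p (\<lambda>j. x i k \<omega> j - xbar k \<omega> j) (\<lambda>j. x i k \<omega> j - xbar k \<omega> j)
          + 2 * ip p (mg i (xbar k \<omega>)) (mg i (xbar k \<omega>)))"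
    unfolding mg_def by (intro sum_mono smooth_fun_grad_growth fi_smooth x_Rp w) auto
  then have "(\<Sum>i<n. ip p (mg i (x i k \<omega>)) (mg i (x i k \<omega>))) / real n
      \<le> (\<Sum>i<n. 2 * Lf\<^sup>2 * ip p (\<lambda>j. x i k \<omega> j - xbar k \<omega> j) (\<lambda>j. x i k \<omega> j - xbar k \<omega> j)
          + 2 * ip p (mg i (xbar k \<omega>)) (mg i (xbar k \<omega>))) / real n"
    by (intro divide_right_mono) auto
  also have "\<dots> = 2 * Lf\<^sup>2 * cons k \<omega> + 2 * ((\<Sum>i<n. ip p (mg i (xbar k \<omega>)) (mg i (xbar k \<omega>))) / real n)"
    by (simp add: cons_ip sum.distrib sum_distrib_left add_divide_distrib)
  also have "\<dots> \<le> 2 * Lf\<^sup>2 * cons k \<omega> + 2 * (4 * Lf * (f (xbar k \<omega>) - flow))"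
    by (intro add_left_mono mult_left_mono mg_xbar_le) auto
  finally show ?thesis by simp
qed

lemma f_xbar_integrable: "integrable M (\<lambda>\<omega>. f (xbar k \<omega>))"
proof -
  let ?z = "\<lambda>j\<in>{..<p}. 0 :: real"
  let ?C = "\<bar>f ?z\<bar> + ip p (grad p f ?z) (grad p f ?z)"
  let ?d = "\<lambda>\<omega> j. xbar k \<omega> j - ?z j"
  have "integrable M (\<lambda>\<omega>. ip p (?d \<omega>) (?d \<omega>))"
    by (intro l2v_ip_integrable l2v_diff xbar_l2 l2v_const)
  then have "integrable M (\<lambda>\<omega>. ?C + (Lf + 1) * ip p (?d \<omega>) (?d \<omega>))" by auto
  then show ?thesis
  proof (rule Bochner_Integration.integrable_bound)
    show "(\<lambda>\<omega>. f (xbar k \<omega>)) \<in> borel_measurable M"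
      by (rule measurable_compose[OF from_others[OF xbar_measurable_others] f_measurable])
    show "AE \<omega> in M. norm (f (xbar k \<omega>)) \<le> norm (?C + (Lf + 1) * ip p (?d \<omega>) (?d \<omega>))"
    proof (rule AE_I2)
      fix \<omega>
      have "\<bar>f (xbar k \<omega>)\<bar> \<le> ?C + (Lf + 1) * ip p (?d \<omega>) (?d \<omega>)"
        using Lf by (intro smooth_fun_growth[OF f_smooth]) auto
      then show "norm (f (xbar k \<omega>)) \<le> norm (?C + (Lf + 1) * ip p (?d \<omega>) (?d \<omega>))" by simp
    qed
  qed
qed

text \<open>Closes the recursion: the second moment of the estimates is bounded by the expected gap
  and the expected disagreement.\<close>

lemma gvar_le:
  assumes dm: "\<And>i. i < n \<Longrightarrow> (\<delta> i k)\<^sup>2 \<le> dm"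
  shows "gvar k \<le> 2 * (real p)\<^sup>2 * Lf\<^sup>2 * dm + 4 * real p * ((1 + \<sigma>\<^sub>0\<^sup>2) *
    (8 * Lf * ((\<integral>\<omega>. f (xbar k \<omega>) \<partial>M) - flow) + 2 * Lf\<^sup>2 * (\<integral>\<omega>. cons k \<omega> \<partial>M)) + \<sigma>\<^sub>1\<^sup>2)"
proof -
  let ?m = "\<lambda>i. (\<integral>\<omega>. ip p (mg i (x i k \<omega>)) (mg i (x i k \<omega>)) \<partial>M)"
  have mi: "integrable M (\<lambda>\<omega>. ip p (mg i (x i k \<omega>)) (mg i (x i k \<omega>)))" if "i < n" for i
    using that by (intro l2v_ip_integrable l2v_mg x_measurable x_l2)
  have "(\<Sum>i<n. (\<integral>\<omega>. ip p (gr i k \<omega>) (gr i k \<omega>) \<partial>M))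
      \<le> (\<Sum>i<n. 2 * (real p)\<^sup>2 * Lf\<^sup>2 * dm + 4 * real p * ((1 + \<sigma>\<^sub>0\<^sup>2) * ?m i + \<sigma>\<^sub>1\<^sup>2))"
  proof (rule sum_mono)
    fix i assume "i \<in> {..<n}"
    then have i: "i < n" by simp
    have "2 * (real p)\<^sup>2 * Lf\<^sup>2 * (\<delta> i k)\<^sup>2 \<le> 2 * (real p)\<^sup>2 * Lf\<^sup>2 * dm"
      using dm[OF i] by (intro mult_left_mono) auto
    then show "(\<integral>\<omega>. ip p (gr i k \<omega>) (gr i k \<omega>) \<partial>M)
        \<le> 2 * (real p)\<^sup>2 * Lf\<^sup>2 * dm + 4 * real p * ((1 + \<sigma>\<^sub>0\<^sup>2) * ?m i + \<sigma>\<^sub>1\<^sup>2)"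
      using gr_moment(2)[OF i x_l2[OF i], of k] by linarith
  qed
  also have "\<dots> = real n * (2 * (real p)\<^sup>2 * Lf\<^sup>2 * dm)
      + 4 * real p * ((1 + \<sigma>\<^sub>0\<^sup>2) * (\<Sum>i<n. ?m i) + real n * \<sigma>\<^sub>1\<^sup>2)"
    by (simp add: sum.distrib sum_distrib_left distrib_left)
  finally have "gvar k \<le> (real n * (2 * (real p)\<^sup>2 * Lf\<^sup>2 * dm)
      + 4 * real p * ((1 + \<sigma>\<^sub>0\<^sup>2) * (\<Sum>i<n. ?m i) + real n * \<sigma>\<^sub>1\<^sup>2)) / real n"
    unfolding gvar_def by (rule divide_right_mono) simp
  also have "\<dots> = 2 * (real p)\<^sup>2 * Lf\<^sup>2 * dm + 4 * real p * ((1 + \<sigma>\<^sub>0\<^sup>2) * ((\<Sum>i<n. ?m i) / real n) + \<sigma>\<^sub>1\<^sup>2)"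
    using n1 by (simp add: add_divide_distrib distrib_left)
  also have "\<dots> \<le> 2 * (real p)\<^sup>2 * Lf\<^sup>2 * dm + 4 * real p * ((1 + \<sigma>\<^sub>0\<^sup>2) *
    (8 * Lf * ((\<integral>\<omega>. f (xbar k \<omega>) \<partial>M) - flow) + 2 * Lf\<^sup>2 * (\<integral>\<omega>. cons k \<omega> \<partial>M)) + \<sigma>\<^sub>1\<^sup>2)"
  proof (intro add_left_mono mult_left_mono add_right_mono)
    have "(\<Sum>i<n. ?m i) / real n = (\<integral>\<omega>. (\<Sum>i<n. ip p (mg i (x i k \<omega>)) (mg i (x i k \<omega>))) / real n \<partial>M)"
      using mi by (simp add: Bochner_Integration.integral_sum)
    also have "\<dots> \<le> (\<integral>\<omega>. 8 * Lf * (f (xbar k \<omega>) - flow) + 2 * Lf\<^sup>2 * cons k \<omega> \<partial>M)"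
      using mi f_xbar_integrable cons_integrable mg_x_le
      by (intro integral_mono integrable_divide Bochner_Integration.integrable_sum) auto
    also have "\<dots> = 8 * Lf * ((\<integral>\<omega>. f (xbar k \<omega>) \<partial>M) - flow) + 2 * Lf\<^sup>2 * (\<integral>\<omega>. cons k \<omega> \<partial>M)"
      using f_xbar_integrable cons_integrable by (simp add: prob_space)
    finally show "(\<Sum>i<n. ?m i) / real n
      \<le> 8 * Lf * ((\<integral>\<omega>. f (xbar k \<omega>) \<partial>M) - flow) + 2 * Lf\<^sup>2 * (\<integral>\<omega>. cons k \<omega> \<partial>M)" .
  qed auto
  finally show ?thesis .
qed

section \<open>Descent of the objective at the mean\<close>

definition em_avg :: "nat \<Rightarrow> 'w \<Rightarrow> nat \<Rightarrow> real" where
  "em_avg k \<omega> = (\<lambda>j. (\<Sum>i<n. em i k (x i k \<omega>) j) / real n)"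

definition gr_avg :: "nat \<Rightarrow> 'w \<Rightarrow> nat \<Rightarrow> real" where
  "gr_avg k \<omega> = (\<lambda>j. (\<Sum>i<n. gr i k \<omega> j) / real n)"

definition fg :: "nat \<Rightarrow> 'w \<Rightarrow> nat \<Rightarrow> real" where
  "fg k \<omega> = grad p f (xbar k \<omega>)"

lemma fg_eq: "fg k \<omega> = (\<lambda>j\<in>{..<p}. (\<Sum>i<n. mg i (xbar k \<omega>) j) / real n)"
  unfolding fg_def by (rule grad_f) simp

lemma fg_measurable: "fg k \<in> others m k \<rightarrow>\<^sub>M RV p"
  unfolding fg_eq[abs_def]
  by (intro measurable_restrict borel_measurable_divide borel_measurable_sum
      RV_component[OF measurable_compose[OF xbar_measurable_others mg_measurable]]) auto

lemma l2v_avg: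
  assumes "\<And>i. i < n \<Longrightarrow> l2v p (X i)"
  shows "l2v p (\<lambda>\<omega> j. (\<Sum>i<n. X i \<omega> j) / real n)"
proof -
  have "l2 (\<lambda>\<omega>. (1 / real n) * (\<Sum>i<n. X i \<omega> j))" if "j < p" for j
    using assms that by (intro l2_scale l2_sum) (auto simp: l2v_def)
  then show ?thesis by (simp add: l2v_def)
qed

lemma fg_l2: "l2v p (fg k)"
proof -
  have "l2v p (\<lambda>\<omega> j. (\<Sum>i<n. mg i (xbar k \<omega>) j) / real n)"
    by (intro l2v_avg l2v_mg xbar_l2 from_others[OF xbar_measurable_others])
  then show ?thesis by (simp add: l2v_def fg_eq)
qed

text \<open>Two sources: local gradients are taken at the iterates and not at their mean, which
  costs the disagreement, and finite differences cost \<delta>^2.\<close>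

lemma bias_le:
  assumes w: "\<omega> \<in> space M" and dm: "\<And>i. i < n \<Longrightarrow> (\<delta> i k)\<^sup>2 \<le> dm"
  shows "ip p (\<lambda>j. fg k \<omega> j - em_avg k \<omega> j) (\<lambda>j. fg k \<omega> j - em_avg k \<omega> j)
    \<le> 2 * Lf\<^sup>2 * cons k \<omega> + 2 * Lf\<^sup>2 * dm"
proof -
  let ?X = "\<lambda>i j. mg i (xbar k \<omega>) j - em i k (x i k \<omega>) j"
  let ?d = "\<lambda>i j. x i k \<omega> j - xbar k \<omega> j"
  have "ip p (\<lambda>j. fg k \<omega> j - em_avg k \<omega> j) (\<lambda>j. fg k \<omega> j - em_avg k \<omega> j)
      = ip p (\<lambda>j. (\<Sum>i<n. ?X i j) / real n) (\<lambda>j. (\<Sum>i<n. ?X i j) / real n)"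
    by (rule ip_cong) (simp_all add: fg_eq em_avg_def sum_subtractf diff_divide_distrib)
  also have "\<dots> \<le> (\<Sum>i<n. ip p (?X i) (?X i)) / real n" by (rule ip_avg_Jensen[OF n1])
  also have "\<dots> \<le> (\<Sum>i<n. 2 * Lf\<^sup>2 * ip p (?d i) (?d i) + 2 * Lf\<^sup>2 * dm) / real n"
  proof (intro divide_right_mono sum_mono)
    fix i assume "i \<in> {..<n}"
    then have i: "i < n" by simp
    note xr = x_Rp[OF w i, of k]
    let ?a = "\<lambda>j. mg i (x i k \<omega>) j - mg i (xbar k \<omega>) j" and ?b = "\<lambda>j. em i k (x i k \<omega>) j - mg i (x i k \<omega>) j"
    have "ip p (?X i) (?X i) = ip p (\<lambda>j. ?a j + ?b j) (\<lambda>j. ?a j + ?b j)"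
      by (simp add: ip_def algebra_simps)
    also have "\<dots> \<le> 2 * ip p ?a ?a + 2 * ip p ?b ?b" by (rule ip_sum_le)
    also have "ip p ?a ?a \<le> Lf\<^sup>2 * ip p (?d i) (?d i)"
      unfolding mg_def by (rule smooth_fun_Lipschitz_sq[OF fi_smooth[OF i] xr xbar_Rp])
    also have "ip p ?b ?b \<le> Lf\<^sup>2 * dm"
      using em_bias[OF i xr, of k] mult_left_mono[OF dm[OF i], of "Lf\<^sup>2"] by simp
    finally show "ip p (?X i) (?X i) \<le> 2 * Lf\<^sup>2 * ip p (?d i) (?d i) + 2 * Lf\<^sup>2 * dm" by simp
  qed simp
  also have "\<dots> = 2 * Lf\<^sup>2 * cons k \<omega> + 2 * Lf\<^sup>2 * dm"
    using n1 by (simp add: cons_ip sum.distrib sum_distrib_left add_divide_distrib)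
  finally show ?thesis .
qed

lemma gr_avg_inner: "(\<integral>\<omega>. ip p (fg k \<omega>) (gr_avg k \<omega>) \<partial>M) = (\<integral>\<omega>. ip p (fg k \<omega>) (em_avg k \<omega>) \<partial>M)"
proof -
  have 1: "integrable M (\<lambda>\<omega>. ip p (fg k \<omega>) (gr i k \<omega>))" if "i < n" for i
    using that by (intro l2v_ip_integrable fg_l2 gr_l2)
  have 2: "integrable M (\<lambda>\<omega>. ip p (fg k \<omega>) (em i k (x i k \<omega>)))" if "i < n" for i
    using that by (intro l2v_ip_integrable fg_l2 em_l2)
  have "(\<integral>\<omega>. ip p (fg k \<omega>) (gr i k \<omega>) \<partial>M) = (\<integral>\<omega>. ip p (fg k \<omega>) (em i k (x i k \<omega>)) \<partial>M)" if "i < n" for i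
    using gr_cond[OF that fg_measurable fg_l2] by (simp add: ip_commute)
  then show ?thesis
    unfolding gr_avg_def em_avg_def ip_avg_right using 1 2 by (simp add: Bochner_Integration.integral_sum)
qed

lemma integral_double_avg:
  assumes h: "\<And>i l. i < n \<Longrightarrow> l < n \<Longrightarrow> integrable M (h i l)"
  shows "(\<integral>\<omega>. (\<Sum>i<n. (\<Sum>l<n. h i l \<omega>) / real n) / real n \<partial>M) = (\<Sum>i<n. (\<Sum>l<n. (\<integral>\<omega>. h i l \<omega> \<partial>M)) / real n) / real n"
proof -
  have "(\<integral>\<omega>. (\<Sum>i<n. (\<Sum>l<n. h i l \<omega>) / real n) \<partial>M) = (\<Sum>i<n. (\<integral>\<omega>. (\<Sum>l<n. h i l \<omega>) / real n \<partial>M))"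
    by (intro Bochner_Integration.integral_sum integrable_divide Bochner_Integration.integrable_sum h) auto
  also have "\<dots> = (\<Sum>i<n. (\<Sum>l<n. (\<integral>\<omega>. h i l \<omega> \<partial>M)) / real n)"
    using h by (intro sum.cong refl) (simp add: Bochner_Integration.integral_sum)
  finally show ?thesis by simp
qed

text \<open>Expanding the square of the average, cross terms equal products of conditional means.
  Only the n diagonal terms carry a variance, and the weight 1/n^2 leaves \<open>gvar\<close> /
  n.\<close>

lemma gr_avg_second:
  "(\<integral>\<omega>. ip p (gr_avg k \<omega>) (gr_avg k \<omega>) \<partial>M) \<le> (\<integral>\<omega>. ip p (em_avg k \<omega>) (em_avg k \<omega>) \<partial>M) + gvar k / real n"
proof -
  let ?g = "\<lambda>i l. (\<integral>\<omega>. ip p (gr i k \<omega>) (gr l k \<omega>) \<partial>M)"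
  let ?m = "\<lambda>i l. (\<integral>\<omega>. ip p (em i k (x i k \<omega>)) (em l k (x l k \<omega>)) \<partial>M)"
  have 1: "integrable M (\<lambda>\<omega>. ip p (gr i k \<omega>) (gr l k \<omega>))" if "i < n" "l < n" for i l
    using that by (intro l2v_ip_integrable gr_l2)
  have 2: "integrable M (\<lambda>\<omega>. ip p (em i k (x i k \<omega>)) (em l k (x l k \<omega>)))" if "i < n" "l < n" for i l
    using that by (intro l2v_ip_integrable em_l2)
  have "(\<integral>\<omega>. ip p (gr_avg k \<omega>) (gr_avg k \<omega>) \<partial>M) = (\<Sum>i<n. (\<Sum>l<n. ?g i l) / real n) / real n"
    unfolding gr_avg_def ip_avg unfolding ip_avg_right by (rule integral_double_avg[OF 1])
  also have "\<dots> \<le> (\<Sum>i<n. (\<Sum>l<n. ?m i l + (if i = l then ?g i i else 0)) / real n) / real n"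
  proof (intro divide_right_mono sum_mono)
    fix i l assume "i \<in> {..<n}" "l \<in> {..<n}"
    moreover have "0 \<le> ?m i i" by (intro integral_nonneg_AE) auto
    ultimately show "?g i l \<le> ?m i l + (if i = l then ?g i i else 0)" using gr_cross[of i l k] by auto
  qed auto
  also have "\<dots> = (\<Sum>i<n. (\<Sum>l<n. ?m i l) / real n) / real n + (\<Sum>i<n. ?g i i) / real n / real n"
    by (simp add: sum.distrib add_divide_distrib sum_divide_distrib[symmetric])
  also have "(\<Sum>i<n. (\<Sum>l<n. ?m i l) / real n) / real n = (\<integral>\<omega>. ip p (em_avg k \<omega>) (em_avg k \<omega>) \<partial>M)"
    unfolding em_avg_def ip_avg unfolding ip_avg_right by (rule integral_double_avg[OF 2, symmetric])
  finally show ?thesis by (simp add: gvar_def)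
qed

text \<open>In expectation the estimates are replaced by their conditional means m, at the price of
  \<open>gvar\<close> / n. Then -<grad f, m> <= -|grad f|^2 / 2 + |grad f - m|^2 / 2: the first part
  feeds the Polyak-Lojasiewicz inequality, the second is the bias. The quadratic term returns to the
  gap through \<open>grad_sq_le\<close>, which gives 8 Lf^2 \<eta>^2.\<close>

lemma descent_step:
  assumes PL: "PL_condition p f \<nu>" and bd: "bdd_below (f ` Rp p)"
    and dm: "\<And>i. i < n \<Longrightarrow> (\<delta> i k)\<^sup>2 \<le> dm"
  shows "(\<integral>\<omega>. f (xbar (Suc k) \<omega>) \<partial>M) - infval p f
    \<le> (1 - \<nu> * \<eta> k + 8 * Lf\<^sup>2 * (\<eta> k)\<^sup>2) * ((\<integral>\<omega>. f (xbar k \<omega>) \<partial>M) - infval p f)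
      + (\<eta> k / 2 + 2 * Lf * (\<eta> k)\<^sup>2) * (2 * Lf\<^sup>2 * (\<integral>\<omega>. cons k \<omega> \<partial>M) + 2 * Lf\<^sup>2 * dm)
      + Lf * (\<eta> k)\<^sup>2 * (gvar k / real n)"
proof -
  let ?e = "\<eta> k"
  have gl: "l2v p (gr_avg k)" unfolding gr_avg_def[abs_def] by (intro l2v_avg gr_l2)
  have el: "l2v p (em_avg k)" unfolding em_avg_def[abs_def] by (intro l2v_avg em_l2)
  note ints = l2v_ip_integrable[OF gl gl] l2v_ip_integrable[OF el el] l2v_ip_integrable[OF fg_l2 gl]
    l2v_ip_integrable[OF fg_l2 el] f_xbar_integrable cons_integrable
  have step: "f (xbar (Suc k) \<omega>) \<le> f (xbar k \<omega>) - ?e * ip p (fg k \<omega>) (gr_avg k \<omega>)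
      + Lf * ?e\<^sup>2 * ip p (gr_avg k \<omega>) (gr_avg k \<omega>)" if w: "\<omega> \<in> space M" for \<omega>
  proof -
    let ?d = "\<lambda>j. xbar (Suc k) \<omega> j - xbar k \<omega> j"
    have d: "?d j = (- ?e) * gr_avg k \<omega> j" if "j < p" for j
      using xbar_Suc[OF w that] by (simp add: gr_avg_def)
    have 1: "ip p (fg k \<omega>) ?d = - (?e * ip p (fg k \<omega>) (gr_avg k \<omega>))"
    proof -
      have "ip p (fg k \<omega>) ?d = ip p (fg k \<omega>) (\<lambda>j. (- ?e) * gr_avg k \<omega> j)" by (rule ip_cong[OF refl d])
      also have "\<dots> = (- ?e) * ip p (fg k \<omega>) (gr_avg k \<omega>)" by (simp only: ip_scale_right)
      finally show ?thesis by simp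
    qed
    have 2: "ip p ?d ?d = ?e\<^sup>2 * ip p (gr_avg k \<omega>) (gr_avg k \<omega>)"
    proof -
      have "ip p ?d ?d = ip p (\<lambda>j. (- ?e) * gr_avg k \<omega> j) (\<lambda>j. (- ?e) * gr_avg k \<omega> j)" by (rule ip_cong[OF d d])
      also have "\<dots> = (- ?e) * ((- ?e) * ip p (gr_avg k \<omega>) (gr_avg k \<omega>))" by (simp only: ip_scale_right ip_scale_left)
      finally show ?thesis by (simp add: power2_eq_square)
    qed
    have "\<bar>f (xbar (Suc k) \<omega>) - f (xbar k \<omega>) - ip p (fg k \<omega>) ?d\<bar> \<le> Lf * ip p ?d ?d"
      unfolding fg_def using Lf by (intro smooth_fun_quadratic_bound[OF f_smooth]) auto
    then show ?thesis unfolding 1 2 by (simp add: mult.assoc)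
  qed
  have point: "f (xbar k \<omega>) - ?e * ip p (fg k \<omega>) (em_avg k \<omega>) + Lf * ?e\<^sup>2 * ip p (em_avg k \<omega>) (em_avg k \<omega>)
      \<le> f (xbar k \<omega>) + (- \<nu> * ?e + 8 * Lf\<^sup>2 * ?e\<^sup>2) * (f (xbar k \<omega>) - infval p f)
        + (?e / 2 + 2 * Lf * ?e\<^sup>2) * (2 * Lf\<^sup>2 * cons k \<omega> + 2 * Lf\<^sup>2 * dm)" if w: "\<omega> \<in> space M" for \<omega>
  proof -
    let ?D = "\<lambda>j. fg k \<omega> j - em_avg k \<omega> j"
    let ?G = "ip p (fg k \<omega>) (fg k \<omega>)" and ?h = "f (xbar k \<omega>) - infval p f"
    have "ip p ?D ?D = ?G - 2 * ip p (fg k \<omega>) (em_avg k \<omega>) + ip p (em_avg k \<omega>) (em_avg k \<omega>)"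
      by (simp add: ip_diff_left ip_diff_right ip_commute)
    \<comment> \<open>Polarization, with the nonnegative square of the mean estimate
      dropped.\<close>
    then have "?G / 2 - ip p ?D ?D / 2 \<le> ip p (fg k \<omega>) (em_avg k \<omega>)"
      using ip_self_nonneg[of p "em_avg k \<omega>"] by linarith
    from mult_left_mono[OF this, of ?e]
    have 1: "?e * (?G / 2 - ip p ?D ?D / 2) \<le> ?e * ip p (fg k \<omega>) (em_avg k \<omega>)" using \<eta>[of k] by simp
    have "ip p (em_avg k \<omega>) (em_avg k \<omega>) \<le> 2 * ?G + 2 * ip p ?D ?D"
      using ip_diff_le[of p "fg k \<omega>" ?D] by simp
    from mult_left_mono[OF this, of "Lf * ?e\<^sup>2"]
    have 2: "Lf * ?e\<^sup>2 * ip p (em_avg k \<omega>) (em_avg k \<omega>) \<le> Lf * ?e\<^sup>2 * (2 * ?G + 2 * ip p ?D ?D)" using Lf by simp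
    have "\<nu> * ?h \<le> ?G / 2" using PL by (simp add: PL_condition_def fg_def nrm_sq)
    from mult_left_mono[OF this, of ?e]
    have 3: "?e * (\<nu> * ?h) \<le> ?e * (?G / 2)" using \<eta>[of k] by simp
    have "?G \<le> 4 * Lf * ?h" unfolding fg_def by (rule grad_sq_le[OF f_smooth Lf bd]) simp
    from mult_left_mono[OF this, of "2 * Lf * ?e\<^sup>2"]
    have 4: "2 * Lf * ?e\<^sup>2 * ?G \<le> 2 * Lf * ?e\<^sup>2 * (4 * Lf * ?h)" using Lf by simp
    from mult_left_mono[OF bias_le[OF w dm], of "?e / 2 + 2 * Lf * ?e\<^sup>2"]
    have 5: "(?e / 2 + 2 * Lf * ?e\<^sup>2) * ip p ?D ?D
        \<le> (?e / 2 + 2 * Lf * ?e\<^sup>2) * (2 * Lf\<^sup>2 * cons k \<omega> + 2 * Lf\<^sup>2 * dm)"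
      using \<eta>[of k] Lf by simp
    have "f (xbar k \<omega>) - ?e * ip p (fg k \<omega>) (em_avg k \<omega>) + Lf * ?e\<^sup>2 * ip p (em_avg k \<omega>) (em_avg k \<omega>)
        \<le> f (xbar k \<omega>) - ?e * (?G / 2 - ip p ?D ?D / 2) + Lf * ?e\<^sup>2 * (2 * ?G + 2 * ip p ?D ?D)"
      using 1 2 by linarith
    also have "\<dots> = f (xbar k \<omega>) - ?e * (?G / 2) + 2 * Lf * ?e\<^sup>2 * ?G + (?e / 2 + 2 * Lf * ?e\<^sup>2) * ip p ?D ?D"
      by (simp add: algebra_simps)
    also have "\<dots> \<le> f (xbar k \<omega>) - ?e * (\<nu> * ?h) + 2 * Lf * ?e\<^sup>2 * (4 * Lf * ?h)
        + (?e / 2 + 2 * Lf * ?e\<^sup>2) * (2 * Lf\<^sup>2 * cons k \<omega> + 2 * Lf\<^sup>2 * dm)"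
      using 3 4 5 by linarith
    also have "\<dots> = f (xbar k \<omega>) + (- \<nu> * ?e + 8 * Lf\<^sup>2 * ?e\<^sup>2) * ?h
        + (?e / 2 + 2 * Lf * ?e\<^sup>2) * (2 * Lf\<^sup>2 * cons k \<omega> + 2 * Lf\<^sup>2 * dm)"
      by (simp add: power2_eq_square algebra_simps)
    finally show ?thesis .
  qed
  let ?Ef = "\<integral>\<omega>. f (xbar k \<omega>) \<partial>M"
  have "(\<integral>\<omega>. f (xbar (Suc k) \<omega>) \<partial>M) \<le> (\<integral>\<omega>. f (xbar k \<omega>) - ?e * ip p (fg k \<omega>) (gr_avg k \<omega>)
      + Lf * ?e\<^sup>2 * ip p (gr_avg k \<omega>) (gr_avg k \<omega>) \<partial>M)"
    using step f_xbar_integrable ints by (intro integral_mono) auto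
  also have "\<dots> = ?Ef - ?e * (\<integral>\<omega>. ip p (fg k \<omega>) (gr_avg k \<omega>) \<partial>M)
      + Lf * ?e\<^sup>2 * (\<integral>\<omega>. ip p (gr_avg k \<omega>) (gr_avg k \<omega>) \<partial>M)"
    using ints by simp
  also have "\<dots> \<le> ?Ef - ?e * (\<integral>\<omega>. ip p (fg k \<omega>) (em_avg k \<omega>) \<partial>M)
      + Lf * ?e\<^sup>2 * ((\<integral>\<omega>. ip p (em_avg k \<omega>) (em_avg k \<omega>) \<partial>M) + gvar k / real n)"
    unfolding gr_avg_inner using Lf by (intro add_left_mono mult_left_mono gr_avg_second) auto
  also have "\<dots> = (\<integral>\<omega>. f (xbar k \<omega>) - ?e * ip p (fg k \<omega>) (em_avg k \<omega>)
      + Lf * ?e\<^sup>2 * ip p (em_avg k \<omega>) (em_avg k \<omega>) \<partial>M) + Lf * ?e\<^sup>2 * (gvar k / real n)"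
    using ints by (simp add: distrib_left)
  also have "(\<integral>\<omega>. f (xbar k \<omega>) - ?e * ip p (fg k \<omega>) (em_avg k \<omega>)
      + Lf * ?e\<^sup>2 * ip p (em_avg k \<omega>) (em_avg k \<omega>) \<partial>M)
      \<le> (\<integral>\<omega>. f (xbar k \<omega>) + (- \<nu> * ?e + 8 * Lf\<^sup>2 * ?e\<^sup>2) * (f (xbar k \<omega>) - infval p f)
        + (?e / 2 + 2 * Lf * ?e\<^sup>2) * (2 * Lf\<^sup>2 * cons k \<omega> + 2 * Lf\<^sup>2 * dm) \<partial>M)"
    using point ints by (intro integral_mono) auto
  also have "\<dots> = ?Ef + (- \<nu> * ?e + 8 * Lf\<^sup>2 * ?e\<^sup>2) * (?Ef - infval p f)
        + (?e / 2 + 2 * Lf * ?e\<^sup>2) * (2 * Lf\<^sup>2 * (\<integral>\<omega>. cons k \<omega> \<partial>M) + 2 * Lf\<^sup>2 * dm)"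
    using ints by (simp add: prob_space)
  finally show ?thesis by (simp add: left_diff_distrib distrib_right)
qed

end

text \<open>A is the gap, U the energy, W the disagreement, dm the bound on \<delta>^2 and g the
  second moment. The terms of order 1/s^2 without factor A or U keep p / n and form q; elsewhere p
  is bounded by P, and 1/s^2 in front of U by (1/t)/s.\<close>

lemma descent_coefficients:
  fixes A A' U W dm g p n P s t r L gap \<nu> kd s0 s1 e :: real
  assumes s: "0 < t" "t \<le> s" and AUW: "0 \<le> A" "0 \<le> U" "0 \<le> W" "W \<le> 2 * U"
    and n: "1 \<le> n" and p: "0 \<le> p" "p \<le> P" and r: "0 < r" "16/3 \<le> \<nu> * r" and L: "0 < L"
    and nn: "0 \<le> gap" "0 \<le> kd" "0 \<le> s0" "0 \<le> s1" and e: "e = r / s"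
    and dm: "dm = kd * (p * e) / (n + p)"
    and g: "g \<le> 2 * p\<^sup>2 * L\<^sup>2 * dm + 4 * p * (s0 * (8 * L * (A + gap) + 2 * L\<^sup>2 * W) + s1)"
    and A': "A' \<le> (1 - \<nu> * e + 8 * L\<^sup>2 * e\<^sup>2) * A + (e / 2 + 2 * L * e\<^sup>2) * (2 * L\<^sup>2 * W + 2 * L\<^sup>2 * dm)
      + L * e\<^sup>2 * (g / n)"
  shows "A' \<le> (1 - 16/3 / s + (8 * L\<^sup>2 * r\<^sup>2 + 32 * L\<^sup>2 * s0 * P * r\<^sup>2) / s\<^sup>2) * A
      + (2 * (r * L\<^sup>2 + 4 * L^3 * r\<^sup>2 / t + 8 * L^3 * s0 * P * r\<^sup>2 / t)) / s * U
      + (p / n * r\<^sup>2 * (L\<^sup>2 * kd + 32 * L\<^sup>2 * s0 * gap + 4 * L * s1)) / s\<^sup>2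
      + (4 * L^3 * kd * r^3 + 2 * L^3 * P\<^sup>2 * kd * r^3) / s^3"
proof -
  have s0': "0 < s" using s by linarith
  have e0: "0 < e" using r s0' by (simp add: e)
  have e2: "e\<^sup>2 = r\<^sup>2 / s\<^sup>2" "e^3 = r^3 / s^3" by (simp_all add: e power_divide)
  have est: "e\<^sup>2 \<le> (r\<^sup>2 / t) / s"
  proof -
    have "r\<^sup>2 / (s * s) \<le> r\<^sup>2 / (t * s)" using s s0' by (intro divide_left_mono mult_right_mono) auto
    moreover have "e\<^sup>2 = r\<^sup>2 / (s * s)" by (simp add: e power2_eq_square)
    ultimately show ?thesis by simp
  qed
  have np: "0 < n + p" "0 < n" using n p by auto
  have dm0: "0 \<le> dm" unfolding dm using nn p e0 np by simp
  \<comment> \<open>The denominator n + p serves twice. Dropping p leaves p / n, kept in the term of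
    order e^2; in \<open>dm2\<close> it cancels p, for the terms of order e^3.\<close>
  have dm1: "dm \<le> kd * (p * e) / n" unfolding dm using nn p e0 np by (intro divide_left_mono) auto
  have dm2: "dm \<le> kd * e"
  proof -
    have "kd * e * p \<le> kd * e * (n + p)" using nn e0 np by (intro mult_left_mono) auto
    then show ?thesis unfolding dm using np by (simp add: pos_divide_le_eq ac_simps)
  qed
  have T1: "(16/3 / s) * A \<le> \<nu> * e * A"
  proof (rule mult_right_mono)
    show "16/3 / s \<le> \<nu> * e" using divide_right_mono[OF r(2), of s] s0' by (simp add: e)
  qed (rule AUW)
  have T2: "e * L\<^sup>2 * W \<le> (2 * (r * L\<^sup>2)) / s * U"
  proof -
    have "e * L\<^sup>2 * W \<le> e * L\<^sup>2 * (2 * U)" using AUW e0 by (intro mult_left_mono) auto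
    then show ?thesis by (simp add: e ac_simps)
  qed
  have T3: "e * L\<^sup>2 * dm \<le> (p / n * r\<^sup>2 * (L\<^sup>2 * kd)) / s\<^sup>2"
  proof -
    have "e * L\<^sup>2 * dm \<le> e * L\<^sup>2 * (kd * (p * e) / n)" using dm1 e0 by (intro mult_left_mono) auto
    also have "\<dots> = (p / n * (L\<^sup>2 * kd)) * e\<^sup>2" by (simp add: power2_eq_square)
    finally show ?thesis by (simp add: e2 ac_simps)
  qed
  have T4: "4 * L^3 * e\<^sup>2 * W \<le> (2 * (4 * L^3 * r\<^sup>2 / t)) / s * U"
  proof -
    have "4 * L^3 * e\<^sup>2 * W \<le> 4 * L^3 * ((r\<^sup>2 / t) / s) * (2 * U)"
      using AUW est L r s s0' by (intro mult_mono) auto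
    then show ?thesis by (simp add: ac_simps)
  qed
  have T5: "4 * L^3 * e\<^sup>2 * dm \<le> (4 * L^3 * kd * r^3) / s^3"
  proof -
    have "4 * L^3 * e\<^sup>2 * dm \<le> 4 * L^3 * e\<^sup>2 * (kd * e)" using dm2 L by (intro mult_left_mono) auto
    also have "\<dots> = 4 * L^3 * kd * e^3" by (simp add: power2_eq_square power3_eq_cube)
    finally show ?thesis by (simp add: e2)
  qed
  have div_n: "y / n \<le> y" if "0 \<le> y" for y
    using that n by (simp add: divide_le_eq) (metis mult_left_mono mult.right_neutral)
  have T6a: "L * e\<^sup>2 * (2 * p\<^sup>2 * L\<^sup>2 * dm / n) \<le> (2 * L^3 * P\<^sup>2 * kd * r^3) / s^3"
  proof -
    have "2 * p\<^sup>2 * L\<^sup>2 * dm / n \<le> 2 * p\<^sup>2 * L\<^sup>2 * dm" using dm0 by (intro div_n) auto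
    also have "\<dots> \<le> 2 * P\<^sup>2 * L\<^sup>2 * (kd * e)"
      using p dm0 dm2 L by (intro mult_mono power_mono) auto
    finally have "L * e\<^sup>2 * (2 * p\<^sup>2 * L\<^sup>2 * dm / n) \<le> L * e\<^sup>2 * (2 * P\<^sup>2 * L\<^sup>2 * (kd * e))"
      using L by (intro mult_left_mono) auto
    also have "\<dots> = 2 * L^3 * P\<^sup>2 * kd * e^3" by (simp add: power2_eq_square power3_eq_cube)
    finally show ?thesis by (simp add: e2)
  qed
  have pnP: "p / n \<le> P" using div_n[OF p(1)] p by linarith
  have P: "0 \<le> P" using p by linarith
  have T6b: "L * e\<^sup>2 * (32 * L * s0 * A * (p / n)) \<le> (32 * L\<^sup>2 * s0 * P * r\<^sup>2) / s\<^sup>2 * A"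
  proof -
    have "L * e\<^sup>2 * (32 * L * s0 * A * (p / n)) \<le> L * e\<^sup>2 * (32 * L * s0 * A * P)"
      using pnP L nn AUW by (intro mult_left_mono) auto
    also have "\<dots> = (32 * L\<^sup>2 * s0 * P) * e\<^sup>2 * A" by (simp add: power2_eq_square)
    finally show ?thesis by (simp add: e2)
  qed
  have T6d: "L * e\<^sup>2 * (8 * L\<^sup>2 * s0 * W * (p / n)) \<le> (2 * (8 * L^3 * s0 * P * r\<^sup>2 / t)) / s * U"
  proof -
    have "8 * L\<^sup>2 * s0 * W * (p / n) \<le> 8 * L\<^sup>2 * s0 * (2 * U) * P"
      using pnP AUW nn p np by (intro mult_mono) auto
    then have "L * e\<^sup>2 * (8 * L\<^sup>2 * s0 * W * (p / n)) \<le> L * e\<^sup>2 * (8 * L\<^sup>2 * s0 * (2 * U) * P)"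
      using L by (intro mult_left_mono) auto
    also have "\<dots> \<le> L * ((r\<^sup>2 / t) / s) * (8 * L\<^sup>2 * s0 * (2 * U) * P)"
    proof (rule mult_right_mono)
      show "L * e\<^sup>2 \<le> L * ((r\<^sup>2 / t) / s)" using est L by (intro mult_left_mono) auto
    qed (use nn AUW P in simp)
    also have "\<dots> = (2 * (8 * L^3 * s0 * P * r\<^sup>2 / t)) / s * U"
      by (simp add: power2_eq_square power3_eq_cube)
    finally show ?thesis .
  qed
  have T6c: "L * e\<^sup>2 * (4 * (8 * L * s0 * gap + s1) * (p / n))
      = (p / n * r\<^sup>2 * (32 * L\<^sup>2 * s0 * gap + 4 * L * s1)) / s\<^sup>2"
    unfolding e2 by (simp add: power2_eq_square algebra_simps add_divide_distrib)
  have "g / n \<le> (2 * p\<^sup>2 * L\<^sup>2 * dm + 4 * p * (s0 * (8 * L * (A + gap) + 2 * L\<^sup>2 * W) + s1)) / n"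
    using g np by (intro divide_right_mono) auto
  also have "\<dots> = 2 * p\<^sup>2 * L\<^sup>2 * dm / n + 32 * L * s0 * A * (p / n) + 8 * L\<^sup>2 * s0 * W * (p / n)
      + 4 * (8 * L * s0 * gap + s1) * (p / n)"
    by (simp add: add_divide_distrib algebra_simps)
  finally have "L * e\<^sup>2 * (g / n) \<le> L * e\<^sup>2 * (2 * p\<^sup>2 * L\<^sup>2 * dm / n + 32 * L * s0 * A * (p / n)
      + 8 * L\<^sup>2 * s0 * W * (p / n) + 4 * (8 * L * s0 * gap + s1) * (p / n))"
    using L by (intro mult_left_mono) auto
  also have "\<dots> = L * e\<^sup>2 * (2 * p\<^sup>2 * L\<^sup>2 * dm / n) + L * e\<^sup>2 * (32 * L * s0 * A * (p / n))
      + L * e\<^sup>2 * (8 * L\<^sup>2 * s0 * W * (p / n)) + L * e\<^sup>2 * (4 * (8 * L * s0 * gap + s1) * (p / n))"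
    by (simp only: distrib_left)
  finally have T6: "L * e\<^sup>2 * (g / n) \<le> \<dots>" .
  have T7: "(e / 2 + 2 * L * e\<^sup>2) * (2 * L\<^sup>2 * W + 2 * L\<^sup>2 * dm)
      = e * L\<^sup>2 * W + e * L\<^sup>2 * dm + 4 * L^3 * e\<^sup>2 * W + 4 * L^3 * e\<^sup>2 * dm"
    by (simp add: power2_eq_square power3_eq_cube algebra_simps)
  have T8: "(1 - \<nu> * e + 8 * L\<^sup>2 * e\<^sup>2) * A = A - \<nu> * e * A + (8 * L\<^sup>2 * r\<^sup>2) / s\<^sup>2 * A"
    unfolding e2 by (simp add: algebra_simps)
  have R: "(1 - 16/3 / s + (8 * L\<^sup>2 * r\<^sup>2 + 32 * L\<^sup>2 * s0 * P * r\<^sup>2) / s\<^sup>2) * A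
      + (2 * (r * L\<^sup>2 + 4 * L^3 * r\<^sup>2 / t + 8 * L^3 * s0 * P * r\<^sup>2 / t)) / s * U
      + (p / n * r\<^sup>2 * (L\<^sup>2 * kd + 32 * L\<^sup>2 * s0 * gap + 4 * L * s1)) / s\<^sup>2
      + (4 * L^3 * kd * r^3 + 2 * L^3 * P\<^sup>2 * kd * r^3) / s^3
    = A - (16/3 / s) * A + (8 * L\<^sup>2 * r\<^sup>2) / s\<^sup>2 * A + (32 * L\<^sup>2 * s0 * P * r\<^sup>2) / s\<^sup>2 * A
      + ((2 * (r * L\<^sup>2)) / s * U + (2 * (4 * L^3 * r\<^sup>2 / t)) / s * U + (2 * (8 * L^3 * s0 * P * r\<^sup>2 / t)) / s * U)
      + ((p / n * r\<^sup>2 * (L\<^sup>2 * kd)) / s\<^sup>2 + (p / n * r\<^sup>2 * (32 * L\<^sup>2 * s0 * gap + 4 * L * s1)) / s\<^sup>2)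
      + ((4 * L^3 * kd * r^3) / s^3 + (2 * L^3 * P\<^sup>2 * kd * r^3) / s^3)"
    by (simp only: distrib_left distrib_right add_divide_distrib left_diff_distrib)
  show ?thesis
    unfolding R using A' T1 T2 T3 T4 T5 T6 T6a T6b T6c T6d unfolding T7 T8 by linarith
qed

text \<open>The constants for U may depend on n and P, so p is bounded by P, W by 2 U and dm by its
  largest value; the second moment becomes affine in A and U.\<close>

lemma energy_coefficients:
  fixes A U' U W dm g p n P s t r L gap kd s0 s1 c K e :: real
  assumes s: "0 < t" "t \<le> s" and AUW: "0 \<le> A" "0 \<le> U" "0 \<le> W" "W \<le> 2 * U"
    and n: "1 \<le> n" and p: "0 \<le> p" "p \<le> P" and r: "0 < r" and L: "0 < L" and K: "0 \<le> K"
    and nn: "0 \<le> gap" "0 \<le> kd" "0 \<le> s0" "0 \<le> s1" and e: "e = r / s"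
    and dm: "dm = kd * (p * e) / (n + p)"
    and g: "g \<le> 2 * p\<^sup>2 * L\<^sup>2 * dm + 4 * p * (s0 * (8 * L * (A + gap) + 2 * L\<^sup>2 * W) + s1)"
    and U': "U' \<le> (1 - c) * U + K * e\<^sup>2 * (n * g)"
  shows "U' \<le> (1 - c) * U + (K * r\<^sup>2 * n * (2 * P\<^sup>2 * L\<^sup>2 * (kd * (r / t)) + 4 * P * (s0 * (8 * L * gap) + s1))
      + (K * r\<^sup>2 * n * (32 * P * s0 * L)) * A + (K * r\<^sup>2 * n * (16 * P * s0 * L\<^sup>2)) * U) / s\<^sup>2"
proof -
  have s0': "0 < s" using s by linarith
  have e0: "0 < e" "e \<le> r / t" using r s s0' by (auto simp: e intro: divide_left_mono)
  have np: "0 < n + p" using n p by auto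
  have dm2: "dm \<le> kd * (r / t)"
  proof -
    have "kd * e * p \<le> kd * e * (n + p)" using nn e0 n by (intro mult_left_mono) auto
    then have "dm \<le> kd * e" unfolding dm using np by (simp add: pos_divide_le_eq ac_simps)
    also have "\<dots> \<le> kd * (r / t)" using e0 nn by (intro mult_left_mono) auto
    finally show ?thesis .
  qed
  have dm0: "0 \<le> dm" unfolding dm using nn p e0 np by simp
  have P: "0 \<le> P" using p by linarith
  have "g \<le> 2 * P\<^sup>2 * L\<^sup>2 * (kd * (r / t)) + 4 * P * (s0 * (8 * L * (A + gap) + 2 * L\<^sup>2 * (2 * U)) + s1)"
  proof -
    have "2 * p\<^sup>2 * L\<^sup>2 * dm \<le> 2 * P\<^sup>2 * L\<^sup>2 * (kd * (r / t))"
      using p dm0 dm2 L by (intro mult_mono power_mono) auto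
    moreover have "4 * p * (s0 * (8 * L * (A + gap) + 2 * L\<^sup>2 * W) + s1)
        \<le> 4 * P * (s0 * (8 * L * (A + gap) + 2 * L\<^sup>2 * (2 * U)) + s1)"
      using p AUW nn L P by (intro mult_mono add_mono order_refl add_nonneg_nonneg mult_nonneg_nonneg) auto
    ultimately show ?thesis using g by linarith
  qed
  then have "K * e\<^sup>2 * (n * g) \<le> K * e\<^sup>2 * (n * (2 * P\<^sup>2 * L\<^sup>2 * (kd * (r / t))
      + 4 * P * (s0 * (8 * L * (A + gap) + 2 * L\<^sup>2 * (2 * U)) + s1)))"
    using K n by (intro mult_left_mono) auto
  also have "\<dots> = (K * r\<^sup>2 * n * (2 * P\<^sup>2 * L\<^sup>2 * (kd * (r / t)) + 4 * P * (s0 * (8 * L * gap) + s1))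
      + (K * r\<^sup>2 * n * (32 * P * s0 * L)) * A + (K * r\<^sup>2 * n * (16 * P * s0 * L\<^sup>2)) * U) / s\<^sup>2"
  proof -
    have "K * e\<^sup>2 * y = (K * r\<^sup>2 * y) / s\<^sup>2" for y by (simp add: e power_divide)
    then show ?thesis
      by (simp only:) (rule arg_cong[where f = "\<lambda>y. y / s\<^sup>2"], simp add: algebra_simps)
  qed
  finally show ?thesis using U' by linarith
qed

subsection \<open>The convergence rates\<close>

lemma gradient_estimatorI:
  assumes so: "stochastic_objectives n p F D" and p: "1 \<le> p" and L: "0 < Lf" and i: "i < n"
    and sm: "AE z in D i. smooth_fun p Lf (\<lambda>y. F i y z)" and bv: "bounded_variance n p F D \<sigma>\<^sub>0 \<sigma>\<^sub>1" and d: "0 < d"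
  shows "gradient_estimator (D i) p (F i) Lf \<sigma>\<^sub>0 \<sigma>\<^sub>1 d"
proof -
  have so_i: "prob_space (D i)" "(\<lambda>(x, z). F i x z) \<in> borel_measurable (RV p \<Otimes>\<^sub>M D i)"
    "\<And>x. x \<in> Rp p \<Longrightarrow> integrable (D i) (F i x)"
    using so i by (auto simp: stochastic_objectives_def)
  interpret smooth_objective "D i" p "F i" Lf
    by (rule smooth_objective.intro[OF so_i(1)], unfold_locales) (use p L so_i sm in auto)
  have eq: "local_obj F D i = obj" by (simp add: fun_eq_iff local_obj_def obj_def)
  show ?thesis
  proof unfold_locales
    fix x assume "x \<in> Rp p"
    then show "(\<integral>\<^sup>+ z. ennreal ((nrm p (\<lambda>j. grad p (\<lambda>y. F i y z) x j - grad p obj x j))\<^sup>2) \<partial>D i)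
        \<le> ennreal (\<sigma>\<^sub>0\<^sup>2 * (nrm p (grad p obj x))\<^sup>2 + \<sigma>\<^sub>1\<^sup>2)"
      using bv i unfolding bounded_variance_def eq[symmetric] by blast
  qed (rule d)
qed

context zo_primal_dual
begin

lemma flow_le_f:
  assumes "y \<in> Rp p"
  shows "flow \<le> f y"
  unfolding flow_def global_obj_def using assms
  by (intro divide_right_mono sum_mono infval_le lb) auto

lemma flow_le_infval: "flow \<le> infval p f"
proof -
  have "(\<lambda>j\<in>{..<p}. 0 :: real) \<in> Rp p" by simp
  then have "Rp p \<noteq> {}" by blast
  then show ?thesis unfolding infval_def by (intro cINF_greatest flow_le_f) auto
qed

lemma f_gap_nonneg:
  assumes "bdd_below (f ` Rp p)"
  shows "0 \<le> (\<integral>\<omega>. f (xbar k \<omega>) \<partial>M) - infval p f"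
proof -
  have "(\<integral>\<omega>. infval p f \<partial>M) \<le> (\<integral>\<omega>. f (xbar k \<omega>) \<partial>M)"
    using f_xbar_integrable infval_le[OF assms] by (intro integral_mono) auto
  then show ?thesis by (simp add: prob_space)
qed

lemma xbar_0: "\<omega> \<in> space M \<Longrightarrow> xbar 0 \<omega> = agent_mean n p x0"
proof -
  assume w: "\<omega> \<in> space M"
  have "(\<Sum>i<n. x i 0 \<omega> j) = (\<Sum>i<n. x0 i j)" for j
    using x_0[OF w] by (intro sum.cong) auto
  then show ?thesis by (simp add: xbar_def agent_mean_def)
qed

lemma f_xbar_0: "(\<integral>\<omega>. f (xbar 0 \<omega>) \<partial>M) = f (agent_mean n p x0)"
proof -
  have "(\<integral>\<omega>. f (xbar 0 \<omega>) \<partial>M) = (\<integral>\<omega>. f (agent_mean n p x0) \<partial>M)"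
    by (intro Bochner_Integration.integral_cong refl) (simp add: xbar_0)
  then show ?thesis by (simp add: prob_space)
qed

lemma mean_energy_0: "(\<integral>\<omega>. energy 0 \<omega> \<partial>M) = real n * consensus_error n p x0"
proof -
  have "(\<integral>\<omega>. energy 0 \<omega> \<partial>M) = (\<integral>\<omega>. real n * consensus_error n p x0 \<partial>M)"
    by (intro Bochner_Integration.integral_cong refl) (simp add: energy_0)
  then show ?thesis by (simp add: prob_space)
qed

lemma mean_cons_le:
  assumes "\<And>x w. ip n x x \<le> 2 * lyap n a \<kappa>\<^sub>2 x w"
  shows "(\<integral>\<omega>. cons k \<omega> \<partial>M) \<le> 2 * (\<integral>\<omega>. energy k \<omega> \<partial>M)"
proof -
  have "cons k \<omega> \<le> 2 * energy k \<omega>" for \<omega>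
  proof -
    have "(\<Sum>j<p. ip n (dev k \<omega> j) (dev k \<omega> j)) \<le> (\<Sum>j<p. 2 * lyap n a \<kappa>\<^sub>2 (dev k \<omega> j) (dual k \<omega> j))"
      by (intro sum_mono assms)
    then have "(\<Sum>j<p. ip n (dev k \<omega> j) (dev k \<omega> j)) \<le> 2 * energy k \<omega>"
      by (simp add: energy_def sum_distrib_left)
    moreover have "(\<Sum>j<p. ip n (dev k \<omega> j) (dev k \<omega> j)) / real n \<le> (\<Sum>j<p. ip n (dev k \<omega> j) (dev k \<omega> j)) / 1"
      using n1 by (intro divide_left_mono sum_nonneg) auto
    ultimately have "(\<Sum>j<p. ip n (dev k \<omega> j) (dev k \<omega> j)) / real n \<le> 2 * energy k \<omega>" by simp
    then show ?thesis by (simp only: cons_dev)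
  qed
  then have "(\<integral>\<omega>. cons k \<omega> \<partial>M) \<le> (\<integral>\<omega>. 2 * energy k \<omega> \<partial>M)"
    using cons_integrable energy_integrable by (intro integral_mono) auto
  then show ?thesis by simp
qed

lemma mean_cons_nonneg: "0 \<le> (\<integral>\<omega>. cons k \<omega> \<partial>M)"
  by (intro integral_nonneg_AE) (simp add: cons_nonneg)

end

section \<open>Consequences of the lower bound on the time shift\<close>

lemma c3_check_ge:
  shows "2 / (3 * eps6 \<kappa>\<^sub>2) \<le> c3_check p Lf \<sigma>\<^sub>0 \<nu> L \<kappa>\<^sub>0 \<kappa>\<^sub>1 \<kappa>\<^sub>2"
    and "64 * real p * (1 + \<sigma>\<^sub>0\<^sup>2) * Lf * \<kappa>\<^sub>2 * eps10_check Lf L \<kappa>\<^sub>1 \<kappa>\<^sub>2 / (\<nu> * \<kappa>\<^sub>0)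
      \<le> c3_check p Lf \<sigma>\<^sub>0 \<nu> L \<kappa>\<^sub>0 \<kappa>\<^sub>1 \<kappa>\<^sub>2"
  unfolding c3_check_def by (rule Max_ge; simp)+

text \<open>The entry with the factor 64 is linear in p. Since \<open>eps10_check\<close> >= 10 and
  1 + \<open>\<sigma>\<^sub>0\<close>^2 >= 1, it bounds p by a multiple of the shift, with 640 = 64
  * 10.\<close>

lemma c3_check_dimension:
  assumes "0 < Lf" "0 < \<nu>" "0 < \<kappa>\<^sub>0" "0 < \<kappa>\<^sub>1" "0 < \<kappa>\<^sub>2" "0 < rho2 L"
    and t: "c3_check p Lf \<sigma>\<^sub>0 \<nu> L \<kappa>\<^sub>0 \<kappa>\<^sub>1 \<kappa>\<^sub>2 \<le> t\<^sub>1"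
  shows "real p \<le> t\<^sub>1 * \<nu> * \<kappa>\<^sub>0 / (640 * Lf * \<kappa>\<^sub>2)"
proof -
  let ?e = "eps10_check Lf L \<kappa>\<^sub>1 \<kappa>\<^sub>2"
  have "0 \<le> kappa4 L \<kappa>\<^sub>1" using assms by (simp add: kappa4_def)
  then have e: "10 \<le> ?e" using assms by (simp add: eps10_check_def)
  have "640 * real p * Lf * \<kappa>\<^sub>2 = (64 * real p * Lf * \<kappa>\<^sub>2) * (1 * 10)" by simp
  also have "\<dots> \<le> (64 * real p * Lf * \<kappa>\<^sub>2) * ((1 + \<sigma>\<^sub>0\<^sup>2) * ?e)"
    using e assms by (intro mult_left_mono mult_mono) auto
  also have "\<dots> = 64 * real p * (1 + \<sigma>\<^sub>0\<^sup>2) * Lf * \<kappa>\<^sub>2 * ?e" by simp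
  also have "\<dots> \<le> t\<^sub>1 * (\<nu> * \<kappa>\<^sub>0)"
  proof -
    have "64 * real p * (1 + \<sigma>\<^sub>0\<^sup>2) * Lf * \<kappa>\<^sub>2 * ?e / (\<nu> * \<kappa>\<^sub>0) \<le> t\<^sub>1"
      using c3_check_ge(2) t by (rule order_trans)
    then show ?thesis using assms by (simp add: pos_divide_le_eq)
  qed
  finally have "real p * (640 * Lf * \<kappa>\<^sub>2) \<le> t\<^sub>1 * \<nu> * \<kappa>\<^sub>0" by (simp add: ac_simps)
  then show ?thesis using assms by (simp add: pos_le_divide_eq)
qed

text \<open>Yields positivity of the shift, which is not among the assumptions: \<open>eps6\<close>
  is positive because \<open>\<kappa>\<^sub>2\<close> < 1/5.\<close>

lemma c3_check_pos:
  assumes "0 < \<kappa>\<^sub>2" "\<kappa>\<^sub>2 < 1/5"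
  shows "0 < c3_check p Lf \<sigma>\<^sub>0 \<nu> L \<kappa>\<^sub>0 \<kappa>\<^sub>1 \<kappa>\<^sub>2"
proof -
  have "0 < \<kappa>\<^sub>2 * (1 - 5 * \<kappa>\<^sub>2)" using assms by simp
  then have "0 < eps6 \<kappa>\<^sub>2" by (simp add: eps6_def power2_eq_square algebra_simps)
  then have "0 < 2 / (3 * eps6 \<kappa>\<^sub>2)" by simp
  then show ?thesis using c3_check_ge(1) by (rule less_le_trans)
qed

theorem theorem5:
  fixes Lf \<sigma>\<^sub>0 \<sigma>\<^sub>1 \<nu> \<kappa>\<^sub>\<delta> c0hat gap :: real
  assumes "0 < Lf" and "0 < \<nu>" and "0 < \<kappa>\<^sub>\<delta>" and "0 < c0hat" and "c0hat < 1"
  shows "\<exists>C1\<ge>0.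
    \<forall>(n::nat) (E :: (nat \<times> nat) set) (a :: nat \<Rightarrow> nat \<Rightarrow> real)
      (\<kappa>\<^sub>0::real) (\<kappa>\<^sub>1::real) (\<kappa>\<^sub>2::real) (t\<^sub>1::real) (f_gap0::real) (cons0::real).
    2 \<le> n \<and> network n E a \<and> connected_network n E \<and>
    c1 (laplacian n a) < \<kappa>\<^sub>1 \<and>
    0 < \<kappa>\<^sub>2 \<and> \<kappa>\<^sub>2 < c2 (laplacian n a) \<kappa>\<^sub>1 \<and>
    3 * c0hat * \<nu> * \<kappa>\<^sub>2 / 16 \<le> \<kappa>\<^sub>0 \<and> \<kappa>\<^sub>0 < 3 * \<nu> * \<kappa>\<^sub>2 / 16 \<longrightarrow>
    (\<exists>C2\<ge>0. \<exists>C3\<ge>0.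
      \<forall>(p::nat) (F :: nat \<Rightarrow> (nat \<Rightarrow> real) \<Rightarrow> 'z \<Rightarrow> real) (D :: nat \<Rightarrow> 'z measure)
        (\<delta> :: nat \<Rightarrow> nat \<Rightarrow> real) (x0 :: nat \<Rightarrow> nat \<Rightarrow> real)
        (M :: 'w measure) (u :: nat \<Rightarrow> nat \<Rightarrow> 'w \<Rightarrow> nat \<Rightarrow> real) (\<xi> :: nat \<Rightarrow> nat \<Rightarrow> 'w \<Rightarrow> 'z)
        (x :: nat \<Rightarrow> nat \<Rightarrow> 'w \<Rightarrow> nat \<Rightarrow> real) (v :: nat \<Rightarrow> nat \<Rightarrow> 'w \<Rightarrow> nat \<Rightarrow> real).
      let f = global_obj n F D;
          fstar = infval p f;
          \<alpha> = alpha_seq \<kappa>\<^sub>0 \<kappa>\<^sub>1 t\<^sub>1;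
          \<beta> = beta_seq \<kappa>\<^sub>0 t\<^sub>1;
          \<eta> = eta_seq \<kappa>\<^sub>0 \<kappa>\<^sub>2 t\<^sub>1;
          xbar = (\<lambda>k \<omega>. agent_mean n p (\<lambda>i. x i k \<omega>))
      in
        1 \<le> p \<and>
        stochastic_objectives n p F D \<and>
        minimizers p f \<noteq> {} \<and> bdd_below (f ` Rp p) \<and>
        (\<forall>i<n. AE z in D i. smooth_fun p Lf (\<lambda>y. F i y z)) \<and>
        bounded_variance n p F D \<sigma>\<^sub>0 \<sigma>\<^sub>1 \<and>
        PL_condition p f \<nu> \<and>
        (\<forall>i<n. bdd_below (local_obj F D i ` Rp p)) \<and>
        c3_check p Lf \<sigma>\<^sub>0 \<nu> (laplacian n a) \<kappa>\<^sub>0 \<kappa>\<^sub>1 \<kappa>\<^sub>2 \<le> t\<^sub>1 \<and>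
        (\<forall>i<n. \<forall>k. 0 < \<delta> i k \<and> \<delta> i k \<le> \<kappa>\<^sub>\<delta> * sqrt (real p * \<eta> k) / sqrt (real n + real p)) \<and>
        (\<forall>i<n. x0 i \<in> Rp p) \<and>
        sampling n p D M u \<xi> \<and>
        primal_dual_iterates n p (laplacian n a) F \<alpha> \<beta> \<eta> \<delta> x0 M u \<xi> x v \<and>
        fstar - (\<Sum>i<n. infval p (local_obj F D i)) / real n = gap \<and>
        f (agent_mean n p x0) - fstar = f_gap0 \<and>
        consensus_error n p x0 = cons0 \<longrightarrow>
        (\<forall>T\<ge>1.
          integrable M (\<lambda>\<omega>. consensus_error n p (\<lambda>i. x i T \<omega>)) \<and>
          (\<integral>\<omega>. consensus_error n p (\<lambda>i. x i T \<omega>) \<partial>M) \<le> C3 * (real p / (real T)\<^sup>2) \<and>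
          integrable M (\<lambda>\<omega>. f (xbar T \<omega>) - fstar) \<and>
          (\<integral>\<omega>. f (xbar T \<omega>) - fstar \<partial>M)
            \<le> C1 * (real p / (real n * real T)) + C2 * (real p / (real T)\<^sup>2)))"
proof -
  \<comment> \<open>The coefficient of p / n in q up to the factor r^2: finite-difference bias,
    heterogeneity and sampling noise. The sign of \<open>gap\<close> is known only once the
    objectives are given, hence the absolute value.\<close>
  define Cb where "Cb = Lf\<^sup>2 * \<kappa>\<^sub>\<delta>\<^sup>2 + 32 * Lf\<^sup>2 * (1 + \<sigma>\<^sub>0\<^sup>2) * \<bar>gap\<bar> + 4 * Lf * \<sigma>\<^sub>1\<^sup>2"
  have Cb: "0 \<le> Cb" using assms(1) by (simp add: Cb_def)
  \<comment> \<open>Bounds \<open>\<kappa>\<^sub>2\<close> / \<open>\<kappa>\<^sub>0\<close> for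
    every network, by the lower bound on \<open>\<kappa>\<^sub>0\<close>.\<close>
  define R where "R = 16 / (3 * c0hat * \<nu>)"
  show ?thesis
    unfolding Let_def
  proof (rule exI[of _ "R\<^sup>2 * Cb"], rule conjI, use Cb in simp, intro allI impI, goal_cases)
    case (1 n E a \<kappa>\<^sub>0 \<kappa>\<^sub>1 \<kappa>\<^sub>2 t\<^sub>1 f_gap0 cons0)
    then have n: "2 \<le> n" and net: "network n E a" and con: "connected_network n E"
      and \<kappa>1: "c1 (laplacian n a) < \<kappa>\<^sub>1" and \<kappa>2: "0 < \<kappa>\<^sub>2" "\<kappa>\<^sub>2 < c2 (laplacian n a) \<kappa>\<^sub>1"
      and \<kappa>0: "3 * c0hat * \<nu> * \<kappa>\<^sub>2 / 16 \<le> \<kappa>\<^sub>0" "\<kappa>\<^sub>0 < 3 * \<nu> * \<kappa>\<^sub>2 / 16" by auto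
    obtain \<Lambda> \<mu> where \<Lambda>: "0 < \<Lambda>" and \<mu>: "0 < \<mu>" and kk: "\<kappa>\<^sub>1 * \<kappa>\<^sub>2 * \<Lambda> \<le> 1/2" and k1: "1 < \<kappa>\<^sub>1"
      and r2: "0 < rho2 (laplacian n a)"
      and P: "\<And>y. ip n (lap n a y) (lap n a y) \<le> \<Lambda> * ip n y (lap n a y)"
      and coer: "\<And>y. (\<Sum>i<n. y i) = 0 \<Longrightarrow> \<mu> * ip n y y \<le> ip n y (lap n a y)"
      using network_constants[OF n net con \<kappa>1 \<kappa>2] by blast
    have k2: "\<kappa>\<^sub>2 < 1/5" using \<kappa>2 by (simp add: c2_def)
    have b2: "\<kappa>\<^sub>2\<^sup>2 \<le> (\<kappa>\<^sub>1 * \<kappa>\<^sub>2) / 5"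
    proof -
      have "\<kappa>\<^sub>2 * \<kappa>\<^sub>2 \<le> \<kappa>\<^sub>2 * (\<kappa>\<^sub>1 / 5)" using \<kappa>2 k1 k2 by (intro mult_left_mono) auto
      then show ?thesis by (simp add: power2_eq_square mult.commute)
    qed
    have ab: "0 < \<kappa>\<^sub>1 * \<kappa>\<^sub>2" using k1 \<kappa>2(1) by simp
    obtain c K where c: "0 < c" "c < 1" and K: "0 \<le> K"
      and contr: "\<And>x w d. (\<Sum>i<n. x i) = 0 \<Longrightarrow> (\<Sum>i<n. w i) = 0 \<Longrightarrow>
        lyap n a \<kappa>\<^sub>2 (\<lambda>i. x i - (\<kappa>\<^sub>1 * \<kappa>\<^sub>2) * lap n a x i - \<kappa>\<^sub>2 * lap n a w i + d i) (\<lambda>i. w i + \<kappa>\<^sub>2 * x i)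
          \<le> (1 - c) * lyap n a \<kappa>\<^sub>2 x w + K * ip n d d"
      and lyap_ge: "\<And>x w. ip n x x \<le> 2 * lyap n a \<kappa>\<^sub>2 x w"
      by (rule lyap_contraction[OF net \<Lambda> \<mu> P coer ab \<kappa>2(1) b2 k2 kk]) (assumption | rule that)+
    have "0 < 3 * c0hat * \<nu> * \<kappa>\<^sub>2 / 16" using assms \<kappa>2 by simp
    then have k0: "0 < \<kappa>\<^sub>0" using \<kappa>0(1) by linarith
    define r where "r = \<kappa>\<^sub>2 / \<kappa>\<^sub>0"
    have r: "0 < r" "16/3 \<le> \<nu> * r" "r \<le> R"
    proof -
      show "0 < r" using k0 \<kappa>2 by (simp add: r_def)
      show "16/3 \<le> \<nu> * r" using \<kappa>0(2) k0 by (simp add: r_def pos_le_divide_eq)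
      show "r \<le> R" using \<kappa>0(1) k0 assms by (simp add: r_def R_def divide_le_eq pos_le_divide_eq ac_simps)
    qed
    \<comment> \<open>The shift is known to be positive only after the constants are fixed; until
      then 1 stands in for nonpositive values.\<close>
    define t where "t = (if 0 < t\<^sub>1 then t\<^sub>1 else 1)"
    have t: "0 < t" by (simp add: t_def)
    \<comment> \<open>Built from quantities fixed before p; \<open>c3_check_dimension\<close> later
      gives p <= P.\<close>
    define P where "P = \<bar>t * \<nu> * \<kappa>\<^sub>0 / (640 * Lf * \<kappa>\<^sub>2)\<bar>"
    have P0: "0 \<le> P" by (simp add: P_def)
    define s0 s1 kd where defs: "s0 = 1 + \<sigma>\<^sub>0\<^sup>2" "s1 = \<sigma>\<^sub>1\<^sup>2" "kd = \<kappa>\<^sub>\<delta>\<^sup>2"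
    have nn: "0 \<le> s0" "0 \<le> s1" "0 \<le> kd" by (simp_all add: defs)
    define a1 a2 a3 b0 b1 b2 where coefs:
      "a1 = 8 * Lf\<^sup>2 * r\<^sup>2 + 32 * Lf\<^sup>2 * s0 * P * r\<^sup>2"
      "a2 = 2 * (r * Lf\<^sup>2 + 4 * Lf^3 * r\<^sup>2 / t + 8 * Lf^3 * s0 * P * r\<^sup>2 / t)"
      "a3 = 4 * Lf^3 * kd * r^3 + 2 * Lf^3 * P\<^sup>2 * kd * r^3"
      "b0 = K * r\<^sup>2 * real n * (2 * P\<^sup>2 * Lf\<^sup>2 * (kd * (r / t)) + 4 * P * (s0 * (8 * Lf * \<bar>gap\<bar>) + s1))"
      "b1 = K * r\<^sup>2 * real n * (32 * P * s0 * Lf)"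
      "b2 = K * r\<^sup>2 * real n * (16 * P * s0 * Lf\<^sup>2)"
    \<comment> \<open>The initial values are prescribed as arbitrary reals, so they too enter by
      absolute value until the data show them nonnegative.\<close>
    have coefs_nonneg: "0 \<le> a1" "0 \<le> a2" "0 \<le> a3" "0 \<le> b0" "0 \<le> b1" "0 \<le> b2" "0 \<le> P * r\<^sup>2 * Cb"
      "0 \<le> \<bar>f_gap0\<bar>" "0 \<le> real n * \<bar>cons0\<bar>"
      using nn P0 K r assms t Cb by (simp_all add: coefs)
    from coupled_recursion_rates[OF coefs_nonneg c t]
    obtain C2 C3 where C: "0 \<le> C2" "0 \<le> C3" and rates: "\<forall>A U q.
      A 0 = \<bar>f_gap0\<bar> \<and> U 0 = real n * \<bar>cons0\<bar> \<and> 0 \<le> q \<and> q \<le> P * r\<^sup>2 * Cb \<and>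
      (\<forall>k. 0 \<le> A k) \<and> (\<forall>k. 0 \<le> U k) \<and>
      (\<forall>k. A (Suc k) \<le> (1 - 16/3 / (real k + t) + a1 / (real k + t)\<^sup>2) * A k
          + a2 / (real k + t) * U k + q / (real k + t)\<^sup>2 + a3 / (real k + t)^3) \<and>
      (\<forall>k. U (Suc k) \<le> (1 - c) * U k + (b0 + b1 * A k + b2 * U k) / (real k + t)\<^sup>2) \<longrightarrow>
      (\<forall>T\<ge>1. A T \<le> q / real T + C2 / (real T)\<^sup>2 \<and> U T \<le> C3 / (real T)\<^sup>2)"
      by (elim exE conjE)
    show ?case
    proof (rule exI[of _ C2], rule conjI[OF C(1)], rule exI[of _ "2 * C3"], rule conjI, use C(2) in simp,
        intro allI impI, goal_cases)
      case (1 p F D \<delta> x0 M u \<xi> x v T)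
      let ?f = "global_obj n F D"
      let ?\<eta> = "eta_seq \<kappa>\<^sub>0 \<kappa>\<^sub>2 t\<^sub>1"
      note h = 1(1)
      have T: "1 \<le> T" by (rule 1(2))
      have p: "1 \<le> p" and so: "stochastic_objectives n p F D" and bd: "bdd_below (?f ` Rp p)"
        and sm': "\<forall>i<n. AE z in D i. smooth_fun p Lf (\<lambda>y. F i y z)"
        and bv: "bounded_variance n p F D \<sigma>\<^sub>0 \<sigma>\<^sub>1" and PL: "PL_condition p ?f \<nu>"
        and lb: "\<forall>i<n. bdd_below (local_obj F D i ` Rp p)"
        and c3: "c3_check p Lf \<sigma>\<^sub>0 \<nu> (laplacian n a) \<kappa>\<^sub>0 \<kappa>\<^sub>1 \<kappa>\<^sub>2 \<le> t\<^sub>1"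
        and \<delta>': "\<forall>i<n. \<forall>k. 0 < \<delta> i k \<and>
          \<delta> i k \<le> \<kappa>\<^sub>\<delta> * sqrt (real p * ?\<eta> k) / sqrt (real n + real p)"
        and x0: "\<forall>i<n. x0 i \<in> Rp p" and samp: "sampling n p D M u \<xi>"
        and it: "primal_dual_iterates n p (laplacian n a) F (alpha_seq \<kappa>\<^sub>0 \<kappa>\<^sub>1 t\<^sub>1) (beta_seq \<kappa>\<^sub>0 t\<^sub>1) ?\<eta> \<delta> x0 M u \<xi> x v"
        and gap: "infval p ?f - (\<Sum>i<n. infval p (local_obj F D i)) / real n = gap"
        and fg0: "?f (agent_mean n p x0) - infval p ?f = f_gap0" and cs0: "consensus_error n p x0 = cons0"
        using h by - (elim conjE, assumption)+
      have sm: "AE z in D i. smooth_fun p Lf (\<lambda>y. F i y z)" if "i < n" for i using sm' that by simp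
      have \<delta>: "0 < \<delta> i k" "\<delta> i k \<le> \<kappa>\<^sub>\<delta> * sqrt (real p * ?\<eta> k) / sqrt (real n + real p)" if "i < n" for i k
        using \<delta>' that by simp_all
      have t1: "0 < t\<^sub>1" using c3_check_pos[OF \<kappa>2(1) k2] c3 by (rule less_le_trans)
      then have tt: "t = t\<^sub>1" by (simp add: t_def)
      have pP: "real p \<le> P"
        using c3_check_dimension[OF assms(1,2) k0 _ \<kappa>2(1) r2 c3] k1 unfolding P_def tt by linarith
      have s_pos: "0 < real k + t\<^sub>1" for k using t1 by linarith
      have \<eta>: "?\<eta> k = r / (real k + t)" for k
        by (simp add: eta_seq_def beta_seq_def r_def tt)
      have "prob_space M" using samp by (simp add: sampling_def)
      then interpret prob_space M .
      interpret samples M n p D u \<xi>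
      proof (intro samples.intro samples_axioms.intro prob_space_axioms p samp)
        show "prob_space (D i)" if "i < n" for i using so that by (simp add: stochastic_objectives_def)
      qed
      interpret Z: zo_primal_dual M n p D u \<xi> E a F Lf \<sigma>\<^sub>0 \<sigma>\<^sub>1 \<nu> \<kappa>\<^sub>1 \<kappa>\<^sub>2 "alpha_seq \<kappa>\<^sub>0 \<kappa>\<^sub>1 t\<^sub>1" "beta_seq \<kappa>\<^sub>0 t\<^sub>1"
        ?\<eta> \<delta> x0 x v
      proof (intro zo_primal_dual.intro zo_primal_dual_axioms.intro samples_axioms)
        show "1 \<le> n" using n by simp
        show "network n E a" "0 < Lf" by fact+
        show "gradient_estimator (D i) p (F i) Lf \<sigma>\<^sub>0 \<sigma>\<^sub>1 (\<delta> i k)" if "i < n" for i k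
          by (rule gradient_estimatorI[OF so p assms(1) that sm[OF that] bv \<delta>(1)[OF that]])
        show "0 < ?\<eta> k" for k using k0 \<kappa>2 s_pos by (simp add: eta_seq_def beta_seq_def)
        have b0: "beta_seq \<kappa>\<^sub>0 t\<^sub>1 k \<noteq> 0" for k using k0 s_pos[of k] by (simp add: beta_seq_def)
        show "?\<eta> k * alpha_seq \<kappa>\<^sub>0 \<kappa>\<^sub>1 t\<^sub>1 k = \<kappa>\<^sub>1 * \<kappa>\<^sub>2" for k using b0 by (simp add: eta_seq_def alpha_seq_def)
        show "?\<eta> k * beta_seq \<kappa>\<^sub>0 t\<^sub>1 k = \<kappa>\<^sub>2" for k using b0 by (simp add: eta_seq_def)
        show "x0 i \<in> Rp p" "bdd_below (local_obj F D i ` Rp p)" if "i < n" for i using x0 lb that by simp_all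
      qed (rule it)
      define A where "A k = (\<integral>\<omega>. ?f (Z.xbar k \<omega>) \<partial>M) - infval p ?f" for k
      define U where "U k = (\<integral>\<omega>. Z.energy k \<omega> \<partial>M)" for k
      define W where "W k = (\<integral>\<omega>. Z.cons k \<omega> \<partial>M)" for k
      define dm where "dm k = kd * (real p * ?\<eta> k) / (real n + real p)" for k
      have A: "0 \<le> A k" for k unfolding A_def by (rule Z.f_gap_nonneg[OF bd])
      have W: "0 \<le> W k" "W k \<le> 2 * U k" for k
        unfolding W_def U_def by (rule Z.mean_cons_nonneg) (rule Z.mean_cons_le[OF lyap_ge])
      have U: "0 \<le> U k" for k using W[of k] by linarith
      have gap0: "0 \<le> gap" "Z.flow = infval p ?f - gap"
        using Z.flow_le_infval gap by (simp_all add: Z.flow_def)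
      have dm: "(\<delta> i k)\<^sup>2 \<le> dm k" if "i < n" for i k
      proof -
        have "0 \<le> ?\<eta> k" using Z.\<eta>[of k] by simp
        have "(\<delta> i k)\<^sup>2 \<le> (\<kappa>\<^sub>\<delta> * sqrt (real p * ?\<eta> k) / sqrt (real n + real p))\<^sup>2"
          using \<delta>[OF that, of k] by (intro power_mono) auto
        also have "\<dots> = dm k"
          using \<open>0 \<le> ?\<eta> k\<close> by (simp add: dm_def defs power_divide power_mult_distrib)
        finally show ?thesis .
      qed
      have g: "Z.gvar k \<le> 2 * (real p)\<^sup>2 * Lf\<^sup>2 * dm k
          + 4 * real p * (s0 * (8 * Lf * (A k + gap) + 2 * Lf\<^sup>2 * W k) + s1)" for k
      proof -
        have "(\<integral>\<omega>. ?f (Z.xbar k \<omega>) \<partial>M) - Z.flow = A k + gap" by (simp add: A_def gap0(2))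
        then show ?thesis using Z.gvar_le[of k "dm k", OF dm] by (simp only: W_def defs)
      qed
      have ts: "t \<le> real k + t" for k by simp
      have n1: "1 \<le> real n" using n by simp
      \<comment> \<open>Here p / n is kept exactly; P serves only for the uniform bound on
        q.\<close>
      define q where "q = real p / real n * r\<^sup>2 * (Lf\<^sup>2 * kd + 32 * Lf\<^sup>2 * s0 * gap + 4 * Lf * s1)"
      have q_Cb: "q = real p / real n * r\<^sup>2 * Cb" using gap0 by (simp add: q_def Cb_def defs)
      have q: "0 \<le> q" "q \<le> P * r\<^sup>2 * Cb"
      proof -
        show "0 \<le> q" using Cb by (simp add: q_Cb)
        have "real p / real n \<le> real p / 1" using n1 by (intro divide_left_mono) auto
        then show "q \<le> P * r\<^sup>2 * Cb" unfolding q_Cb using pP Cb by (intro mult_right_mono) auto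
      qed
      have rA: "A (Suc k) \<le> (1 - 16/3 / (real k + t) + a1 / (real k + t)\<^sup>2) * A k
          + a2 / (real k + t) * U k + q / (real k + t)\<^sup>2 + a3 / (real k + t)^3" for k
        unfolding coefs q_def
        by (rule descent_coefficients[OF t ts A U W n1 _ pP r(1,2) assms(1) gap0(1) nn(3,1,2) \<eta> dm_def g])
           (use Z.descent_step[OF PL bd dm, of k] in \<open>simp_all add: A_def W_def\<close>)
      have rU: "U (Suc k) \<le> (1 - c) * U k + (b0 + b1 * A k + b2 * U k) / (real k + t)\<^sup>2" for k
        unfolding coefs abs_of_nonneg[OF gap0(1)]
      proof (rule energy_coefficients[OF t ts A U W n1 _ pP r(1) assms(1) K gap0(1) nn(3,1,2) \<eta> dm_def g])
        show "U (Suc k) \<le> (1 - c) * U k + K * (?\<eta> k)\<^sup>2 * (real n * Z.gvar k)"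
          unfolding U_def by (rule Z.energy_step[OF c(2) K]) (rule contr)
      qed simp
      have "0 \<le> f_gap0" using infval_le[OF bd agent_mean_Rp, of n x0] fg0 by simp
      then have A0: "A 0 = \<bar>f_gap0\<bar>" using fg0 by (simp add: A_def Z.f_xbar_0)
      have "0 \<le> cons0" unfolding cs0[symmetric] consensus_error_def by (intro divide_nonneg_nonneg sum_nonneg) auto
      then have U0: "U 0 = real n * \<bar>cons0\<bar>" using cs0 by (simp add: U_def Z.mean_energy_0)
      have R: "A T \<le> q / real T + C2 / (real T)\<^sup>2 \<and> U T \<le> C3 / (real T)\<^sup>2"
        by (rule rates[rule_format, of A U q T, OF _ T]) (intro conjI allI A0 U0 q A U rA rU)
      have T0: "0 < (real T)\<^sup>2" using T by simp
      \<comment> \<open>The recursion gives constants over T^2 without p; as p >= 1, the factor p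
        may be inserted.\<close>
      have le_p: "y / (real T)\<^sup>2 \<le> y * (real p / (real T)\<^sup>2)" if "0 \<le> y" for y
      proof -
        have "y * 1 \<le> y * real p" using that p by (intro mult_left_mono) auto
        then show ?thesis using T0 by (simp add: divide_right_mono)
      qed
      have fT: "(\<lambda>\<omega>. ?f (agent_mean n p (\<lambda>i. x i T \<omega>)) - infval p ?f) = (\<lambda>\<omega>. ?f (Z.xbar T \<omega>) - infval p ?f)"
        by (simp add: Z.xbar_def)
      have cT: "(\<lambda>\<omega>. consensus_error n p (\<lambda>i. x i T \<omega>)) = Z.cons T" by (simp add: Z.cons_def fun_eq_iff)
      have "W T \<le> 2 * (C3 / (real T)\<^sup>2)" using W(2)[of T] R by linarith
      also have "\<dots> \<le> 2 * C3 * (real p / (real T)\<^sup>2)" using le_p[OF C(2)] by simp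
      finally have WT: "(\<integral>\<omega>. Z.cons T \<omega> \<partial>M) \<le> 2 * C3 * (real p / (real T)\<^sup>2)" by (simp add: W_def)
      have "q / real T \<le> R\<^sup>2 * Cb * (real p / (real n * real T))"
      proof -
        have "r\<^sup>2 \<le> R\<^sup>2" using r by (intro power_mono) auto
        then have "r\<^sup>2 * (Cb * (real p / (real n * real T))) \<le> R\<^sup>2 * (Cb * (real p / (real n * real T)))"
          using Cb by (intro mult_right_mono) auto
        then show ?thesis by (simp add: q_Cb ac_simps)
      qed
      then have AT: "(\<integral>\<omega>. ?f (Z.xbar T \<omega>) - infval p ?f \<partial>M)
          \<le> R\<^sup>2 * Cb * (real p / (real n * real T)) + C2 * (real p / (real T)\<^sup>2)"
        using R le_p[OF C(1)] Z.f_xbar_integrable by (simp add: A_def prob_space)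
      show ?case
        unfolding fT cT using Z.cons_integrable[of T] Z.f_xbar_integrable[of T] WT AT by simp
    qed
  qed
qed

end
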